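(* Let $p$ be a prime, let $m \in \mathbb{N}$, and let $G_p$ be Grigorchuk's $2$-group if $p=2$ and the Gupta–Sidki $p$-group if $p \geq 3$. Then the restricted wreath product $\mathbb{Z}^m \wr G_p$ is $p$-conjugacy separable.
   Context: A group $G$ is $p$-conjugacy separable if for every pair of non-conjugate elements $g,h \in G$ there is a surjective homomorphism $\pi \colon G \to Q$ onto a finite $p$-group $Q$ such that $\pi(g)$ and $\pi(h)$ are not conjugate in $Q$. The restricted wreath product is $A \wr B = \left(\bigoplus_{b \in B} A\right) \rtimes B$ with $B$ acting by $(b\cdot f)(x) = f(b^{-1}x)$ on finitely supported functions $f\colon B\to A$. Standard definitions: for automorphisms $g_1,\dots,g_p$ of the rooted $p$-regular tree, $(g_1,\dots,g_p)$ denotes the automorphism fixing the first level and acting as $g_i$ on the $i$-th first-level subtree. Grigorchuk's $2$-group is the group of automorphisms of the rooted binary tree generated by $a,b,c,d$, where $a$ swaps the two first-level subtrees and $b = (a,c)$, $c=(a,d)$, $d=(1,b)$. For $p \ge 3$, the Gupta–Sidki $p$-group is the group of automorphisms of the rooted $p$-regular tree generated by $a$, which cyclically permutes the $p$ first-level subtrees, and $t = (a,a^{-1},1,\dots,1,t)$. *)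

theory Defs
  imports "HOL-Algebra.Algebra" "HOL-Library.Sublist" "HOL-Computational_Algebra.Primes"
begin

section \<open>Conjugacy separability\<close>

definition conjugate_in :: "('a, 'b) monoid_scheme \<Rightarrow> 'a \<Rightarrow> 'a \<Rightarrow> bool" where
  "conjugate_in G g h \<longleftrightarrow> (\<exists>x\<in>carrier G. h = x \<otimes>\<^bsub>G\<^esub> g \<otimes>\<^bsub>G\<^esub> inv\<^bsub>G\<^esub> x)"

definition finite_p_group :: "nat \<Rightarrow> ('a, 'b) monoid_scheme \<Rightarrow> bool" where
  "finite_p_group p Q \<longleftrightarrow> group Q \<and> finite (carrier Q) \<and> (\<exists>k. order Q = p ^ k)"

text \<open>
  HOL has no quantification over types inside a formula, so the finite quotients are taken with
  underlying type \<open>nat\<close>. As every finite group has an isomorphic copy there, this is no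
  restriction: see \<open>p_conjugacy_separableI\<close> below, where the quotients have an arbitrary type.
\<close>

definition p_conjugacy_separable :: "nat \<Rightarrow> ('a, 'b) monoid_scheme \<Rightarrow> bool" where
  "p_conjugacy_separable p G \<longleftrightarrow>
     group G \<and>
     (\<forall>g\<in>carrier G. \<forall>h\<in>carrier G. \<not> conjugate_in G g h \<longrightarrow>
        (\<exists>(Q :: nat monoid) \<pi>. finite_p_group p Q \<and> \<pi> \<in> epi G Q \<and>
           \<not> conjugate_in Q (\<pi> g) (\<pi> h)))"

lemma finite_p_group_nat_copy:
  fixes Q :: "('c, 'd) monoid_scheme"
  assumes Q: "finite_p_group p Q" and pi: "\<pi> \<in> epi G Q" and G: "group G"
    and gh: "g \<in> carrier G" "h \<in> carrier G" "\<not> conjugate_in Q (\<pi> g) (\<pi> h)"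
  shows "\<exists>(Q' :: nat monoid) \<pi>'. finite_p_group p Q' \<and> \<pi>' \<in> epi G Q' \<and>
           \<not> conjugate_in Q' (\<pi>' g) (\<pi>' h)"
proof -
  interpret Q: group Q using Q by (simp add: finite_p_group_def)
  obtain e :: "'c \<Rightarrow> nat" where e: "inj_on e (carrier Q)"
    using Q finite_imp_inj_to_nat_seg[of "carrier Q"] by (auto simp: finite_p_group_def)
  define d where "d = inv_into (carrier Q) e"
  have d[simp]: "d (e x) = x" if "x \<in> carrier Q" for x
    using e that by (simp add: d_def)
  define Q' :: "nat monoid" where
    "Q' = \<lparr>carrier = e ` carrier Q, monoid.mult = (\<lambda>x y. e (d x \<otimes>\<^bsub>Q\<^esub> d y)), one = e \<one>\<^bsub>Q\<^esub>\<rparr>"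
  have grp: "group Q'"
  proof (rule groupI)
    fix x assume "x \<in> carrier Q'"
    then obtain y where y: "x = e y" "y \<in> carrier Q" by (auto simp: Q'_def)
    show "\<exists>z\<in>carrier Q'. z \<otimes>\<^bsub>Q'\<^esub> x = \<one>\<^bsub>Q'\<^esub>"
      by (rule bexI[of _ "e (inv\<^bsub>Q\<^esub> y)"]) (use y in \<open>auto simp: Q'_def\<close>)
  qed (auto simp: Q'_def Q.m_assoc)
  have iso: "e \<in> iso Q Q'"
    using e by (auto simp: iso_def hom_def bij_betw_def Q'_def)
  have ord: "order Q' = order Q"
    using e by (simp add: order_def Q'_def card_image)
  have hom: "group_hom Q Q' e"
    using iso grp Q.is_group by (simp add: group_hom_def group_hom_axioms_def iso_def)
  have pig: "\<pi> g \<in> carrier Q" "\<pi> h \<in> carrier Q"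
    using pi gh by (auto simp: epi_def)
  have "finite_p_group p Q'"
    using Q grp ord by (simp add: finite_p_group_def) (simp add: Q'_def)
  moreover have "e \<circ> \<pi> \<in> epi G Q'"
  proof -
    have "(e \<circ> \<pi>) ` carrier G = carrier Q'"
      using pi unfolding image_comp[symmetric] by (simp add: epi_def Q'_def)
    moreover have "e \<circ> \<pi> \<in> hom G Q'"
      using pi iso by (auto simp: epi_def iso_def intro: hom_compose)
    ultimately show ?thesis by (simp add: epi_def)
  qed
  moreover have "\<not> conjugate_in Q' ((e \<circ> \<pi>) g) ((e \<circ> \<pi>) h)"
  proof
    assume "conjugate_in Q' ((e \<circ> \<pi>) g) ((e \<circ> \<pi>) h)"
    then obtain x where x: "x \<in> carrier Q" and
      eq: "e (\<pi> h) = e x \<otimes>\<^bsub>Q'\<^esub> e (\<pi> g) \<otimes>\<^bsub>Q'\<^esub> inv\<^bsub>Q'\<^esub> e x"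
      by (auto simp: conjugate_in_def Q'_def)
    note eq
    also have "e x \<otimes>\<^bsub>Q'\<^esub> e (\<pi> g) \<otimes>\<^bsub>Q'\<^esub> inv\<^bsub>Q'\<^esub> e x = e (x \<otimes>\<^bsub>Q\<^esub> \<pi> g \<otimes>\<^bsub>Q\<^esub> inv\<^bsub>Q\<^esub> x)"
      using hom x pig by (simp add: group_hom.hom_mult group_hom.hom_inv)
    finally have "\<pi> h = x \<otimes>\<^bsub>Q\<^esub> \<pi> g \<otimes>\<^bsub>Q\<^esub> inv\<^bsub>Q\<^esub> x"
      using e x pig by (auto dest: inj_onD)
    then show False using gh x by (auto simp: conjugate_in_def)
  qed
  ultimately show ?thesis by blast
qed

lemma p_conjugacy_separableI:
  assumes "group G"
    and "\<And>g h. g \<in> carrier G \<Longrightarrow> h \<in> carrier G \<Longrightarrow> \<not> conjugate_in G g h \<Longrightarrow>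
           \<exists>(Q :: 'c monoid) \<pi>. finite_p_group p Q \<and> \<pi> \<in> epi G Q \<and>
             \<not> conjugate_in Q (\<pi> g) (\<pi> h)"
  shows "p_conjugacy_separable p G"
  unfolding p_conjugacy_separable_def
  using assms(1) assms(2) finite_p_group_nat_copy[OF _ _ assms(1)] by metis


section \<open>Restricted wreath products\<close>

definition semidirect_product ::
  "('a, 'c) monoid_scheme \<Rightarrow> ('b, 'd) monoid_scheme \<Rightarrow> ('b \<Rightarrow> 'a \<Rightarrow> 'a) \<Rightarrow> ('a \<times> 'b) monoid" where
  "semidirect_product N H \<phi> =
     \<lparr>carrier = carrier N \<times> carrier H,
      monoid.mult = (\<lambda>(n, h) (n', h'). (n \<otimes>\<^bsub>N\<^esub> \<phi> h n', h \<otimes>\<^bsub>H\<^esub> h')),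
      one = (\<one>\<^bsub>N\<^esub>, \<one>\<^bsub>H\<^esub>)\<rparr>"

definition shift_action ::
  "('b, 'd) monoid_scheme \<Rightarrow> 'b \<Rightarrow> ('b \<Rightarrow> 'a) \<Rightarrow> 'b \<Rightarrow> 'a" where
  "shift_action B b f = (\<lambda>x\<in>carrier B. f (inv\<^bsub>B\<^esub> b \<otimes>\<^bsub>B\<^esub> x))"

definition wreath_product ::
  "('a, 'c) monoid_scheme \<Rightarrow> ('b, 'd) monoid_scheme \<Rightarrow> (('b \<Rightarrow> 'a) \<times> 'b) monoid" where
  "wreath_product A B =
     semidirect_product (sum_group (carrier B) (\<lambda>_. A)) B (shift_action B)"

lemma group_semidirect_product:
  assumes "group N" "group H"
    and hom: "\<And>h. h \<in> carrier H \<Longrightarrow> \<phi> h \<in> hom N N"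
    and one: "\<And>n. n \<in> carrier N \<Longrightarrow> \<phi> \<one>\<^bsub>H\<^esub> n = n"
    and mult: "\<And>h h' n. h \<in> carrier H \<Longrightarrow> h' \<in> carrier H \<Longrightarrow> n \<in> carrier N \<Longrightarrow>
                 \<phi> (h \<otimes>\<^bsub>H\<^esub> h') n = \<phi> h (\<phi> h' n)"
  shows "group (semidirect_product N H \<phi>)"
proof -
  interpret N: group N by fact
  interpret H: group H by fact
  have closed[simp]: "\<phi> h n \<in> carrier N" if "h \<in> carrier H" "n \<in> carrier N" for h n
    using hom[OF that(1)] that(2) by (rule hom_in_carrier)
  have hm[simp]: "\<phi> h (n \<otimes>\<^bsub>N\<^esub> n') = \<phi> h n \<otimes>\<^bsub>N\<^esub> \<phi> h n'"
    if "h \<in> carrier H" "n \<in> carrier N" "n' \<in> carrier N" for h n n'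
    using hom[OF that(1)] that(2,3) by (rule hom_mult)
  show ?thesis
  proof (rule groupI)
    fix x assume "x \<in> carrier (semidirect_product N H \<phi>)"
    then obtain n h where x: "x = (n, h)" "n \<in> carrier N" "h \<in> carrier H"
      by (auto simp: semidirect_product_def)
    show "\<exists>y\<in>carrier (semidirect_product N H \<phi>).
            y \<otimes>\<^bsub>semidirect_product N H \<phi>\<^esub> x = \<one>\<^bsub>semidirect_product N H \<phi>\<^esub>"
      by (rule bexI[of _ "(inv\<^bsub>N\<^esub> (\<phi> (inv\<^bsub>H\<^esub> h) n), inv\<^bsub>H\<^esub> h)"])
         (use x in \<open>auto simp: semidirect_product_def\<close>)
  qed (auto simp: semidirect_product_def N.m_assoc H.m_assoc mult one)
qed

lemma group_wreath_product:
  assumes "group A" "group B"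
  shows "group (wreath_product A B)"
proof -
  interpret A: group A by fact
  interpret B: group B by fact
  let ?N = "sum_group (carrier B) (\<lambda>_. A)"
  have supp: "finite {x \<in> carrier B. shift_action B b f x \<noteq> \<one>\<^bsub>A\<^esub>}"
    if "b \<in> carrier B" "finite {x \<in> carrier B. f x \<noteq> \<one>\<^bsub>A\<^esub>}" for b f
  proof (rule finite_subset)
    show "{x \<in> carrier B. shift_action B b f x \<noteq> \<one>\<^bsub>A\<^esub>}
            \<subseteq> (\<lambda>x. b \<otimes>\<^bsub>B\<^esub> x) ` {x \<in> carrier B. f x \<noteq> \<one>\<^bsub>A\<^esub>}"
    proof
      fix x assume "x \<in> {x \<in> carrier B. shift_action B b f x \<noteq> \<one>\<^bsub>A\<^esub>}"
      then show "x \<in> (\<lambda>x. b \<otimes>\<^bsub>B\<^esub> x) ` {x \<in> carrier B. f x \<noteq> \<one>\<^bsub>A\<^esub>}"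
        using that(1)
        by (intro image_eqI[of _ _ "inv\<^bsub>B\<^esub> b \<otimes>\<^bsub>B\<^esub> x"])
           (auto simp: shift_action_def B.m_assoc[symmetric])
    qed
  qed (use that in auto)
  have act: "shift_action B b f \<in> carrier ?N" if "b \<in> carrier B" "f \<in> carrier ?N" for b f
    using that supp[of b f] by (auto simp: carrier_sum_group) (auto simp: shift_action_def)
  show ?thesis
    unfolding wreath_product_def
  proof (rule group_semidirect_product)
    show "shift_action B b \<in> hom ?N ?N" if "b \<in> carrier B" for b
      using that act by (auto simp: hom_def) (auto simp: shift_action_def fun_eq_iff)
    show "shift_action B \<one>\<^bsub>B\<^esub> n = n" if "n \<in> carrier ?N" for n
    proof
      have ext: "n \<in> extensional (carrier B)"
        using that by (simp add: carrier_sum_group PiE_def)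
      show "shift_action B \<one>\<^bsub>B\<^esub> n x = n x" for x
        by (cases "x \<in> carrier B") (simp_all add: shift_action_def extensional_arb[OF ext])
    qed
    show "shift_action B (h \<otimes>\<^bsub>B\<^esub> h') n = shift_action B h (shift_action B h' n)"
      if "h \<in> carrier B" "h' \<in> carrier B" for h h' n
    proof
      show "shift_action B (h \<otimes>\<^bsub>B\<^esub> h') n x = shift_action B h (shift_action B h' n) x" for x
        by (cases "x \<in> carrier B") (simp_all add: shift_action_def that B.m_assoc B.inv_mult_group)
    qed
  qed (use assms in auto)
qed


section \<open>The rooted regular tree and its automorphisms\<close>

text \<open>
  The vertices are the words over \<open>{0, \<dots>, p - 1}\<close>; the root is the empty word and the
  subtree at the first-level vertex \<open>[x]\<close> consists of the words with head \<open>x\<close>.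
  A rooted tree automorphism is a bijection that preserves and reflects the ancestor relation.
\<close>

definition regular_tree :: "nat \<Rightarrow> nat list set" where
  "regular_tree p = lists {..<p}"

definition tree_aut :: "nat \<Rightarrow> (nat list \<Rightarrow> nat list) set" where
  "tree_aut p = {f \<in> Bij (regular_tree p).
     \<forall>u\<in>regular_tree p. \<forall>v\<in>regular_tree p. prefix (f u) (f v) \<longleftrightarrow> prefix u v}"

definition tree_aut_group :: "nat \<Rightarrow> (nat list \<Rightarrow> nat list) monoid" where
  "tree_aut_group p = (BijGroup (regular_tree p))\<lparr>carrier := tree_aut p\<rparr>"

text \<open>The automorphism \<open>(g\<^sub>1, \<dots>, g\<^sub>p)\<close>; the list is indexed from \<open>0\<close>.\<close>

definition level_tuple :: "nat \<Rightarrow> (nat list \<Rightarrow> nat list) list \<Rightarrow> nat list \<Rightarrow> nat list" where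
  "level_tuple p gs = (\<lambda>w\<in>regular_tree p. case w of [] \<Rightarrow> [] | x # u \<Rightarrow> x # (gs ! x) u)"

definition rooted_cycle :: "nat \<Rightarrow> nat list \<Rightarrow> nat list" where
  "rooted_cycle p = (\<lambda>w\<in>regular_tree p. case w of [] \<Rightarrow> [] | x # u \<Rightarrow> (Suc x mod p) # u)"


section \<open>Grigorchuk's group and the Gupta--Sidki groups\<close>

text \<open>
  The self-referential generators are first defined by recursion on words and then restricted to
  the tree; the equations \<open>b = (a, c)\<close>, \<open>c = (a, d)\<close>, \<open>d = (1, b)\<close> and
  \<open>t = (a, a\<^sup>-\<^sup>1, 1, \<dots>, 1, t)\<close> are derived below.
\<close>

fun grig_b_word grig_c_word grig_d_word :: "nat list \<Rightarrow> nat list" where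
  "grig_b_word [] = []"
| "grig_b_word (x # w) = x # (if x = 0 then rooted_cycle 2 w else grig_c_word w)"
| "grig_c_word [] = []"
| "grig_c_word (x # w) = x # (if x = 0 then rooted_cycle 2 w else grig_d_word w)"
| "grig_d_word [] = []"
| "grig_d_word (x # w) = x # (if x = 0 then w else grig_b_word w)"

definition grig_a where "grig_a = rooted_cycle 2"
definition grig_b where "grig_b = restrict grig_b_word (regular_tree 2)"
definition grig_c where "grig_c = restrict grig_c_word (regular_tree 2)"
definition grig_d where "grig_d = restrict grig_d_word (regular_tree 2)"

definition grigorchuk_group :: "(nat list \<Rightarrow> nat list) monoid" where
  "grigorchuk_group = subgroup_generated (tree_aut_group 2) {grig_a, grig_b, grig_c, grig_d}"

fun gs_t_word :: "nat \<Rightarrow> nat list \<Rightarrow> nat list" where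
  "gs_t_word p [] = []"
| "gs_t_word p (x # w) = x #
     (if x = 0 then rooted_cycle p w
      else if x = 1 then (inv\<^bsub>tree_aut_group p\<^esub> (rooted_cycle p)) w
      else if x = p - 1 then gs_t_word p w
      else w)"

definition gs_a where "gs_a p = rooted_cycle p"
definition gs_t where "gs_t p = restrict (gs_t_word p) (regular_tree p)"

definition gupta_sidki_group :: "nat \<Rightarrow> (nat list \<Rightarrow> nat list) monoid" where
  "gupta_sidki_group p = subgroup_generated (tree_aut_group p) {gs_a p, gs_t p}"


subsection \<open>The generators are tree automorphisms satisfying the defining equations\<close>

lemma regular_tree_Nil[simp]: "[] \<in> regular_tree p"
  and regular_tree_Cons[simp]: "x # w \<in> regular_tree p \<longleftrightarrow> x < p \<and> w \<in> regular_tree p"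
  and regular_tree_take: "w \<in> regular_tree p \<Longrightarrow> take n w \<in> regular_tree p"
  by (auto simp: regular_tree_def dest: in_set_takeD)

lemma subgroup_tree_aut: "subgroup (tree_aut p) (BijGroup (regular_tree p))"
proof -
  let ?T = "regular_tree p"
  interpret B: group "BijGroup ?T" by (rule group_BijGroup)
  show ?thesis
  proof (rule B.subgroupI)
    show "tree_aut p \<subseteq> carrier (BijGroup ?T)" by (auto simp: tree_aut_def BijGroup_def)
    have "(\<lambda>x\<in>?T. x) \<in> tree_aut p" by (auto simp: tree_aut_def id_Bij)
    then show "tree_aut p \<noteq> {}" by blast
  next
    fix f assume f: "f \<in> tree_aut p"
    then have fB: "f \<in> Bij ?T" by (simp add: tree_aut_def)
    then have surj: "f ` ?T = ?T" by (simp add: Bij_def bij_betw_def)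
    have i: "inv\<^bsub>BijGroup ?T\<^esub> f = (\<lambda>x\<in>?T. inv_into ?T f x)"
      using fB by (rule inv_BijGroup)
    have "prefix (inv_into ?T f u) (inv_into ?T f v) \<longleftrightarrow> prefix u v"
      if uv: "u \<in> ?T" "v \<in> ?T" for u v
    proof -
      have "inv_into ?T f u \<in> ?T" "inv_into ?T f v \<in> ?T"
        using uv surj by (metis inv_into_into)+
      moreover have "f (inv_into ?T f u) = u" "f (inv_into ?T f v) = v"
        using uv surj by (simp_all add: f_inv_into_f)
      moreover have "prefix (f (inv_into ?T f u)) (f (inv_into ?T f v)) \<longleftrightarrow>
                       prefix (inv_into ?T f u) (inv_into ?T f v)"
        using f calculation(1,2) unfolding tree_aut_def by blast
      ultimately show ?thesis by simp
    qed
    then show "inv\<^bsub>BijGroup ?T\<^esub> f \<in> tree_aut p"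
      using restrict_inv_into_Bij[OF fB] by (simp add: i tree_aut_def)
  next
    fix f g assume fg: "f \<in> tree_aut p" "g \<in> tree_aut p"
    then have B: "f \<in> Bij ?T" "g \<in> Bij ?T" by (simp_all add: tree_aut_def)
    then show "f \<otimes>\<^bsub>BijGroup ?T\<^esub> g \<in> tree_aut p"
      using fg compose_Bij[OF B] Bij_imp_funcset[OF B(2)]
      by (simp add: BijGroup_def tree_aut_def compose_eq Pi_iff)
  qed
qed

lemma group_tree_aut_group: "group (tree_aut_group p)"
  unfolding tree_aut_group_def
  by (rule subgroup.subgroup_is_group[OF subgroup_tree_aut group_BijGroup])

lemma one_tree_aut_group: "\<one>\<^bsub>tree_aut_group p\<^esub> = (\<lambda>w\<in>regular_tree p. w)"
  by (simp add: tree_aut_group_def BijGroup_def)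

lemma tree_autI:
  assumes ext: "f \<in> extensional (regular_tree p)"
    and closed: "\<And>w. w \<in> regular_tree p \<Longrightarrow> f w \<in> regular_tree p"
    and inj: "\<And>v w. v \<in> regular_tree p \<Longrightarrow> w \<in> regular_tree p \<Longrightarrow> f v = f w \<Longrightarrow> v = w"
    and surj: "\<And>w. w \<in> regular_tree p \<Longrightarrow> \<exists>v\<in>regular_tree p. f v = w"
    and len: "\<And>w. w \<in> regular_tree p \<Longrightarrow> length (f w) = length w"
    and take: "\<And>w n. w \<in> regular_tree p \<Longrightarrow> f (take n w) = take n (f w)"
  shows "f \<in> tree_aut p"
proof -
  have pre: "prefix x y \<longleftrightarrow> x = take (length x) y" for x y :: "nat list"
    by (metis append_eq_conv_conj prefix_def take_is_prefix)
  have "bij_betw f (regular_tree p) (regular_tree p)"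
    unfolding bij_betw_def using closed inj surj by (auto simp: inj_on_def) (metis image_iff)
  moreover have "prefix (f u) (f v) \<longleftrightarrow> prefix u v"
    if "u \<in> regular_tree p" "v \<in> regular_tree p" for u v
    unfolding pre len[OF that(1)] take[OF that(2), symmetric]
    using inj[OF that(1) regular_tree_take[OF that(2)], of "length u"] by metis
  ultimately show ?thesis using ext by (simp add: tree_aut_def Bij_def)
qed

lemma tree_aut_props:
  assumes f: "f \<in> tree_aut p"
  shows "w \<in> regular_tree p \<Longrightarrow> f w \<in> regular_tree p"
    and "v \<in> regular_tree p \<Longrightarrow> w \<in> regular_tree p \<Longrightarrow> f v = f w \<Longrightarrow> v = w"
    and "w \<in> regular_tree p \<Longrightarrow> \<exists>v\<in>regular_tree p. f v = w"
    and "w \<in> regular_tree p \<Longrightarrow> length (f w) = length w"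
    and "w \<in> regular_tree p \<Longrightarrow> f (take n w) = take n (f w)"
proof -
  have b: "bij_betw f (regular_tree p) (regular_tree p)"
    and pr: "\<And>u v. u \<in> regular_tree p \<Longrightarrow> v \<in> regular_tree p \<Longrightarrow>
               prefix (f u) (f v) \<longleftrightarrow> prefix u v"
    using f by (auto simp: tree_aut_def Bij_def)
  show c: "f w \<in> regular_tree p" if "w \<in> regular_tree p" for w
    using b that by (auto simp: bij_betw_def)
  show "v \<in> regular_tree p \<Longrightarrow> w \<in> regular_tree p \<Longrightarrow> f v = f w \<Longrightarrow> v = w" for v w
    using b by (auto simp: bij_betw_def inj_on_def)
  show s: "\<exists>v\<in>regular_tree p. f v = w" if "w \<in> regular_tree p" for w
    using b that by (force simp: bij_betw_def)
  have pt: "u \<in> regular_tree p" if "prefix u w" "w \<in> regular_tree p" for u w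
    using that by (auto simp: regular_tree_def prefix_def)
  have pf: "{u. prefix u (f w)} = f ` {u. prefix u w}" if w: "w \<in> regular_tree p" for w
  proof safe
    fix u assume u: "prefix u (f w)"
    then obtain v where "v \<in> regular_tree p" "f v = u" using s pt c w by blast
    then show "u \<in> f ` {u. prefix u w}" using u pr w by blast
  qed (use pr pt w in blast)
  have cp: "card {u. prefix u (w :: nat list)} = Suc (length w)" for w
  proof -
    have "{u. prefix u w} = set (prefixes w)" by auto
    then show ?thesis by (simp add: distinct_card)
  qed
  show l: "length (f w) = length w" if w: "w \<in> regular_tree p" for w
  proof -
    have "inj_on f {u. prefix u w}"
      by (rule inj_on_subset[of f "regular_tree p"]) (use b pt w in \<open>auto simp: bij_betw_def\<close>)
    then have "card {u. prefix u (f w)} = card {u. prefix u w}"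
      unfolding pf[OF w] by (rule card_image)
    then show ?thesis by (simp add: cp)
  qed
  show "f (take n w) = take n (f w)" if w: "w \<in> regular_tree p" for w n
  proof -
    have "prefix (f (take n w)) (f w)"
      using pr[OF regular_tree_take[OF w] w] by (simp add: take_is_prefix)
    then have "f (take n w) = take (length (f (take n w))) (f w)"
      by (metis append_eq_conv_conj prefix_def)
    then show ?thesis
      using l[OF w] l[OF regular_tree_take[OF w], of n] by (simp add: min_def split: if_splits)
  qed
qed

lemma self_similar_aut:
  assumes F: "\<And>f. f \<in> F \<Longrightarrow> \<exists>gs. length gs = p \<and> set gs \<subseteq> F \<union> tree_aut p \<and> f = level_tuple p gs"
  shows "F \<subseteq> tree_aut p"
proof
  let ?T = "regular_tree p"
  have E: "f [] = [] \<and> (\<exists>gs. \<forall>x<p. gs ! x \<in> F \<union> tree_aut p \<and> (\<forall>u\<in>?T. f (x # u) = x # (gs ! x) u))"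
    if f: "f \<in> F" for f
  proof -
    obtain gs where gs: "length gs = p" "set gs \<subseteq> F \<union> tree_aut p" "f = level_tuple p gs"
      using F[OF f] by blast
    have "gs ! x \<in> F \<union> tree_aut p" if "x < p" for x
      using gs(1,2) that nth_mem[of x gs] by blast
    moreover have "\<forall>u\<in>?T. f (x # u) = x # (gs ! x) u" if "x < p" for x
      using gs(3) that by (auto simp: level_tuple_def)
    moreover have "f [] = []" using gs(3) by (simp add: level_tuple_def)
    ultimately show ?thesis by blast
  qed
  have *: "f w \<in> ?T \<and> length (f w) = length w \<and> (\<exists>v\<in>?T. f v = w) \<and>
          (\<forall>n. f (take n w) = take n (f w)) \<and> (\<forall>v\<in>?T. f v = f w \<longrightarrow> v = w)"
    if "w \<in> ?T" "f \<in> F \<union> tree_aut p" for f w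
    using that
  proof (induction w arbitrary: f)
    case Nil
    show ?case
    proof (cases "f \<in> tree_aut p")
      case True
      show ?thesis using tree_aut_props[OF True] Nil(1) by blast
    next
      case False
      then have f: "f \<in> F" using Nil by blast
      obtain gs where gs: "f [] = []" "\<forall>x<p. \<forall>u\<in>?T. f (x # u) = x # (gs ! x) u"
        using E[OF f] by blast
      have "v = []" if "v \<in> ?T" "f v = []" for v
        using that gs(2) by (cases v) auto
      then show ?thesis using gs(1) by (auto intro!: bexI[of _ "[]"])
    qed
  next
    case (Cons x w)
    show ?case
    proof (cases "f \<in> tree_aut p")
      case True
      show ?thesis using tree_aut_props[OF True] Cons.prems(1) by blast
    next
      case False
      then have f: "f \<in> F" using Cons.prems by blast
      obtain gs where nil: "f [] = []" and mem: "\<And>x. x < p \<Longrightarrow> gs ! x \<in> F \<union> tree_aut p"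
        and eq: "\<And>x u. x < p \<Longrightarrow> u \<in> ?T \<Longrightarrow> f (x # u) = x # (gs ! x) u"
        using E[OF f] by blast
      have x: "x < p" and w: "w \<in> ?T" using Cons.prems(1) by auto
      note IH = Cons.IH[OF w mem[OF x]]
      have 1: "f (x # w) \<in> ?T" "length (f (x # w)) = length (x # w)"
        using IH x w by (auto simp: eq)
      obtain v where "v \<in> ?T" "(gs ! x) v = w" using IH by blast
      then have 2: "\<exists>v\<in>?T. f v = x # w"
        using x by (intro bexI[of _ "x # v"]) (auto simp: eq)
      have 3: "f (take n (x # w)) = take n (f (x # w))" for n
        using IH x w regular_tree_take[OF w] by (cases n) (auto simp: eq nil)
      have 4: "v = x # w" if "v \<in> ?T" "f v = f (x # w)" for v
        using that IH x w by (cases v) (auto simp: eq nil)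
      show ?thesis using 1 2 3 4 by blast
    qed
  qed
  fix f assume f: "f \<in> F"
  note P = *[OF _ UnI1[OF f]]
  have "f \<in> extensional ?T" using F[OF f] by (auto simp: level_tuple_def)
  then show "f \<in> tree_aut p"
    using P by (intro tree_autI) blast+
qed

lemma rooted_cycle_aut: "rooted_cycle p \<in> tree_aut p"
proof (rule tree_autI)
  have inj: "Suc x mod p = Suc y mod p \<Longrightarrow> x = y" if "x < p" "y < p" for x y
    using that by (auto simp: mod_Suc split: if_splits)
  fix w assume w: "w \<in> regular_tree p"
  show "rooted_cycle p w \<in> regular_tree p" "length (rooted_cycle p w) = length w"
    using w by (auto simp: rooted_cycle_def split: list.splits)
  show "\<exists>v\<in>regular_tree p. rooted_cycle p v = w"
  proof (cases w)
    case (Cons x u)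
    have "\<exists>y<p. Suc y mod p = x"
      using w Cons by (cases x) (auto intro: exI[of _ "p - 1"] exI[of _ "x - 1"])
    then obtain y where "y < p" "Suc y mod p = x" by blast
    then show ?thesis
      using Cons w by (intro bexI[of _ "y # u"]) (auto simp: rooted_cycle_def)
  qed (auto simp: rooted_cycle_def intro!: bexI[of _ "[]"])
  show "rooted_cycle p (take n w) = take n (rooted_cycle p w)" for n
    using w regular_tree_take[of _ p]
    by (cases n; cases w) (auto simp: rooted_cycle_def)
  show "w = v" if "v \<in> regular_tree p" "rooted_cycle p w = rooted_cycle p v" for v
    using w that by (cases v; cases w) (auto simp: rooted_cycle_def dest: inj)
qed (simp add: rooted_cycle_def)

lemma grig_equations:
  "grig_b = level_tuple 2 [grig_a, grig_c]"
  "grig_c = level_tuple 2 [grig_a, grig_d]"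
  "grig_d = level_tuple 2 [\<one>\<^bsub>tree_aut_group 2\<^esub>, grig_b]"
  by (auto simp: grig_a_def grig_b_def grig_c_def grig_d_def level_tuple_def one_tree_aut_group
        fun_eq_iff restrict_def dest!: less_2_cases split: list.splits)

lemma gs_t_equation:
  assumes "p \<ge> 3"
  shows "gs_t p = level_tuple p
           ([gs_a p, inv\<^bsub>tree_aut_group p\<^esub> (gs_a p)]
             @ replicate (p - 3) \<one>\<^bsub>tree_aut_group p\<^esub> @ [gs_t p])"
    (is "_ = level_tuple p ?gs")
proof -
  define gs where "gs = ?gs"
  have nth: "gs ! x = (if x = 0 then gs_a p else if x = 1 then inv\<^bsub>tree_aut_group p\<^esub> (gs_a p)
               else if x = p - 1 then gs_t p else \<one>\<^bsub>tree_aut_group p\<^esub>)" if "x < p" for x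
    using that assms by (auto simp: gs_def nth_append nth_Cons')
  have "gs_t p = level_tuple p gs"
  proof
    show "gs_t p w = level_tuple p gs w" for w
      by (cases w) (use assms in \<open>auto simp: gs_t_def level_tuple_def nth gs_a_def one_tree_aut_group\<close>)
  qed
  then show ?thesis by (simp add: gs_def)
qed

lemma one_in_tree_aut: "\<one>\<^bsub>tree_aut_group p\<^esub> \<in> tree_aut p"
  using group.is_monoid[OF group_tree_aut_group, THEN monoid.one_closed, of p]
  by (simp add: tree_aut_group_def)

lemma inv_in_tree_aut: "f \<in> tree_aut p \<Longrightarrow> inv\<^bsub>tree_aut_group p\<^esub> f \<in> tree_aut p"
  using group.inv_closed[OF group_tree_aut_group, of f p] by (simp add: tree_aut_group_def)

lemma grig_generators: "{grig_a, grig_b, grig_c, grig_d} \<subseteq> carrier (tree_aut_group 2)"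
proof -
  have a: "grig_a \<in> tree_aut 2" unfolding grig_a_def by (rule rooted_cycle_aut)
  have "{grig_b, grig_c, grig_d} \<subseteq> tree_aut 2"
  proof (rule self_similar_aut)
    fix f assume "f \<in> {grig_b, grig_c, grig_d}"
    then consider "f = grig_b" | "f = grig_c" | "f = grig_d" by blast
    then show "\<exists>gs. length gs = 2 \<and> set gs \<subseteq> {grig_b, grig_c, grig_d} \<union> tree_aut 2 \<and>
                 f = level_tuple 2 gs"
    proof cases
      case 1
      show ?thesis
        by (rule exI[of _ "[grig_a, grig_c]"]) (use 1 a grig_equations(1) in simp)
    next
      case 2
      show ?thesis
        by (rule exI[of _ "[grig_a, grig_d]"]) (use 2 a grig_equations(2) in simp)
    next
      case 3
      show ?thesis
        by (rule exI[of _ "[\<one>\<^bsub>tree_aut_group 2\<^esub>, grig_b]"])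
           (use 3 one_in_tree_aut grig_equations(3) in simp)
    qed
  qed
  then show ?thesis using a by (simp add: tree_aut_group_def)
qed

lemma gs_generators:
  assumes "p \<ge> 3"
  shows "{gs_a p, gs_t p} \<subseteq> carrier (tree_aut_group p)"
proof -
  have a: "gs_a p \<in> tree_aut p" unfolding gs_a_def by (rule rooted_cycle_aut)
  have "{gs_t p} \<subseteq> tree_aut p"
  proof (rule self_similar_aut)
    fix f assume f: "f \<in> {gs_t p}"
    show "\<exists>gs. length gs = p \<and> set gs \<subseteq> {gs_t p} \<union> tree_aut p \<and> f = level_tuple p gs"
      by (rule exI[of _ "[gs_a p, inv\<^bsub>tree_aut_group p\<^esub> (gs_a p)]
             @ replicate (p - 3) \<one>\<^bsub>tree_aut_group p\<^esub> @ [gs_t p]"])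
         (use f assms a inv_in_tree_aut[OF a] one_in_tree_aut gs_t_equation[OF assms]
          in \<open>auto simp: set_replicate_conv_if\<close>)
  qed
  then show ?thesis using a by (simp add: tree_aut_group_def)
qed

end

theory Submission
  imports Defs
begin

text \<open>
  The theorem combines a criterion for wreath products with a property of the two families of
  groups.

  \<^bold>\<open>Wreath products.\<close> Elements of \<open>A \<wr> B\<close> are pairs \<open>(f, b)\<close>. If the acting parts of two elements are not
  conjugate in \<open>B\<close>, conjugacy separability of \<open>B\<close> settles the matter. Otherwise a conjugation makes them equal, and
  it remains to compare \<open>(f, b)\<close> and \<open>(f', b)\<close>. As \<open>B\<close> is torsion, \<open>f\<close> may be multiplied up over the
  orbits of \<open>\<langle>b\<rangle>\<close>; the result \<open>e\<close> (\<open>orb\<close> below) is finitely supported, and two elements are conjugate if and only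
  if some \<open>c\<close> in the centraliser of \<open>b\<close> carries \<open>e\<close> to \<open>e'\<close> (\<open>conjugate_orb\<close>, \<open>orb_imp_conjugate\<close>). The
  same criterion holds in the wreath product of a quotient of \<open>A\<close> by a quotient of \<open>B\<close>. If \<open>e\<close> is not trivial,
  an element \<open>q\<close> of the quotient of \<open>B\<close> that carries the image of \<open>e\<close> to the image of \<open>e'\<close> maps a point of
  the support of \<open>e\<close> to a point of the support of \<open>e'\<close>, so it is the image of one of finitely many known elements
  of \<open>B\<close>. Quotients that are injective on a suitable finite set therefore reflect conjugacy.

  \<^bold>\<open>Branch groups.\<close> It remains to show that \<open>G\<^sub>p\<close> is torsion, residually a finite \<open>p\<close>-group and
  \<open>p\<close>-conjugacy separable. Both groups are branch over a normal subgroup \<open>K\<close> of finite index: \<open>K\<close> contains the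
  group \<open>K \<times> \<cdots> \<times> K\<close> acting on the first-level subtrees. Iterating gives normal subgroups \<open>R n\<close> of
  \<open>p\<close>-power index with trivial intersection. Call a pair detected if for some \<open>n\<close> every conjugation of one to the
  other modulo \<open>R n\<close> becomes a true conjugation after multiplying the conjugator by an element of \<open>K\<close>. If all
  pairs are detected, the group is \<open>p\<close>-conjugacy separable. Detection can be checked on sections: those of
  the elements themselves if they fix the first level (\<open>detected_stab\<close>), and those of their \<open>p\<close>-th powers if they
  rotate it (\<open>detected_rot\<close>). Remembering the coset of \<open>K\<close> is what makes these two steps possible, because elements
  of \<open>K\<close> may be chosen independently in all coordinates.

  \<^bold>\<open>Contraction.\<close> Both groups are generated by the rooted rotation \<open>a\<close> and a finite group \<open>B\<close> of directed
  automorphisms. Up to conjugation, sections have at most about half the length (\<open>len_section_stab\<close>), and the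
  exceptional case of elements that rotate the first level can be controlled; so passing to sections leads to the
  elements of \<open>\<langle>a\<rangle> \<union> B\<close> and their conjugates. The same induction shows that the groups are torsion. What depends on
  the group is the choice of \<open>K\<close>, namely the derived subgroup for the Gupta--Sidki groups and the normal closure
  of \<open>(ab)\<^sup>2\<close> for Grigorchuk's group, the proof that it is branching, and the detection of pairs of elements of \<open>B\<close>.
\<close>



section \<open>Conjugacy in groups and in their finite \<open>p\<close>-quotients\<close>

lemma conjugate_in_iff:
  assumes "group G" "g \<in> carrier G" "h \<in> carrier G"
  shows "conjugate_in G g h \<longleftrightarrow> (\<exists>x\<in>carrier G. h \<otimes>\<^bsub>G\<^esub> x = x \<otimes>\<^bsub>G\<^esub> g)"
proof -
  interpret group G by fact
  show ?thesis
    unfolding conjugate_in_def using assms(2,3) by (metis inv_closed inv_solve_right m_closed)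
qed

lemma conjugate_in_sym:
  assumes "group G" "g \<in> carrier G" "h \<in> carrier G" "conjugate_in G g h"
  shows "conjugate_in G h g"
proof -
  interpret group G by fact
  obtain x where x: "x \<in> carrier G" "h \<otimes>\<^bsub>G\<^esub> x = x \<otimes>\<^bsub>G\<^esub> g"
    using assms conjugate_in_iff by metis
  have "g \<otimes>\<^bsub>G\<^esub> inv\<^bsub>G\<^esub> x = inv\<^bsub>G\<^esub> x \<otimes>\<^bsub>G\<^esub> h"
    using x assms(2,3) by (metis inv_closed inv_solve_left inv_solve_right m_assoc m_closed)
  then show ?thesis using assms x by (auto simp: conjugate_in_iff)
qed

lemma conjugate_in_trans:
  assumes "group G" "g \<in> carrier G" "h \<in> carrier G" "k \<in> carrier G"
    and "conjugate_in G g h" "conjugate_in G h k"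
  shows "conjugate_in G g k"
proof -
  interpret group G by fact
  obtain x y where x: "x \<in> carrier G" "h \<otimes>\<^bsub>G\<^esub> x = x \<otimes>\<^bsub>G\<^esub> g"
    and y: "y \<in> carrier G" "k \<otimes>\<^bsub>G\<^esub> y = y \<otimes>\<^bsub>G\<^esub> h"
    using assms conjugate_in_iff by metis
  have "k \<otimes>\<^bsub>G\<^esub> (y \<otimes>\<^bsub>G\<^esub> x) = (y \<otimes>\<^bsub>G\<^esub> x) \<otimes>\<^bsub>G\<^esub> g"
    using x y assms by (metis m_assoc)
  then show ?thesis using assms x y by (auto simp: conjugate_in_iff)
qed

lemma conjugate_in_hom:
  assumes "group G" "group H" "\<phi> \<in> hom G H" "g \<in> carrier G" "h \<in> carrier G" "conjugate_in G g h"
  shows "conjugate_in H (\<phi> g) (\<phi> h)"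
proof -
  obtain x where x: "x \<in> carrier G" "h \<otimes>\<^bsub>G\<^esub> x = x \<otimes>\<^bsub>G\<^esub> g"
    using assms conjugate_in_iff by metis
  then have "\<phi> h \<otimes>\<^bsub>H\<^esub> \<phi> x = \<phi> x \<otimes>\<^bsub>H\<^esub> \<phi> g"
    using assms by (metis hom_mult)
  then show ?thesis using assms x by (auto simp: conjugate_in_iff hom_in_carrier)
qed

lemma finite_p_group_subgroup:
  assumes p: "Factorial_Ring.prime p" and Q: "finite_p_group p Q" and H: "subgroup H Q"
  shows "finite_p_group p (Q\<lparr>carrier := H\<rparr>)"
proof -
  interpret Q: group Q using Q by (simp add: finite_p_group_def)
  obtain k where k: "order Q = p ^ k" using Q by (auto simp: finite_p_group_def)
  have "card (rcosets\<^bsub>Q\<^esub> H) * card H = order Q" by (rule Q.lagrange[OF H])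
  then have "card H dvd p ^ k" using k by (metis dvd_triv_right)
  then obtain j where "card H = p ^ j" using p divides_primepow_nat by blast
  moreover have "finite H"
    using Q subgroup.subset[OF H] finite_subset by (auto simp: finite_p_group_def)
  ultimately show ?thesis
    using subgroup.subgroup_is_group[OF H Q.is_group]
    by (auto simp: finite_p_group_def order_def)
qed

text \<open>
  Surjectivity of the separating homomorphisms comes for free: the image of a homomorphism into a
  finite \<open>p\<close>-group is a finite \<open>p\<close>-group, and passing to a subgroup creates no
  new conjugacies.
\<close>

lemma p_conjugacy_separated_by_hom:
  assumes p: "Factorial_Ring.prime p" and G: "group G"
    and gh: "g \<in> carrier G" "h \<in> carrier G"
    and Q: "finite_p_group p Q" and pi: "\<pi> \<in> hom G Q" and nc: "\<not> conjugate_in Q (\<pi> g) (\<pi> h)"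
  shows "\<exists>(Q' :: nat monoid) \<pi>'. finite_p_group p Q' \<and> \<pi>' \<in> epi G Q' \<and>
           \<not> conjugate_in Q' (\<pi>' g) (\<pi>' h)"
proof -
  have grp: "group Q" using Q by (simp add: finite_p_group_def)
  let ?H = "\<pi> ` carrier G"
  let ?Q = "Q\<lparr>carrier := ?H\<rparr>"
  have H: "subgroup ?H Q"
    using G grp pi by (intro group_hom.img_is_subgroup) (simp add: group_hom_def group_hom_axioms_def)
  have fin: "finite_p_group p ?Q" by (rule finite_p_group_subgroup[OF p Q H])
  have epi: "\<pi> \<in> epi G ?Q" using pi by (auto simp: epi_def hom_def)
  have "\<not> conjugate_in ?Q (\<pi> g) (\<pi> h)"
  proof
    assume "conjugate_in ?Q (\<pi> g) (\<pi> h)"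
    moreover have "(\<lambda>x. x) \<in> hom ?Q Q" using subgroup.subset[OF H] by (auto simp: hom_def)
    ultimately have "conjugate_in Q (\<pi> g) (\<pi> h)"
      using fin grp gh conjugate_in_hom[of ?Q Q "\<lambda>x. x" "\<pi> g" "\<pi> h"]
      by (simp add: finite_p_group_def)
    then show False using nc by simp
  qed
  then show ?thesis using finite_p_group_nat_copy[OF fin epi G gh] by blast
qed


section \<open>Conjugacy in a restricted wreath product with abelian base\<close>

locale wreath = A: comm_group A + B: group B for A (structure) and B (structure)
begin

abbreviation base where "base \<equiv> sum_group (carrier B) (\<lambda>_. A)"
abbreviation sh where "sh \<equiv> shift_action B"
abbreviation supp where "supp f \<equiv> {x \<in> carrier B. f x \<noteq> \<one>\<^bsub>A\<^esub>}"

lemma base_iff: "f \<in> carrier base \<longleftrightarrow> f \<in> carrier B \<rightarrow>\<^sub>E carrier A \<and> finite (supp f)"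
  by (simp add: carrier_sum_group)

lemma base_app[simp]: "f \<in> carrier base \<Longrightarrow> x \<in> carrier B \<Longrightarrow> f x \<in> carrier A"
  by (auto simp: base_iff)

lemma base_eqI:
  "f \<in> carrier base \<Longrightarrow> g \<in> carrier base \<Longrightarrow> (\<And>x. x \<in> carrier B \<Longrightarrow> f x = g x) \<Longrightarrow> f = g"
  unfolding base_iff by (meson PiE_ext)

lemma base_mult_app[simp]: "x \<in> carrier B \<Longrightarrow> (f \<otimes>\<^bsub>base\<^esub> g) x = f x \<otimes>\<^bsub>A\<^esub> g x"
  by simp

lemma base_one_app[simp]: "x \<in> carrier B \<Longrightarrow> \<one>\<^bsub>base\<^esub> x = \<one>\<^bsub>A\<^esub>"
  by simp

lemma base_comm_group: "comm_group base"
proof -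
  interpret N: group base by simp
  show ?thesis
    by (rule N.group_comm_groupI, rule base_eqI) (auto simp del: mult_sum_group simp: A.m_comm)
qed

end

sublocale wreath \<subseteq> N: comm_group base
  by (rule base_comm_group)

context wreath
begin

declare mult_sum_group[simp del] one_sum_group[simp del] inv_sum_group[simp del]



lemma sh_app[simp]: "x \<in> carrier B \<Longrightarrow> sh b f x = f (inv\<^bsub>B\<^esub> b \<otimes>\<^bsub>B\<^esub> x)"
  by (simp add: shift_action_def)

lemma sh_closed[simp]:
  assumes b: "b \<in> carrier B" and f: "f \<in> carrier base" shows "sh b f \<in> carrier base"
proof -
  have "supp (sh b f) \<subseteq> (\<lambda>x. b \<otimes>\<^bsub>B\<^esub> x) ` supp f"
  proof
    fix x assume "x \<in> supp (sh b f)"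
    then show "x \<in> (\<lambda>x. b \<otimes>\<^bsub>B\<^esub> x) ` supp f"
      using b by (intro image_eqI[of _ _ "inv\<^bsub>B\<^esub> b \<otimes>\<^bsub>B\<^esub> x"]) (auto simp: B.m_assoc[symmetric])
  qed
  then have "finite (supp (sh b f))" using f by (auto simp: base_iff intro: finite_subset)
  moreover have "sh b f \<in> carrier B \<rightarrow>\<^sub>E carrier A"
    using b f by (auto simp: base_iff shift_action_def)
  ultimately show ?thesis unfolding base_iff by blast
qed

lemma sh_mult: "b \<in> carrier B \<Longrightarrow> f \<in> carrier base \<Longrightarrow> g \<in> carrier base \<Longrightarrow>
    sh b (f \<otimes>\<^bsub>base\<^esub> g) = sh b f \<otimes>\<^bsub>base\<^esub> sh b g"
  by (rule base_eqI) auto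

lemma sh_one: "b \<in> carrier B \<Longrightarrow> sh b \<one>\<^bsub>base\<^esub> = \<one>\<^bsub>base\<^esub>"
  by (rule base_eqI) auto

lemma sh_comp: "b \<in> carrier B \<Longrightarrow> c \<in> carrier B \<Longrightarrow> f \<in> carrier base \<Longrightarrow>
    sh b (sh c f) = sh (b \<otimes>\<^bsub>B\<^esub> c) f"
  by (rule base_eqI) (auto simp: B.m_assoc B.inv_mult_group)

lemma sh_id: "f \<in> carrier base \<Longrightarrow> sh \<one>\<^bsub>B\<^esub> f = f"
  by (rule base_eqI) auto

text \<open>
  For \<open>b\<close> of order \<open>r\<close> this is a transfer map: its value at \<open>x\<close> is the product of \<open>f\<close> over the
  orbit \<open>x, bx, \<dots>\<close> of \<open>x\<close> under \<open>\<langle>b\<rangle>\<close>. The recursion makes it a homomorphism of the base group that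
  commutes with everything that commutes with \<open>b\<close>.
\<close>

primrec orb :: "'c \<Rightarrow> nat \<Rightarrow> ('c \<Rightarrow> 'a) \<Rightarrow> 'c \<Rightarrow> 'a" where
  "orb b 0 f = \<one>\<^bsub>base\<^esub>"
| "orb b (Suc r) f = f \<otimes>\<^bsub>base\<^esub> sh (inv\<^bsub>B\<^esub> b) (orb b r f)"

lemma orb_closed[simp]: "b \<in> carrier B \<Longrightarrow> f \<in> carrier base \<Longrightarrow> orb b r f \<in> carrier base"
  by (induction r) auto

lemma orb_mult: "b \<in> carrier B \<Longrightarrow> f \<in> carrier base \<Longrightarrow> g \<in> carrier base \<Longrightarrow>
    orb b r (f \<otimes>\<^bsub>base\<^esub> g) = orb b r f \<otimes>\<^bsub>base\<^esub> orb b r g"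
  by (induction r) (auto simp: sh_mult N.m_ac)

lemma orb_sh:
  assumes "b \<in> carrier B" "c \<in> carrier B" "f \<in> carrier base" "c \<otimes>\<^bsub>B\<^esub> b = b \<otimes>\<^bsub>B\<^esub> c"
  shows "orb b r (sh c f) = sh c (orb b r f)"
proof -
  have "inv\<^bsub>B\<^esub> b \<otimes>\<^bsub>B\<^esub> c = c \<otimes>\<^bsub>B\<^esub> inv\<^bsub>B\<^esub> b"
    using assms by (metis B.inv_closed B.inv_solve_left B.inv_solve_right B.m_assoc B.m_closed)
  then show ?thesis
    using assms(1-3) by (induction r) (auto simp: sh_mult sh_one sh_comp)
qed

lemma orb_Suc2:
  assumes "b \<in> carrier B" "f \<in> carrier base"
  shows "orb b (Suc r) f = orb b r f \<otimes>\<^bsub>base\<^esub> sh (inv\<^bsub>B\<^esub> (b [^]\<^bsub>B\<^esub> r)) f"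
proof (induction r)
  case 0
  then show ?case using assms by (simp add: sh_one sh_id)
next
  case (Suc r)
  have "orb b (Suc (Suc r)) f = f \<otimes>\<^bsub>base\<^esub> sh (inv\<^bsub>B\<^esub> b) (orb b (Suc r) f)" by simp
  also have "\<dots> = f \<otimes>\<^bsub>base\<^esub> sh (inv\<^bsub>B\<^esub> b) (orb b r f \<otimes>\<^bsub>base\<^esub> sh (inv\<^bsub>B\<^esub> (b [^]\<^bsub>B\<^esub> r)) f)"
    by (simp only: Suc)
  also have "\<dots> = orb b (Suc r) f \<otimes>\<^bsub>base\<^esub> sh (inv\<^bsub>B\<^esub> (b [^]\<^bsub>B\<^esub> Suc r)) f"
    using assms by (simp add: sh_mult sh_comp N.m_ac B.inv_mult_group)
  finally show ?case .
qed

lemma orb_sh_self: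
  assumes b: "b \<in> carrier B" "f \<in> carrier base" and r: "b [^]\<^bsub>B\<^esub> (r::nat) = \<one>\<^bsub>B\<^esub>"
  shows "orb b r (sh b f) = orb b r f"
proof -
  have "orb b r g = orb b r (sh (inv\<^bsub>B\<^esub> b) g)" if g: "g \<in> carrier base" for g
  proof -
    have "orb b r g \<otimes>\<^bsub>base\<^esub> g = g \<otimes>\<^bsub>base\<^esub> sh (inv\<^bsub>B\<^esub> b) (orb b r g)"
      using orb_Suc2[OF b(1) g, of r] r g by (simp add: sh_id)
    also have "\<dots> = sh (inv\<^bsub>B\<^esub> b) (orb b r g) \<otimes>\<^bsub>base\<^esub> g"
      using b g by (intro N.m_comm) auto
    finally have "orb b r g = sh (inv\<^bsub>B\<^esub> b) (orb b r g)"
      using b g by (simp add: N.r_cancel)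
    then show ?thesis using b g by (simp add: orb_sh)
  qed
  from this[of "sh b f"] show ?thesis using b by (simp add: sh_comp sh_id)
qed

lemma mult_wreath:
  "(f, b) \<otimes>\<^bsub>wreath_product A B\<^esub> (g, c) = (f \<otimes>\<^bsub>base\<^esub> sh b g, b \<otimes>\<^bsub>B\<^esub> c)"
  by (simp add: wreath_product_def semidirect_product_def)

lemma carrier_wreath: "carrier (wreath_product A B) = carrier base \<times> carrier B"
  by (simp add: wreath_product_def semidirect_product_def)

lemma group_wreath: "group (wreath_product A B)"
  by (rule group_wreath_product) unfold_locales

text \<open>
  Applying the transfer to \<open>f' \<cdot> bn = n \<cdot> qf\<close> cancels \<open>n\<close>, which leaves an invariant of the
  conjugacy class that only depends on the acting element \<open>q\<close>.
\<close>

lemma conjugate_orb: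
  assumes "f \<in> carrier base" "f' \<in> carrier base" "b \<in> carrier B"
    and r: "b [^]\<^bsub>B\<^esub> (r::nat) = \<one>\<^bsub>B\<^esub>"
    and conj: "conjugate_in (wreath_product A B) (f, b) (f', b)"
  shows "\<exists>q\<in>carrier B. q \<otimes>\<^bsub>B\<^esub> b = b \<otimes>\<^bsub>B\<^esub> q \<and> orb b r f' = sh q (orb b r f)"
proof -
  obtain n q where nq: "n \<in> carrier base" "q \<in> carrier B"
    and "(f', b) \<otimes>\<^bsub>wreath_product A B\<^esub> (n, q) = (n, q) \<otimes>\<^bsub>wreath_product A B\<^esub> (f, b)"
    using conj conjugate_in_iff[OF group_wreath, of "(f, b)" "(f', b)"] assms(1-3)
    unfolding carrier_wreath by blast
  then have eq: "f' \<otimes>\<^bsub>base\<^esub> sh b n = n \<otimes>\<^bsub>base\<^esub> sh q f" and com: "q \<otimes>\<^bsub>B\<^esub> b = b \<otimes>\<^bsub>B\<^esub> q"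
    by (auto simp: mult_wreath)
  have "orb b r f' \<otimes>\<^bsub>base\<^esub> orb b r n = orb b r (f' \<otimes>\<^bsub>base\<^esub> sh b n)"
    using assms nq by (simp add: orb_mult orb_sh_self)
  also have "\<dots> = sh q (orb b r f) \<otimes>\<^bsub>base\<^esub> orb b r n"
    unfolding eq using assms nq com by (simp add: orb_mult orb_sh N.m_comm)
  finally have "orb b r f' = sh q (orb b r f)"
    by (rule N.right_cancel[THEN iffD1, rotated -1]) (use assms nq in simp_all)
  then show ?thesis using com by (intro bexI[OF _ nq(2)] conjI)
qed

text \<open>
  Functions with trivial transfer are coboundaries: on each \<open>\<langle>b\<rangle>\<close>-orbit fix a base point \<open>\<rho>\<close> and
  let \<open>n\<close> at \<open>b\<^sup>i\<rho>\<close> be the partial product of \<open>h\<close> over \<open>\<rho>, b\<rho>, \<dots>, b\<^sup>i\<rho>\<close>. Going once around the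
  orbit closes up exactly because the full product is trivial.
\<close>

lemma orb_trivial_imp_coboundary:
  assumes b: "b \<in> carrier B" and h: "h \<in> carrier base" and r0: "r > 0"
    and r: "b [^]\<^bsub>B\<^esub> (r::nat) = \<one>\<^bsub>B\<^esub>" and min: "\<And>i. 0 < i \<Longrightarrow> i < r \<Longrightarrow> b [^]\<^bsub>B\<^esub> (i::nat) \<noteq> \<one>\<^bsub>B\<^esub>"
    and triv: "orb b r h = \<one>\<^bsub>base\<^esub>"
  shows "\<exists>n\<in>carrier base. n = h \<otimes>\<^bsub>base\<^esub> sh b n"
proof -
  \<comment> \<open>\<open>Z y\<close> is the orbit of \<open>y\<close>; closing it up uses that \<open>b\<close> has finite order.\<close>
  define Z where "Z y = {b [^]\<^bsub>B\<^esub> i \<otimes>\<^bsub>B\<^esub> y | i::nat. True}" for y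
  have ZI: "b [^]\<^bsub>B\<^esub> i \<otimes>\<^bsub>B\<^esub> y \<in> Z y" for i :: nat and y by (auto simp: Z_def)
  have Zself: "y \<in> Z y" if "y \<in> carrier B" for y using ZI[of 0 y] that by simp
  have Zsub: "Z y \<subseteq> carrier B" if "y \<in> carrier B" for y using b that by (auto simp: Z_def)
  have Ztrans: "Z z \<subseteq> Z y" if "z \<in> Z y" "y \<in> carrier B" for y z
    using b that by (auto simp: Z_def B.m_assoc[symmetric] B.nat_pow_mult)
  have powmod: "b [^]\<^bsub>B\<^esub> i = b [^]\<^bsub>B\<^esub> (i mod r)" for i :: nat
  proof -
    have "b [^]\<^bsub>B\<^esub> i = b [^]\<^bsub>B\<^esub> (r * (i div r) + i mod r)" by simp
    also have "\<dots> = (b [^]\<^bsub>B\<^esub> r) [^]\<^bsub>B\<^esub> (i div r) \<otimes>\<^bsub>B\<^esub> b [^]\<^bsub>B\<^esub> (i mod r)"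
      using b by (simp only: B.nat_pow_mult B.nat_pow_pow)
    finally show ?thesis using r b by simp
  qed
  have Zfin: "finite (Z y)" for y
  proof -
    have "Z y \<subseteq> (\<lambda>i. b [^]\<^bsub>B\<^esub> i \<otimes>\<^bsub>B\<^esub> y) ` {..<r}"
    proof
      fix z assume "z \<in> Z y"
      then obtain i :: nat where "z = b [^]\<^bsub>B\<^esub> i \<otimes>\<^bsub>B\<^esub> y" by (auto simp: Z_def)
      then have "z = b [^]\<^bsub>B\<^esub> (i mod r) \<otimes>\<^bsub>B\<^esub> y" using powmod by metis
      then show "z \<in> (\<lambda>i. b [^]\<^bsub>B\<^esub> i \<otimes>\<^bsub>B\<^esub> y) ` {..<r}" using r0 by auto
    qed
    then show ?thesis by (rule finite_subset) simp
  qed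
  have Zsym: "y \<in> Z z" if z: "z \<in> Z y" and y: "y \<in> carrier B" for y z
  proof -
    obtain i :: nat where i: "z = b [^]\<^bsub>B\<^esub> i \<otimes>\<^bsub>B\<^esub> y" using z by (auto simp: Z_def)
    have "b [^]\<^bsub>B\<^esub> ((r - 1) * i) \<otimes>\<^bsub>B\<^esub> z = b [^]\<^bsub>B\<^esub> ((r - 1) * i + i) \<otimes>\<^bsub>B\<^esub> y"
      using b y i by (simp add: B.m_assoc[symmetric] B.nat_pow_mult)
    also have "(r - 1) * i + i = r * i" using r0 by (cases r) auto
    also have "b [^]\<^bsub>B\<^esub> (r * i) \<otimes>\<^bsub>B\<^esub> y = y"
      using powmod[of "r * i"] y by simp
    finally show ?thesis using ZI by metis
  qed
  have Zeq: "Z z = Z y" if "z \<in> Z y" "y \<in> carrier B" for y z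
    using Ztrans that Zsym Zsub by (meson subset_antisym subsetD)
  define \<rho> where "\<rho> y = (SOME z. z \<in> Z y)" for y
  have rho: "\<rho> y \<in> Z y" if "y \<in> carrier B" for y
    unfolding \<rho>_def by (rule someI[of _ y]) (rule Zself[OF that])
  have rhoB: "\<rho> y \<in> carrier B" if "y \<in> carrier B" for y using rho Zsub that by blast
  have rho_eq: "\<rho> z = \<rho> y" if "z \<in> Z y" "y \<in> carrier B" for y z
    unfolding \<rho>_def using Zeq[OF that] by simp
  define idx where "idx y = (LEAST i. y = b [^]\<^bsub>B\<^esub> (i::nat) \<otimes>\<^bsub>B\<^esub> \<rho> y)" for y
  have ex: "\<exists>i::nat. y = b [^]\<^bsub>B\<^esub> i \<otimes>\<^bsub>B\<^esub> \<rho> y" if "y \<in> carrier B" for y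
    using Zsym[OF rho[OF that] that] by (auto simp: Z_def)
  have idx: "y = b [^]\<^bsub>B\<^esub> (idx y) \<otimes>\<^bsub>B\<^esub> \<rho> y" if "y \<in> carrier B" for y
    using LeastI_ex[OF ex[OF that]] by (simp add: idx_def)
  have idx_le: "idx y \<le> i" if "y = b [^]\<^bsub>B\<^esub> (i::nat) \<otimes>\<^bsub>B\<^esub> \<rho> y" for y i
    unfolding idx_def using that by (rule Least_le)
  define n where "n = (\<lambda>y\<in>carrier B. orb b (Suc (idx y)) h (\<rho> y))"
  have orb_app: "orb b (Suc i) h x = orb b i h x \<otimes>\<^bsub>A\<^esub> h (b [^]\<^bsub>B\<^esub> i \<otimes>\<^bsub>B\<^esub> x)"
    if "x \<in> carrier B" for i x
    using orb_Suc2[OF b h, of i] b that by simp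
  have n_eq: "n y = orb b (idx y) h (\<rho> y) \<otimes>\<^bsub>A\<^esub> h y" if "y \<in> carrier B" for y
    using orb_app[OF rhoB[OF that], of "idx y"] idx[OF that] that by (simp add: n_def del: orb.simps)
  have step: "n y = h y \<otimes>\<^bsub>A\<^esub> n (inv\<^bsub>B\<^esub> b \<otimes>\<^bsub>B\<^esub> y)" if y: "y \<in> carrier B" for y
  proof -
    let ?z = "inv\<^bsub>B\<^esub> b \<otimes>\<^bsub>B\<^esub> y"
    have z: "?z \<in> carrier B" using b y by simp
    have yz: "y = b \<otimes>\<^bsub>B\<^esub> ?z" using b y by (simp add: B.m_assoc[symmetric])
    have rz: "\<rho> y = \<rho> ?z" using ZI[of 1 ?z] b z yz rho_eq[OF _ z] by simp
    have iz: "?z = b [^]\<^bsub>B\<^esub> (idx ?z) \<otimes>\<^bsub>B\<^esub> \<rho> y" using idx[OF z] rz by simp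
    have y_next: "y = b [^]\<^bsub>B\<^esub> (Suc (idx ?z)) \<otimes>\<^bsub>B\<^esub> \<rho> y"
      unfolding B.nat_pow_Suc2[OF b] using yz iz b rhoB[OF y] by (metis B.m_assoc B.nat_pow_closed)
    have "orb b (idx y) h (\<rho> y) = n ?z"
    proof (cases "idx y")
      case (Suc i)
      have "b \<otimes>\<^bsub>B\<^esub> ?z = b \<otimes>\<^bsub>B\<^esub> (b [^]\<^bsub>B\<^esub> i \<otimes>\<^bsub>B\<^esub> \<rho> y)"
        using idx[OF y] Suc b rhoB[OF y] yz B.nat_pow_Suc2[OF b, of i] by (metis B.m_assoc B.nat_pow_closed)
      then have "?z = b [^]\<^bsub>B\<^esub> i \<otimes>\<^bsub>B\<^esub> \<rho> ?z" using b z rhoB[OF y] rz by simp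
      then have "idx ?z \<le> i" by (rule idx_le)
      moreover have "Suc i \<le> Suc (idx ?z)" using idx_le[OF y_next] Suc by simp
      ultimately have "idx y = Suc (idx ?z)" using Suc by simp
      then show ?thesis using z rz by (simp add: n_def)
    next
      \<comment> \<open>Here \<open>y\<close> is the base point and its predecessor is the last point of the orbit.\<close>
      case 0
      have y\<rho>: "y = \<rho> y" using idx[OF y] 0 rhoB[OF y] by simp
      have "b [^]\<^bsub>B\<^esub> (Suc (idx ?z)) \<otimes>\<^bsub>B\<^esub> \<rho> y = \<one>\<^bsub>B\<^esub> \<otimes>\<^bsub>B\<^esub> \<rho> y"
        using y_next y\<rho> rhoB[OF y] by simp
      then have one: "b [^]\<^bsub>B\<^esub> (Suc (idx ?z)) = \<one>\<^bsub>B\<^esub>" using b rhoB[OF y] B.r_cancel by blast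
      have "b [^]\<^bsub>B\<^esub> (r - 1) \<otimes>\<^bsub>B\<^esub> y = ?z"
      proof -
        have "b \<otimes>\<^bsub>B\<^esub> b [^]\<^bsub>B\<^esub> (r - 1) = \<one>\<^bsub>B\<^esub>"
          using r r0 b B.nat_pow_Suc2[OF b, of "r - 1"] by simp
        then have "b [^]\<^bsub>B\<^esub> (r - 1) = inv\<^bsub>B\<^esub> b"
          using b B.inv_equality B.inv_comm by (metis B.nat_pow_closed)
        then show ?thesis by simp
      qed
      then have "idx ?z \<le> r - 1" using y\<rho> rz by (intro idx_le) metis
      then have "Suc (idx ?z) = r" using min[of "Suc (idx ?z)"] one r0 by (cases "Suc (idx ?z) = r") auto
      then have "n ?z = \<one>\<^bsub>A\<^esub>" using z rz triv rhoB[OF y] by (simp add: n_def del: orb.simps)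
      then show ?thesis using 0 rhoB[OF y] by simp
    qed
    moreover have "n ?z \<in> carrier A" using z h b rhoB[OF z] by (simp add: n_def del: orb.simps)
    ultimately show ?thesis using n_eq[OF y] y h A.m_comm by simp
  qed
  have orb_one: "orb b i h x = \<one>\<^bsub>A\<^esub>" if "x \<in> carrier B" "Z x \<inter> supp h = {}" for i x
  proof (induction i)
    case 0
    then show ?case using that by simp
  next
    case (Suc i)
    have "b [^]\<^bsub>B\<^esub> i \<otimes>\<^bsub>B\<^esub> x \<notin> supp h" using that ZI by blast
    then have "h (b [^]\<^bsub>B\<^esub> i \<otimes>\<^bsub>B\<^esub> x) = \<one>\<^bsub>A\<^esub>" using that b by simp
    then show ?case using orb_app[OF that(1)] Suc by (simp del: orb.simps)
  qed
  have "supp n \<subseteq> (\<Union>s\<in>supp h. Z s)"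
  proof
    fix y assume "y \<in> supp n"
    then have y: "y \<in> carrier B" "orb b (Suc (idx y)) h (\<rho> y) \<noteq> \<one>\<^bsub>A\<^esub>" by (auto simp: n_def)
    then obtain s where s: "s \<in> Z (\<rho> y)" "s \<in> supp h" using orb_one rhoB by blast
    have "s \<in> Z y" using s Zeq[OF rho[OF y(1)] y(1)] by simp
    then show "y \<in> (\<Union>s\<in>supp h. Z s)" using Zsym y s by blast
  qed
  moreover have "finite (\<Union>s\<in>supp h. Z s)" using h Zfin by (auto simp: base_iff)
  ultimately have "finite (supp n)" by (rule finite_subset)
  moreover have "n \<in> carrier B \<rightarrow>\<^sub>E carrier A"
    using rhoB b h by (auto simp: n_def simp del: orb.simps)
  ultimately have n: "n \<in> carrier base" unfolding base_iff by blast
  moreover have "n = h \<otimes>\<^bsub>base\<^esub> sh b n"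
    using step n h b by (intro base_eqI) auto
  ultimately show ?thesis by blast
qed

text \<open>
  The invariant of the previous lemma is complete: if \<open>c\<close> matches the transfers, then \<open>f'\<close> and \<open>cf\<close>
  differ by a function with trivial transfer, hence by a coboundary, and that is what conjugation by
  the base group can absorb.
\<close>

lemma orb_imp_conjugate:
  assumes f: "f \<in> carrier base" "f' \<in> carrier base" and b: "b \<in> carrier B" and r0: "r > 0"
    and r: "b [^]\<^bsub>B\<^esub> (r::nat) = \<one>\<^bsub>B\<^esub>" and min: "\<And>i. 0 < i \<Longrightarrow> i < r \<Longrightarrow> b [^]\<^bsub>B\<^esub> (i::nat) \<noteq> \<one>\<^bsub>B\<^esub>"
    and c: "c \<in> carrier B" "c \<otimes>\<^bsub>B\<^esub> b = b \<otimes>\<^bsub>B\<^esub> c" and orb: "orb b r f' = sh c (orb b r f)"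
  shows "conjugate_in (wreath_product A B) (f, b) (f', b)"
proof -
  define h where "h = f' \<otimes>\<^bsub>base\<^esub> inv\<^bsub>base\<^esub> (sh c f)"
  have h: "h \<in> carrier base" using f b c by (simp add: h_def del: inv_sum_group)
  have hc: "f' = h \<otimes>\<^bsub>base\<^esub> sh c f" using f c by (simp add: h_def N.m_assoc del: inv_sum_group)
  have "orb b r h \<otimes>\<^bsub>base\<^esub> orb b r f' = \<one>\<^bsub>base\<^esub> \<otimes>\<^bsub>base\<^esub> orb b r f'"
  proof -
    have "orb b r f' = orb b r h \<otimes>\<^bsub>base\<^esub> orb b r (sh c f)"
      unfolding hc using f b c h by (intro orb_mult sh_closed)
    also have "orb b r (sh c f) = orb b r f'" using orb orb_sh[OF b c(1) f(1) c(2)] by simp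
    finally show ?thesis unfolding N.l_one[OF orb_closed[OF b f(2)]] by (rule sym)
  qed
  then have "orb b r h = \<one>\<^bsub>base\<^esub>"
    by (rule N.right_cancel[THEN iffD1, rotated -1]) (use b h f in simp_all)
  then obtain n where n: "n \<in> carrier base" "n = h \<otimes>\<^bsub>base\<^esub> sh b n"
    using orb_trivial_imp_coboundary[OF b h r0 r min] by blast
  have "f' \<otimes>\<^bsub>base\<^esub> sh b n = (h \<otimes>\<^bsub>base\<^esub> sh b n) \<otimes>\<^bsub>base\<^esub> sh c f"
    unfolding hc using h n(1) f b c by (simp add: N.m_ac)
  then have "f' \<otimes>\<^bsub>base\<^esub> sh b n = n \<otimes>\<^bsub>base\<^esub> sh c f" using n(2) by simp
  then have "(f', b) \<otimes>\<^bsub>wreath_product A B\<^esub> (n, c) = (n, c) \<otimes>\<^bsub>wreath_product A B\<^esub> (f, b)"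
    using c by (simp add: mult_wreath)
  then show ?thesis
    using f b n c group_wreath by (auto simp: conjugate_in_iff carrier_wreath intro!: bexI[of _ "(n, c)"])
qed

end



section \<open>Quotients of wreath products\<close>

locale wreath_map = W: wreath A B + V: wreath A' Q
  for A :: "('a, 'k) monoid_scheme" and B :: "('b, 'l) monoid_scheme"
    and A' :: "('c, 'm) monoid_scheme" and Q :: "('d, 'n) monoid_scheme" +
  fixes \<alpha> and \<pi>
  assumes alpha: "\<alpha> \<in> hom A A'" and pi: "\<pi> \<in> hom B Q" and finite_Q: "finite (carrier Q)"
begin

lemma alpha_closed[simp]: "x \<in> carrier A \<Longrightarrow> \<alpha> x \<in> carrier A'"
  using alpha by (rule hom_in_carrier)

lemma pi_closed[simp]: "x \<in> carrier B \<Longrightarrow> \<pi> x \<in> carrier Q"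
  using pi by (rule hom_in_carrier)

lemma alpha_one[simp]: "\<alpha> \<one>\<^bsub>A\<^esub> = \<one>\<^bsub>A'\<^esub>"
  using alpha by (rule hom_one[OF _ W.A.is_group V.A.is_group])

lemma pi_mult: "x \<in> carrier B \<Longrightarrow> y \<in> carrier B \<Longrightarrow> \<pi> (x \<otimes>\<^bsub>B\<^esub> y) = \<pi> x \<otimes>\<^bsub>Q\<^esub> \<pi> y"
  using pi by (rule hom_mult)

lemma pi_inv: "x \<in> carrier B \<Longrightarrow> \<pi> (inv\<^bsub>B\<^esub> x) = inv\<^bsub>Q\<^esub> \<pi> x"
  using pi by (intro group_hom.hom_inv) (simp_all add: group_hom_def group_hom_axioms_def)

lemma pi_pow: "x \<in> carrier B \<Longrightarrow> \<pi> (x [^]\<^bsub>B\<^esub> (i::nat)) = \<pi> x [^]\<^bsub>Q\<^esub> i"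
  using pi by (intro group_hom.hom_nat_pow) (simp_all add: group_hom_def group_hom_axioms_def)

text \<open>
  A function on \<open>B\<close> is pushed to \<open>Q\<close> by multiplying its values over the fibres of \<open>\<pi>\<close>. The fibres may be
  infinite, so the product runs over the support.
\<close>

definition push :: "('b \<Rightarrow> 'a) \<Rightarrow> 'd \<Rightarrow> 'c" where
  "push f = (\<lambda>q\<in>carrier Q. finprod A' (\<lambda>x. \<alpha> (f x)) {x \<in> W.supp f. \<pi> x = q})"

lemma push_superset:
  assumes f: "f \<in> carrier W.base" and S: "finite S" "S \<subseteq> carrier B" "W.supp f \<subseteq> S" and q: "q \<in> carrier Q"
  shows "push f q = finprod A' (\<lambda>x. \<alpha> (f x)) {x \<in> S. \<pi> x = q}"
proof -
  have "finprod A' (\<lambda>x. \<alpha> (f x)) {x \<in> W.supp f. \<pi> x = q} = finprod A' (\<lambda>x. \<alpha> (f x)) {x \<in> S. \<pi> x = q}"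
    by (rule V.A.finprod_mono_neutral_cong_left) (use f S in auto)
  then show ?thesis using q by (simp add: push_def)
qed

lemma push_closed[simp]: "f \<in> carrier W.base \<Longrightarrow> push f \<in> carrier V.base"
  unfolding V.base_iff using finite_Q by (auto simp: push_def intro!: V.A.finprod_closed)

lemma push_mult:
  assumes "f \<in> carrier W.base" "g \<in> carrier W.base"
  shows "push (f \<otimes>\<^bsub>W.base\<^esub> g) = push f \<otimes>\<^bsub>V.base\<^esub> push g"
proof (rule V.base_eqI)
  fix q assume q: "q \<in> carrier Q"
  let ?S = "W.supp f \<union> W.supp g"
  have S: "finite ?S" "?S \<subseteq> carrier B" using assms by (auto simp: W.base_iff)
  have sub: "W.supp (f \<otimes>\<^bsub>W.base\<^esub> g) \<subseteq> ?S"
    by auto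
  have "push (f \<otimes>\<^bsub>W.base\<^esub> g) q = finprod A' (\<lambda>x. \<alpha> ((f \<otimes>\<^bsub>W.base\<^esub> g) x)) {x \<in> ?S. \<pi> x = q}"
    using assms by (intro push_superset[OF _ S sub q]) auto
  also have "\<dots> = finprod A' (\<lambda>x. \<alpha> (f x) \<otimes>\<^bsub>A'\<^esub> \<alpha> (g x)) {x \<in> ?S. \<pi> x = q}"
    using assms S by (intro V.A.finprod_cong') (auto simp: hom_mult[OF alpha])
  also have "\<dots> = finprod A' (\<lambda>x. \<alpha> (f x)) {x \<in> ?S. \<pi> x = q} \<otimes>\<^bsub>A'\<^esub> finprod A' (\<lambda>x. \<alpha> (g x)) {x \<in> ?S. \<pi> x = q}"
    using assms S by (intro V.A.finprod_multf) auto
  also have "\<dots> = push f q \<otimes>\<^bsub>A'\<^esub> push g q"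
    using push_superset[OF assms(1) S _ q] push_superset[OF assms(2) S _ q] by simp
  finally show "push (f \<otimes>\<^bsub>W.base\<^esub> g) q = (push f \<otimes>\<^bsub>V.base\<^esub> push g) q" using q by simp
qed (use assms in auto)

lemma push_one: "push \<one>\<^bsub>W.base\<^esub> = \<one>\<^bsub>V.base\<^esub>"
proof -
  have "{x \<in> W.supp \<one>\<^bsub>W.base\<^esub>. \<pi> x = q} = {}" for q by auto
  then have "push \<one>\<^bsub>W.base\<^esub> q = \<one>\<^bsub>V.base\<^esub> q" if "q \<in> carrier Q" for q
    using that unfolding push_def by (metis (no_types, lifting) V.A.finprod_empty V.base_one_app restrict_apply')
  then show ?thesis by (intro V.base_eqI) auto
qed

lemma push_sh:
  assumes b: "b \<in> carrier B" and f: "f \<in> carrier W.base"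
  shows "push (W.sh b f) = V.sh (\<pi> b) (push f)"
proof (rule V.base_eqI)
  fix q assume q: "q \<in> carrier Q"
  let ?q = "inv\<^bsub>Q\<^esub> \<pi> b \<otimes>\<^bsub>Q\<^esub> q"
  let ?S = "{x \<in> W.supp (W.sh b f). \<pi> x = q}" and ?T = "{x \<in> W.supp f. \<pi> x = ?q}"
  have img: "?S = (\<lambda>x. b \<otimes>\<^bsub>B\<^esub> x) ` ?T"
  proof
    show "?S \<subseteq> (\<lambda>x. b \<otimes>\<^bsub>B\<^esub> x) ` ?T"
    proof
      fix x assume "x \<in> ?S"
      then show "x \<in> (\<lambda>x. b \<otimes>\<^bsub>B\<^esub> x) ` ?T"
        using b by (intro image_eqI[of _ _ "inv\<^bsub>B\<^esub> b \<otimes>\<^bsub>B\<^esub> x"])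
          (auto simp: W.B.m_assoc[symmetric] pi_mult pi_inv)
    qed
    show "(\<lambda>x. b \<otimes>\<^bsub>B\<^esub> x) ` ?T \<subseteq> ?S"
      using b q by (auto simp: W.B.m_assoc[symmetric] V.B.m_assoc[symmetric] pi_mult)
  qed
  have inj: "inj_on (\<lambda>x. b \<otimes>\<^bsub>B\<^esub> x) ?T" using b by (auto simp: inj_on_def)
  have "push (W.sh b f) q = finprod A' (\<lambda>x. \<alpha> (W.sh b f x)) ((\<lambda>x. b \<otimes>\<^bsub>B\<^esub> x) ` ?T)"
    using q img by (simp add: push_def)
  also have "\<dots> = finprod A' (\<lambda>x. \<alpha> (W.sh b f (b \<otimes>\<^bsub>B\<^esub> x))) ?T"
    using b f by (intro V.A.finprod_reindex inj) (auto intro!: alpha_closed W.base_app[OF W.sh_closed] simp del: W.sh_app)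
  also have "\<dots> = finprod A' (\<lambda>x. \<alpha> (f x)) ?T"
    using b f by (intro V.A.finprod_cong') (auto simp: W.B.m_assoc[symmetric])
  also have "\<dots> = V.sh (\<pi> b) (push f) q" using q b by (simp add: push_def)
  finally show "push (W.sh b f) q = V.sh (\<pi> b) (push f) q" .
qed (use b f in auto)

lemma push_orb: "b \<in> carrier B \<Longrightarrow> f \<in> carrier W.base \<Longrightarrow> push (W.orb b r f) = V.orb (\<pi> b) r (push f)"
  by (induction r) (simp_all add: push_one push_mult push_sh pi_inv)

text \<open>
  Where \<open>\<pi>\<close> is injective on the support together with \<open>z\<close>, the fibre of \<open>z\<close> contributes at most the value at
  \<open>z\<close> itself.
\<close>

lemma push_at:
  assumes f: "f \<in> carrier W.base" and Y: "inj_on \<pi> Y" "W.supp f \<subseteq> Y" "z \<in> Y" and z: "z \<in> carrier B"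
  shows "push f (\<pi> z) = \<alpha> (f z)"
proof -
  have "push f (\<pi> z) = finprod A' (\<lambda>x. \<alpha> (f x)) {x \<in> insert z (W.supp f). \<pi> x = \<pi> z}"
    using f z by (intro push_superset) (auto simp: W.base_iff)
  also have "{x \<in> insert z (W.supp f). \<pi> x = \<pi> z} = {z}"
    using Y by (auto dest: inj_onD)
  finally show ?thesis using f z by simp
qed

definition wmap :: "('b \<Rightarrow> 'a) \<times> 'b \<Rightarrow> ('d \<Rightarrow> 'c) \<times> 'd" where
  "wmap = (\<lambda>(f, b). (push f, \<pi> b))"

lemma wmap_hom: "wmap \<in> hom (wreath_product A B) (wreath_product A' Q)"
  by (auto simp: hom_def wmap_def W.carrier_wreath V.carrier_wreath W.mult_wreath V.mult_wreath
      push_mult push_sh pi_mult)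

text \<open>
  If \<open>q\<close> carries the pushed-down transfer of \<open>f\<close> to that of \<open>f'\<close>, it carries the image of a point
  \<open>s\<close> of the first support to the image of a point \<open>s'\<close> of the second, so \<open>q\<close> is the image of
  \<open>s's\<^sup>-\<^sup>1\<close>. Only finitely many candidates arise, and on the finite set \<open>Y\<close> of all points that matter
  for them nothing is lost in the quotient.
\<close>

lemma lift_transfer:
  assumes e: "e \<in> carrier W.base" "e' \<in> carrier W.base" and b: "b \<in> carrier B"
    and q: "q \<in> carrier Q" "q \<otimes>\<^bsub>Q\<^esub> \<pi> b = \<pi> b \<otimes>\<^bsub>Q\<^esub> q" and eq: "push e' = V.sh q (push e)"
    and D: "D = (\<lambda>(s', s). s' \<otimes>\<^bsub>B\<^esub> inv\<^bsub>B\<^esub> s) ` (W.supp e' \<times> W.supp e)"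
    and Y: "Y = W.supp e \<union> W.supp e' \<union> (\<Union>c\<in>D. (\<lambda>x. c \<otimes>\<^bsub>B\<^esub> x) ` W.supp e \<union>
              (\<lambda>x. inv\<^bsub>B\<^esub> c \<otimes>\<^bsub>B\<^esub> x) ` W.supp e' \<union> {c \<otimes>\<^bsub>B\<^esub> b, b \<otimes>\<^bsub>B\<^esub> c})"
    and inj: "inj_on \<pi> Y" and injA: "inj_on \<alpha> (insert \<one>\<^bsub>A\<^esub> (e ` W.supp e \<union> e' ` W.supp e'))"
  shows "\<exists>c\<in>carrier B. c \<otimes>\<^bsub>B\<^esub> b = b \<otimes>\<^bsub>B\<^esub> c \<and> e' = W.sh c e"
proof -
  have e_dom: "e x \<in> insert \<one>\<^bsub>A\<^esub> (e ` W.supp e \<union> e' ` W.supp e')"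
    "e' x \<in> insert \<one>\<^bsub>A\<^esub> (e ` W.supp e \<union> e' ` W.supp e')" if "x \<in> carrier B" for x
    using that by auto
  have a0: "\<alpha> (e x) = \<one>\<^bsub>A'\<^esub> \<longleftrightarrow> e x = \<one>\<^bsub>A\<^esub>" "\<alpha> (e' x) = \<one>\<^bsub>A'\<^esub> \<longleftrightarrow> e' x = \<one>\<^bsub>A\<^esub>"
    if "x \<in> carrier B" for x
    using inj_on_eq_iff[OF injA e_dom(1)[OF that], of "\<one>\<^bsub>A\<^esub>"]
      inj_on_eq_iff[OF injA e_dom(2)[OF that], of "\<one>\<^bsub>A\<^esub>"] by auto
  have XB: "Y \<subseteq> carrier B" using b unfolding Y D by auto
  have se: "W.supp e \<subseteq> Y" "W.supp e' \<subseteq> Y" unfolding Y by blast+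
  note at = push_at[OF e(1) inj se(1)] and at' = push_at[OF e(2) inj se(2)]
  have fibre: "\<exists>x\<in>W.supp f. \<pi> x = y" if "f \<in> carrier W.base" "push f y \<noteq> \<one>\<^bsub>A'\<^esub>" "y \<in> carrier Q" for f y
  proof (rule ccontr)
    assume "\<not> ?thesis"
    then have "{x \<in> W.supp f. \<pi> x = y} = {}" by blast
    then show False using that unfolding push_def
      by (metis (no_types, lifting) V.A.finprod_empty restrict_apply')
  qed
  show ?thesis
  proof (cases "W.supp e = {}")
    case True
    have "e' x = \<one>\<^bsub>A\<^esub>" if x: "x \<in> carrier B" for x
    proof (rule ccontr)
      assume ne: "e' x \<noteq> \<one>\<^bsub>A\<^esub>"
      then have "x \<in> Y" using x se by blast
      then have "push e' (\<pi> x) \<noteq> \<one>\<^bsub>A'\<^esub>" using at'[of x] x a0 ne by auto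
      then have "push e (inv\<^bsub>Q\<^esub> q \<otimes>\<^bsub>Q\<^esub> \<pi> x) \<noteq> \<one>\<^bsub>A'\<^esub>" using eq x by simp
      moreover have "inv\<^bsub>Q\<^esub> q \<otimes>\<^bsub>Q\<^esub> \<pi> x \<in> carrier Q" using q x by simp
      ultimately show False using fibre[OF e(1)] True by blast
    qed
    moreover have "e x = \<one>\<^bsub>A\<^esub>" if "x \<in> carrier B" for x using True that by blast
    ultimately have "e' = W.sh \<one>\<^bsub>B\<^esub> e" using e by (intro W.base_eqI) auto
    then show ?thesis using b by (intro bexI[of _ "\<one>\<^bsub>B\<^esub>"]) auto
  next
    case False
    then obtain s where s: "s \<in> W.supp e" by blast
    have "push e' (q \<otimes>\<^bsub>Q\<^esub> \<pi> s) = \<alpha> (e s)"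
      using at[of s] s se q eq by (auto simp: V.B.m_assoc[symmetric])
    then have "push e' (q \<otimes>\<^bsub>Q\<^esub> \<pi> s) \<noteq> \<one>\<^bsub>A'\<^esub>" using a0 s by auto
    moreover have "q \<otimes>\<^bsub>Q\<^esub> \<pi> s \<in> carrier Q" using q s by simp
    ultimately obtain s' where s': "s' \<in> W.supp e'" "\<pi> s' = q \<otimes>\<^bsub>Q\<^esub> \<pi> s"
      using fibre[OF e(2)] by blast
    define c where "c = s' \<otimes>\<^bsub>B\<^esub> inv\<^bsub>B\<^esub> s"
    have cD: "c \<in> D" unfolding D c_def using s s' by auto
    have c: "c \<in> carrier B" using s s' by (auto simp: c_def)
    have pc: "\<pi> c = q" using s s' q by (auto simp: c_def pi_mult pi_inv V.B.m_assoc)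
    have "\<pi> (c \<otimes>\<^bsub>B\<^esub> b) = \<pi> (b \<otimes>\<^bsub>B\<^esub> c)" using c b q pc by (simp add: pi_mult)
    then have com: "c \<otimes>\<^bsub>B\<^esub> b = b \<otimes>\<^bsub>B\<^esub> c"
      using inj cD by (elim inj_onD) (auto simp: Y)
    have val: "e' z = e (inv\<^bsub>B\<^esub> c \<otimes>\<^bsub>B\<^esub> z)" if z: "z \<in> Y" "inv\<^bsub>B\<^esub> c \<otimes>\<^bsub>B\<^esub> z \<in> Y" for z
    proof -
      have zB: "z \<in> carrier B" using z XB by blast
      have "\<alpha> (e' z) = push e' (\<pi> z)" using at' z zB by simp
      also have "\<dots> = push e (\<pi> (inv\<^bsub>B\<^esub> c \<otimes>\<^bsub>B\<^esub> z))"
        unfolding eq using zB c pc by (simp add: pi_mult pi_inv)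
      also have "\<dots> = \<alpha> (e (inv\<^bsub>B\<^esub> c \<otimes>\<^bsub>B\<^esub> z))" using at z zB c by simp
      finally show ?thesis using zB c e_dom by (intro inj_onD[OF injA]) auto
    qed
    have "e' z = e (inv\<^bsub>B\<^esub> c \<otimes>\<^bsub>B\<^esub> z)" if z: "z \<in> carrier B" for z
    proof (cases "z \<in> W.supp e' \<or> inv\<^bsub>B\<^esub> c \<otimes>\<^bsub>B\<^esub> z \<in> W.supp e")
      case True
      have "z = c \<otimes>\<^bsub>B\<^esub> (inv\<^bsub>B\<^esub> c \<otimes>\<^bsub>B\<^esub> z)" using c z by (simp add: W.B.m_assoc[symmetric])
      then have "z \<in> Y" using True cD unfolding Y by blast
      moreover have "inv\<^bsub>B\<^esub> c \<otimes>\<^bsub>B\<^esub> z \<in> Y" using True cD unfolding Y by blast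
      ultimately show ?thesis by (rule val)
    next
      case False
      then show ?thesis using z c by auto
    qed
    then have "e' = W.sh c e" using e c by (intro W.base_eqI) auto
    then show ?thesis using c com by blast
  qed
qed

end

text \<open>
  If the acting parts are not conjugate, a finite quotient of \<open>B\<close> already separates. Otherwise they can
  be made equal, and the transfers decide conjugacy on both levels; because \<open>B\<close> is torsion they are
  finitely supported, and finitely many group elements have to be kept apart.
\<close>

theorem wreath_p_conjugacy_separable:
  fixes A :: "('a, 'k) monoid_scheme" and B :: "('b, 'l) monoid_scheme"
  assumes p: "Factorial_Ring.prime p" and A: "comm_group A"
    and sepA: "\<And>S. finite S \<Longrightarrow> S \<subseteq> carrier A \<Longrightarrow>
      \<exists>(Q :: 'c monoid) \<alpha>. finite_p_group p Q \<and> comm_group Q \<and> \<alpha> \<in> hom A Q \<and> inj_on \<alpha> S"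
    and sepB: "\<And>S. finite S \<Longrightarrow> S \<subseteq> carrier B \<Longrightarrow>
      \<exists>(Q :: 'd monoid) \<pi>. finite_p_group p Q \<and> \<pi> \<in> hom B Q \<and> inj_on \<pi> S"
    and cs: "p_conjugacy_separable p B"
    and tors: "\<And>b. b \<in> carrier B \<Longrightarrow> \<exists>r>0. b [^]\<^bsub>B\<^esub> (r::nat) = \<one>\<^bsub>B\<^esub>"
  shows "p_conjugacy_separable p (wreath_product A B)"
proof -
  have B: "group B" using cs by (simp add: p_conjugacy_separable_def)
  interpret W: wreath A B using A B by (simp add: wreath_def)
  let ?W = "wreath_product A B"
  note grp = W.group_wreath
  have "\<exists>(Q :: nat monoid) \<pi>. finite_p_group p Q \<and> \<pi> \<in> epi ?W Q \<and> \<not> conjugate_in Q (\<pi> g) (\<pi> h)"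
    if gh: "g \<in> carrier ?W" "h \<in> carrier ?W" "\<not> conjugate_in ?W g h" for g h
  proof (cases "conjugate_in B (snd g) (snd h)")
    case False
    have snd: "snd \<in> hom ?W B" by (auto simp: hom_def W.carrier_wreath W.mult_wreath)
    obtain Q :: "nat monoid" and \<pi> where Q: "finite_p_group p Q" "\<pi> \<in> epi B Q"
      "\<not> conjugate_in Q (\<pi> (snd g)) (\<pi> (snd h))"
      using cs False gh by (force simp: p_conjugacy_separable_def W.carrier_wreath)
    have "\<pi> \<circ> snd \<in> hom ?W Q" using snd Q(2) by (auto simp: epi_def intro: hom_compose)
    then show ?thesis using p_conjugacy_separated_by_hom[OF p grp gh(1,2) Q(1)] Q(3) by simp
  next
    case True
    obtain f b where g: "g = (f, b)" "f \<in> carrier W.base" "b \<in> carrier B"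
      using gh by (auto simp: W.carrier_wreath)
    have "snd h \<in> carrier B" using gh by (auto simp: W.carrier_wreath)
    then obtain x where x: "x \<in> carrier B" "snd h \<otimes>\<^bsub>B\<^esub> x = x \<otimes>\<^bsub>B\<^esub> b"
      using True g conjugate_in_iff[OF B] by auto
    \<comment> \<open>Conjugating \<open>h\<close> makes the two elements act by the same \<open>b\<close>.\<close>
    let ?x = "(\<one>\<^bsub>W.base\<^esub>, x)"
    interpret Wr: group ?W by (rule grp)
    have xW: "?x \<in> carrier ?W" using x by (simp add: W.carrier_wreath)
    define h' where "h' = inv\<^bsub>?W\<^esub> ?x \<otimes>\<^bsub>?W\<^esub> h \<otimes>\<^bsub>?W\<^esub> ?x"
    have h'W: "h' \<in> carrier ?W" using xW gh by (simp add: h'_def)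
    have hx: "h \<otimes>\<^bsub>?W\<^esub> ?x = ?x \<otimes>\<^bsub>?W\<^esub> h'"
      using xW gh by (simp add: h'_def Wr.m_assoc[symmetric])
    have h'h: "conjugate_in ?W h' h" using hx xW gh h'W conjugate_in_iff[OF grp] by blast
    obtain f' b' where h': "h' = (f', b')" "f' \<in> carrier W.base" "b' \<in> carrier B"
      using h'W by (auto simp: W.carrier_wreath)
    have "x \<otimes>\<^bsub>B\<^esub> b' = x \<otimes>\<^bsub>B\<^esub> b"
      using arg_cong[OF hx, of snd] x gh h' by (cases h) (simp add: W.mult_wreath)
    then have bb: "b' = b" using x g h' by simp
    have nc: "\<not> conjugate_in ?W (f, b) (f', b)"
      using conjugate_in_trans[OF grp gh(1) h'W gh(2)] h'h gh(3) g h' bb by auto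
    define r where "r = (LEAST r. 0 < r \<and> b [^]\<^bsub>B\<^esub> (r::nat) = \<one>\<^bsub>B\<^esub>)"
    have r: "0 < r" "b [^]\<^bsub>B\<^esub> r = \<one>\<^bsub>B\<^esub>"
      using LeastI_ex[OF tors[OF g(3)]] by (simp_all add: r_def)
    have min: "b [^]\<^bsub>B\<^esub> i \<noteq> \<one>\<^bsub>B\<^esub>" if "0 < i" "i < r" for i :: nat
      using that not_less_Least[of i "\<lambda>r. 0 < r \<and> b [^]\<^bsub>B\<^esub> (r::nat) = \<one>\<^bsub>B\<^esub>"] by (auto simp: r_def)
    define e where "e = W.orb b r f"
    define e' where "e' = W.orb b r f'"
    have ee: "e \<in> carrier W.base" "e' \<in> carrier W.base" using g h' by (auto simp: e_def e'_def)
    have fin: "finite (W.supp e)" "finite (W.supp e')" using ee by (auto simp: W.base_iff)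
    define D where "D = (\<lambda>(s', s). s' \<otimes>\<^bsub>B\<^esub> inv\<^bsub>B\<^esub> s) ` (W.supp e' \<times> W.supp e)"
    define Y where "Y = W.supp e \<union> W.supp e' \<union> (\<Union>c\<in>D. (\<lambda>x. c \<otimes>\<^bsub>B\<^esub> x) ` W.supp e \<union>
              (\<lambda>x. inv\<^bsub>B\<^esub> c \<otimes>\<^bsub>B\<^esub> x) ` W.supp e' \<union> {c \<otimes>\<^bsub>B\<^esub> b, b \<otimes>\<^bsub>B\<^esub> c})"
    have Y: "finite Y" "Y \<subseteq> carrier B" using fin g by (auto simp: Y_def D_def)
    obtain Q :: "'d monoid" and \<pi> where Q: "finite_p_group p Q" "\<pi> \<in> hom B Q" "inj_on \<pi> Y"
      using sepB[OF Y] by blast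
    define E where "E = insert \<one>\<^bsub>A\<^esub> (e ` W.supp e \<union> e' ` W.supp e')"
    have E: "finite E" "E \<subseteq> carrier A" using fin ee by (auto simp: E_def)
    obtain A' :: "'c monoid" and \<alpha> where A': "finite_p_group p A'" "comm_group A'" "\<alpha> \<in> hom A A'"
        "inj_on \<alpha> E"
      using sepA[OF E] by blast
    have V: "wreath A' Q" using A' Q by (simp add: wreath_def finite_p_group_def)
    interpret M: wreath_map A B A' Q \<alpha> \<pi>
      using V A' Q W.wreath_axioms
      by (simp add: wreath_map_def wreath_map_axioms_def finite_p_group_def)
    have "\<not> conjugate_in (wreath_product A' Q) (M.wmap (f, b)) (M.wmap (f', b))"
    proof
      assume "conjugate_in (wreath_product A' Q) (M.wmap (f, b)) (M.wmap (f', b))"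
      then have "conjugate_in (wreath_product A' Q) (M.push f, \<pi> b) (M.push f', \<pi> b)"
        by (simp add: M.wmap_def)
      moreover have "\<pi> b [^]\<^bsub>Q\<^esub> r = \<one>\<^bsub>Q\<^esub>"
        using M.pi_pow[OF g(3), of r] r M.pi_pow[OF g(3), of 0] by simp
      ultimately obtain q where q: "q \<in> carrier Q" "q \<otimes>\<^bsub>Q\<^esub> \<pi> b = \<pi> b \<otimes>\<^bsub>Q\<^esub> q"
        "M.push e' = M.V.sh q (M.push e)"
        using M.V.conjugate_orb[of "M.push f" "M.push f'" "\<pi> b" r] g h'
        by (auto simp: e_def e'_def M.push_orb)
      obtain c where "c \<in> carrier B" "c \<otimes>\<^bsub>B\<^esub> b = b \<otimes>\<^bsub>B\<^esub> c" "e' = W.sh c e"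
        using M.lift_transfer[OF ee g(3) q D_def Y_def Q(3) A'(4)[unfolded E_def]] by blast
      then have "conjugate_in ?W (f, b) (f', b)"
        using W.orb_imp_conjugate[OF g(2) h'(2) g(3) r min] unfolding e_def e'_def by blast
      then show False using nc by simp
    qed
    moreover have "conjugate_in (wreath_product A' Q) (M.wmap h) (M.wmap h')"
      using conjugate_in_hom[OF grp M.V.group_wreath M.wmap_hom gh(2) h'W]
        conjugate_in_sym[OF grp h'W gh(2) h'h] by blast
    ultimately have nc': "\<not> conjugate_in (wreath_product A' Q) (M.wmap g) (M.wmap h)"
      using conjugate_in_trans[OF M.V.group_wreath, of "M.wmap g" "M.wmap h" "M.wmap h'"]
        hom_in_carrier[OF M.wmap_hom] gh h'W g h' bb by auto
    obtain i j where ij: "card (carrier A') = p ^ i" "card (carrier Q) = p ^ j"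
      using A' Q by (auto simp: finite_p_group_def order_def)
    have fin': "finite (carrier A')" "finite (carrier Q)" using A' Q by (auto simp: finite_p_group_def)
    have "carrier M.V.base = (carrier Q \<rightarrow>\<^sub>E carrier A')"
      using fin' by (auto simp: M.V.base_iff)
    then have "carrier (wreath_product A' Q) = (carrier Q \<rightarrow>\<^sub>E carrier A') \<times> carrier Q"
      by (simp add: M.V.carrier_wreath)
    then have "finite_p_group p (wreath_product A' Q)"
      using M.V.group_wreath fin' ij
      by (auto simp: finite_p_group_def order_def card_cartesian_product card_PiE finite_PiE
          power_mult[symmetric] power_add[symmetric])
    then show ?thesis
      using p_conjugacy_separated_by_hom[OF p grp gh(1,2) _ M.wmap_hom nc'] by blast
  qed
  then show ?thesis using grp by (auto simp: p_conjugacy_separable_def)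
qed



definition sec :: "nat \<Rightarrow> (nat list \<Rightarrow> nat list) \<Rightarrow> nat \<Rightarrow> nat list \<Rightarrow> nat list" where
  "sec p g x = (\<lambda>u\<in>regular_tree p. tl (g (x # u)))"

definition rot :: "(nat list \<Rightarrow> nat list) \<Rightarrow> nat" where
  "rot g = hd (g [0])"

section \<open>Sections of tree automorphisms\<close>

lemma add_mod_cancel:
  fixes a b c p :: nat
  assumes "(a + c) mod p = (b + c) mod p" "a < p" "b < p"
  shows "a = b"
proof -
  have "int p dvd (int a + int c) - (int b + int c)"
    using assms(1) by (metis mod_eq_dvd_iff of_nat_add zmod_int)
  then have "int p dvd int a - int b" by simp
  then have "int a mod int p = int b mod int p" by (simp add: mod_eq_dvd_iff)
  then show ?thesis using assms by simp
qed

lemma affine_inj_mod: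
  fixes m p :: nat
  assumes "coprime m p"
  shows "inj_on (\<lambda>i. (c + i * m) mod p) {..<p}"
proof (rule inj_onI)
  fix i j assume ij: "i \<in> {..<p}" "j \<in> {..<p}" "(c + i * m) mod p = (c + j * m) mod p"
  then have "int p dvd int (c + i * m) - int (c + j * m)"
    by (metis mod_eq_dvd_iff zmod_int)
  then have "int p dvd (int i - int j) * int m" by (simp add: left_diff_distrib)
  moreover have "coprime (int p) (int m)" using assms by (simp add: coprime_commute)
  ultimately have "int p dvd int i - int j" by (simp add: coprime_dvd_mult_left_iff)
  then have "int i mod int p = int j mod int p" by (simp add: mod_eq_dvd_iff)
  then show "i = j" using ij by simp
qed

lemma affine_image_mod:
  fixes m p :: nat
  assumes "coprime m p" "p > 0"
  shows "(\<lambda>i. (c + i * m) mod p) ` {..<p} = {..<p}"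
  using assms(2) by (intro card_subset_eq) (auto simp: card_image[OF affine_inj_mod[OF assms(1)]])

lemma tree_aut_Cons:
  assumes g: "g \<in> tree_aut p" and x: "x < p" and u: "u \<in> regular_tree p"
  shows "g (x # u) = hd (g [x]) # sec p g x u"
proof -
  have T: "x # u \<in> regular_tree p" "[x] \<in> regular_tree p" using x u by auto
  have "length (g (x # u)) = Suc (length u)" using tree_aut_props(4)[OF g T(1)] by simp
  then obtain y v where y: "g (x # u) = y # v" by (cases "g (x # u)") auto
  have "g [x] = take 1 (g (x # u))" using tree_aut_props(5)[OF g T(1), of 1] by simp
  then show ?thesis using y u by (simp add: sec_def)
qed

text \<open>
  The groups under study act on the first level through rotations \<open>x \<mapsto> x + rot g\<close>, and so do all their
  sections. Keeping the whole group structure \<open>G\<close>, rather than a subgroup of the automorphism group, as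
  the parameter lets inverses and powers be taken inside \<open>G\<close>.
\<close>

locale rot_group = group G for p :: nat and G :: "(nat list \<Rightarrow> nat list) monoid" (structure) +
  assumes p_gt_1: "p > 1"
    and carrier_sub: "carrier G \<subseteq> tree_aut p"
    and mult_eq: "g \<in> carrier G \<Longrightarrow> h \<in> carrier G \<Longrightarrow> g \<otimes> h = compose (regular_tree p) g h"
    and one_eq: "\<one> = (\<lambda>w\<in>regular_tree p. w)"
    and rot_eq: "g \<in> carrier G \<Longrightarrow> x < p \<Longrightarrow> g [x] = [(x + rot g) mod p]"
    and st_closed[simp]: "g \<in> carrier G \<Longrightarrow> x < p \<Longrightarrow> sec p g x \<in> carrier G"
begin

abbreviation st where "st \<equiv> sec p"

lemma p_pos[simp]: "p > 0" using p_gt_1 by simp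

lemma app_Cons: "g \<in> carrier G \<Longrightarrow> x < p \<Longrightarrow> u \<in> regular_tree p \<Longrightarrow>
    g (x # u) = ((x + rot g) mod p) # st g x u"
  using tree_aut_Cons[of g p x u] carrier_sub rot_eq[of g x] by auto

lemma app_Nil: "g \<in> carrier G \<Longrightarrow> g [] = []"
  using tree_aut_props(4)[of g p "[]"] carrier_sub by auto

lemma app_closed: "g \<in> carrier G \<Longrightarrow> w \<in> regular_tree p \<Longrightarrow> g w \<in> regular_tree p"
  using tree_aut_props(1)[of g p w] carrier_sub by auto

lemma app_mult: "g \<in> carrier G \<Longrightarrow> h \<in> carrier G \<Longrightarrow> w \<in> regular_tree p \<Longrightarrow> (g \<otimes> h) w = g (h w)"
  by (simp add: mult_eq compose_eq)

lemma rot_less[simp]: "g \<in> carrier G \<Longrightarrow> rot g < p"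
  using rot_eq[of g 0] by (metis add_0 list.sel(1) mod_less_divisor p_pos rot_def)

lemma rot_mod[simp]: "g \<in> carrier G \<Longrightarrow> rot g mod p = rot g"
  by simp

lemma ext: "g \<in> carrier G \<Longrightarrow> g \<in> extensional (regular_tree p)"
  using carrier_sub by (auto simp: tree_aut_def Bij_def)

lemma app_eqI:
  assumes "g \<in> carrier G" "h \<in> carrier G" "\<And>w. w \<in> regular_tree p \<Longrightarrow> g w = h w"
  shows "g = h"
  using assms by (intro extensionalityI[of g "regular_tree p" h] ext) auto

lemma st_rot_eqI:
  assumes g: "g \<in> carrier G" and h: "h \<in> carrier G" and "rot g = rot h"
    and "\<And>i. i < p \<Longrightarrow> st g i = st h i"
  shows "g = h"
proof (rule app_eqI[OF g h])
  fix w assume "w \<in> regular_tree p"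
  then show "g w = h w" using assms by (cases w) (auto simp: app_Nil app_Cons)
qed

lemma rot_mult: 
  assumes "g \<in> carrier G" "h \<in> carrier G"
  shows "rot (g \<otimes> h) = (rot g + rot h) mod p"
proof -
  have "(g \<otimes> h) [0] = [(rot h + rot g) mod p]"
    using assms by (simp add: app_mult rot_eq[of g] rot_eq[of h])
  then have "hd ((g \<otimes> h) [0]) = (rot g + rot h) mod p" by (simp add: add.commute)
  then show ?thesis by (simp add: rot_def[of "g \<otimes> h"])
qed

lemma st_mult:
  assumes g: "g \<in> carrier G" and h: "h \<in> carrier G" and i: "i < p"
  shows "st (g \<otimes> h) i = st g ((i + rot h) mod p) \<otimes> st h i"
proof (rule app_eqI)
  fix w assume w: "w \<in> regular_tree p"
  have "st (g \<otimes> h) i w = tl (g (h (i # w)))"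
    using assms w by (simp add: sec_def app_mult)
  also have "\<dots> = st g ((i + rot h) mod p) (st h i w)"
    using assms w by (simp add: app_Cons app_closed)
  finally show "st (g \<otimes> h) i w = (st g ((i + rot h) mod p) \<otimes> st h i) w"
    using assms w by (simp add: app_mult)
qed (use assms in auto)

lemma rot_one[simp]: "rot \<one> = 0"
  by (simp add: rot_def one_eq)

lemma st_one[simp]: "i < p \<Longrightarrow> st \<one> i = \<one>"
  by (auto simp: sec_def one_eq fun_eq_iff restrict_def)

lemma rot_inv: "g \<in> carrier G \<Longrightarrow> rot (inv g) = (p - rot g) mod p"
proof -
  assume g: "g \<in> carrier G"
  have "(rot (inv g) + rot g) mod p = 0" using rot_mult[of "inv g" g] g by simp
  moreover have "rot (inv g) < p" "rot g < p" using g by auto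
  ultimately show ?thesis
    by (cases "rot (inv g) + rot g < p") (auto simp: le_mod_geq)
qed

lemma st_inv:
  assumes g: "g \<in> carrier G" and i: "i < p"
  shows "st (inv g) ((i + rot g) mod p) = inv (st g i)"
proof -
  have "st (inv g) ((i + rot g) mod p) \<otimes> st g i = \<one>"
    using st_mult[of "inv g" g i] assms by simp
  then show ?thesis using assms by (simp add: inv_equality)
qed

lemma st_inv0: "g \<in> carrier G \<Longrightarrow> rot g = 0 \<Longrightarrow> i < p \<Longrightarrow> st (inv g) i = inv (st g i)"
  using st_inv[of g i] by simp

lemma st_mult0: "g \<in> carrier G \<Longrightarrow> h \<in> carrier G \<Longrightarrow> rot h = 0 \<Longrightarrow> i < p \<Longrightarrow>
    st (g \<otimes> h) i = st g i \<otimes> st h i"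
  by (simp add: st_mult)

lemma rot_pow: "g \<in> carrier G \<Longrightarrow> rot (g [^] (n::nat)) = (n * rot g) mod p"
  by (induction n) (simp_all add: rot_mult mod_simps add.commute)

lemma rot_pow_p: "g \<in> carrier G \<Longrightarrow> rot (g [^] p) = 0"
  by (simp add: rot_pow)

lemma st_pow_Suc: "g \<in> carrier G \<Longrightarrow> i < p \<Longrightarrow>
    st (g [^] Suc n) i = st g ((i + n * rot g) mod p) \<otimes> st (g [^] n) i"
  using st_mult[of g "g [^] n" i] unfolding nat_pow_Suc2[of g n] by (simp add: rot_pow mod_simps)

lemma st_pow0: "g \<in> carrier G \<Longrightarrow> rot g = 0 \<Longrightarrow> i < p \<Longrightarrow> st (g [^] (n::nat)) i = st g i [^] n"
  by (induction n) (simp_all add: st_mult)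

lemma rot_conj: "g \<in> carrier G \<Longrightarrow> x \<in> carrier G \<Longrightarrow> rot (x \<otimes> g \<otimes> inv x) = rot g"
proof -
  assume *: "g \<in> carrier G" "x \<in> carrier G"
  then have "(x \<otimes> g \<otimes> inv x) \<otimes> x = x \<otimes> g" by (simp add: m_assoc)
  then have "(rot (x \<otimes> g \<otimes> inv x) + rot x) mod p = (rot g + rot x) mod p"
    using * rot_mult[of "x \<otimes> g \<otimes> inv x" x] rot_mult[of x g] by (simp add: add.commute)
  then show ?thesis using * by (elim add_mod_cancel) simp_all
qed

lemma st_conj:
  assumes g: "g \<in> carrier G" and x: "x \<in> carrier G" and rot: "rot g = 0" and i: "i < p"
  shows "st (x \<otimes> g \<otimes> inv x) ((i + rot x) mod p) = st x i \<otimes> st g i \<otimes> inv (st x i)"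
proof -
  have "(x \<otimes> g \<otimes> inv x) \<otimes> x = x \<otimes> g" using g x by (simp add: m_assoc)
  then have "st (x \<otimes> g \<otimes> inv x) ((i + rot x) mod p) \<otimes> st x i = st x i \<otimes> st g i"
    using st_mult[of "x \<otimes> g \<otimes> inv x" x i] st_mult[of x g i] assms by simp
  then show ?thesis using assms by (simp add: inv_solve_right)
qed

end



section \<open>Branch groups and quotients that detect conjugacy\<close>

lemma (in group) p_group_order:
  assumes p: "Factorial_Ring.prime (p::nat)" and fin: "finite (carrier G)"
    and exp: "\<And>g. g \<in> carrier G \<Longrightarrow> g [^] (p ^ e) = \<one>"
  shows "finite_p_group p G"
proof -
  have G: "group G" by (rule is_group)
  have "\<exists>k. order G = p ^ k"
  proof (rule ccontr)
    assume "\<nexists>k. order G = p ^ k"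
    then obtain q where q: "q \<in> prime_factors (order G)" "q \<noteq> p"
      using Ex_other_prime_factor[of "order G" p] p fin by (auto simp: order_gt_0_iff_finite)
    then have pq: "Factorial_Ring.prime q" "q dvd order G" by auto
    then obtain m where m: "order G = q ^ 1 * m" by (auto simp: dvd_def)
    obtain H where H: "subgroup H G" "card H = q ^ 1"
      using sylow_thm[OF pq(1) G m fin] by blast
    interpret H: group "G\<lparr>carrier := H\<rparr>" by (rule subgroup.subgroup_is_group[OF H(1) G])
    have "H \<noteq> {\<one>}" using H(2) prime_gt_1_nat[OF pq(1)] by auto
    then obtain h where h: "h \<in> H" "h \<noteq> \<one>" using subgroup.one_closed[OF H(1)] by blast
    have hG: "h \<in> carrier G" using h subgroup.subset[OF H(1)] by blast
    have "h [^] q = \<one>"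
      using H.pow_order_eq_1[of h] h H(2) nat_pow_consistent[of h q H] by (simp add: order_def)
    then have "ord h dvd q" using hG by (simp add: pow_eq_id)
    moreover have "ord h dvd p ^ e" using exp[OF hG] hG by (simp add: pow_eq_id)
    moreover have "coprime q (p ^ e)" using pq p q(2) by (simp add: primes_coprime)
    ultimately have "ord h = 1" using coprime_common_divisor_nat by blast
    then show False using h(2) hG pow_ord_eq_1[OF hG] by simp
  qed
  then show ?thesis using fin by (simp add: finite_p_group_def)
qed

context group
begin

lemma cancel:
  "x \<in> carrier G \<Longrightarrow> y \<in> carrier G \<Longrightarrow> inv x \<otimes> (x \<otimes> y) = y"
  "x \<in> carrier G \<Longrightarrow> y \<in> carrier G \<Longrightarrow> x \<otimes> (inv x \<otimes> y) = y"
  by (simp_all add: m_assoc[symmetric])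

end

lemma (in normal) rcos_eq_iff:
  assumes "g \<in> carrier G" "h \<in> carrier G"
  shows "H #> g = H #> h \<longleftrightarrow> inv h \<otimes> g \<in> H"
proof -
  have "H #> g = H #> h \<longleftrightarrow> g \<in> H #> h"
    using assms repr_independence[OF _ assms(2) subgroup_axioms] rcos_self[OF assms(1) subgroup_axioms]
    by auto
  also have "\<dots> \<longleftrightarrow> g \<in> h <# H" using coset_eq assms by simp
  also have "\<dots> \<longleftrightarrow> inv h \<otimes> g \<in> H"
  proof
    assume "g \<in> h <# H"
    then obtain r where r: "r \<in> H" "g = h \<otimes> r" by (auto simp: l_coset_def)
    have "inv h \<otimes> g = r" unfolding r(2) using r(1) assms(2) mem_carrier by (simp add: m_assoc[symmetric])
    then show "inv h \<otimes> g \<in> H" using r by simp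
  next
    assume *: "inv h \<otimes> g \<in> H"
    have "g = h \<otimes> (inv h \<otimes> g)" using assms by (simp add: m_assoc[symmetric])
    then show "g \<in> h <# H" using * by (auto simp: l_coset_def)
  qed
  finally show ?thesis .
qed

lemma (in normal) finite_rcosets_invariant:
  assumes fin: "finite (h ` carrier G)"
    and key: "\<And>f g. f \<in> carrier G \<Longrightarrow> g \<in> carrier G \<Longrightarrow> h f = h g \<Longrightarrow> inv g \<otimes> f \<in> H"
  shows "finite (rcosets H)"
proof -
  have "rcosets H = (\<lambda>g. H #> g) ` carrier G" by (auto simp: RCOSETS_def)
  also have "\<dots> = (\<lambda>z. H #> (SOME g. g \<in> carrier G \<and> h g = z)) ` h ` carrier G"
    unfolding image_image
  proof (rule image_cong[OF refl])
    fix g assume g: "g \<in> carrier G"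
    define g' where "g' = (SOME g'. g' \<in> carrier G \<and> h g' = h g)"
    have g': "g' \<in> carrier G \<and> h g' = h g"
      unfolding g'_def by (rule someI[of _ g]) (simp add: g)
    then have "H #> g = H #> g'" using rcos_eq_iff[of g g'] key[of g g'] g by simp
    then show "H #> g = H #> (SOME g'. g' \<in> carrier G \<and> h g' = h g)"
      by (simp only: g'_def)
  qed
  finally show ?thesis using fin by simp
qed

text \<open>
  The branching assumption says that \<open>K\<close> contains the group \<open>K \<times> \<cdots> \<times> K\<close> acting coordinatewise on the
  first-level subtrees.
\<close>

locale branch_group = rot_group +
  fixes K e
  assumes p_prime: "Factorial_Ring.prime p"
    and K_normal: "K \<lhd> G"
    and K_rot: "k \<in> K \<Longrightarrow> rot k = 0"
    and K_branch: "(\<And>i. i < p \<Longrightarrow> f i \<in> K) \<Longrightarrow> \<exists>k\<in>K. \<forall>i<p. sec p k i = f i"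
    and K_exp: "g \<in> carrier G \<Longrightarrow> g [^] (p ^ e) \<in> K"
    and K_fin: "finite (rcosets K)"
begin

text \<open>
  The \<open>n\<close>-th member of this chain is \<open>K \<times> \<cdots> \<times> K\<close> with \<open>p\<^sup>n\<close> factors, acting below level \<open>n\<close>. It lies in
  \<open>K\<close> by the branching assumption, so a congruence modulo \<open>R n\<close> determines the coset modulo \<open>K\<close>.
\<close>

primrec R :: "nat \<Rightarrow> (nat list \<Rightarrow> nat list) set" where
  "R 0 = K"
| "R (Suc n) = {g \<in> carrier G. rot g = 0 \<and> (\<forall>i<p. st g i \<in> R n)}"

lemma K_carrier: "k \<in> K \<Longrightarrow> k \<in> carrier G"
  using normal_imp_subgroup[OF K_normal] by (rule subgroup.mem_carrier)

lemma R_normal: "R n \<lhd> G"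
proof (induction n)
  case 0
  then show ?case by (simp add: K_normal)
next
  case (Suc n)
  interpret N: normal "R n" G by (rule Suc)
  show ?case
    unfolding normal_inv_iff
  proof (intro conjI ballI)
    show "subgroup (R (Suc n)) G"
    proof (rule subgroupI)
      have "\<one> \<in> R (Suc n)" by simp
      then show "R (Suc n) \<noteq> {}" by blast
      show "inv g \<in> R (Suc n)" if "g \<in> R (Suc n)" for g
        using that by (auto simp: rot_inv st_inv0)
      show "g \<otimes> h \<in> R (Suc n)" if "g \<in> R (Suc n)" "h \<in> R (Suc n)" for g h
        using that by (auto simp: rot_mult st_mult0)
    qed auto
    fix x g assume x: "x \<in> carrier G" and g: "g \<in> R (Suc n)"
    have gG: "g \<in> carrier G" and g0: "rot g = 0" using g by auto
    have "st (x \<otimes> g \<otimes> inv x) i \<in> R n" if i: "i < p" for i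
    proof -
      define j where "j = (i + (p - rot x)) mod p"
      have j: "j < p" by (simp add: j_def)
      have "i + (p - rot x) + rot x = i + p" using rot_less[OF x] by simp
      then have "(j + rot x) mod p = i" using i unfolding j_def mod_add_left_eq by simp
      then have "st (x \<otimes> g \<otimes> inv x) i = st x j \<otimes> st g j \<otimes> inv (st x j)"
        using st_conj[OF gG x g0 j] by simp
      then show ?thesis using g j x by (auto intro: N.inv_op_closed2)
    qed
    then show "x \<otimes> g \<otimes> inv x \<in> R (Suc n)" using x gG g0 by (simp add: rot_conj)
  qed
qed

lemma R_carrier: "g \<in> R n \<Longrightarrow> g \<in> carrier G"
  using normal_imp_subgroup[OF R_normal] by (rule subgroup.mem_carrier)

lemma R_conj: "r \<in> R n \<Longrightarrow> x \<in> carrier G \<Longrightarrow> x \<otimes> r \<otimes> inv x \<in> R n"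
  using normal.inv_op_closed2[OF R_normal] .

lemma R_conj': "r \<in> R n \<Longrightarrow> x \<in> carrier G \<Longrightarrow> inv x \<otimes> r \<otimes> x \<in> R n"
  using normal.inv_op_closed1[OF R_normal] .

lemma R_mult: "r \<in> R n \<Longrightarrow> s \<in> R n \<Longrightarrow> r \<otimes> s \<in> R n"
  using normal_imp_subgroup[OF R_normal] by (rule subgroup.m_closed)

lemma R_one: "\<one> \<in> R n"
  using normal_imp_subgroup[OF R_normal] by (rule subgroup.one_closed)

lemma R_rot: "r \<in> R n \<Longrightarrow> rot r = 0"
  by (cases n) (auto simp: K_rot)

lemma R_Suc: "R (Suc n) \<subseteq> R n"
proof (induction n)
  case 0
  show ?case
  proof
    fix g assume g: "g \<in> R (Suc 0)"
    then have g': "g \<in> carrier G" "rot g = 0" "\<And>i. i < p \<Longrightarrow> st g i \<in> K" by auto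
    obtain k where k: "k \<in> K" "\<forall>i<p. st k i = st g i"
      using K_branch[of "st g", OF g'(3)] by blast
    have "g = k"
      by (rule st_rot_eqI) (use g' k in \<open>simp_all add: K_rot K_carrier\<close>)
    then show "g \<in> R 0" using k by simp
  qed
next
  case (Suc n)
  then show ?case by auto
qed

lemma R_antimono: "m \<le> n \<Longrightarrow> R n \<subseteq> R m"
  using R_Suc by (rule lift_Suc_antimono_le)

lemma R_K: "r \<in> R n \<Longrightarrow> r \<in> K"
  using R_antimono[of 0 n] by auto

lemma R_level: "g \<in> R n \<Longrightarrow> w \<in> regular_tree p \<Longrightarrow> length w \<le> n \<Longrightarrow> g w = w"
proof (induction n arbitrary: g w)
  case 0
  then show ?case by (simp add: app_Nil K_carrier)
next
  case (Suc n)
  then show ?case by (cases w) (auto simp: app_Nil app_Cons)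
qed

lemma R_trivial:
  assumes "g \<in> carrier G" "g \<noteq> \<one>"
  shows "\<exists>n. g \<notin> R n"
proof (rule ccontr)
  assume "\<not> ?thesis"
  then have "g w = w" if "w \<in> regular_tree p" for w
    using R_level[of g "length w" w] that by blast
  then have "g = \<one>"
    by (intro app_eqI[OF assms(1) one_closed]) (simp add: one_eq)
  then show False using assms by simp
qed

lemma R_coset_eq:
  "g \<in> carrier G \<Longrightarrow> h \<in> carrier G \<Longrightarrow> R n #> g = R n #> h \<longleftrightarrow> inv h \<otimes> g \<in> R n"
  by (rule normal.rcos_eq_iff[OF R_normal])

lemma R_finite: "finite (rcosets (R n))"
proof (induction n)
  case 0
  then show ?case using K_fin by simp
next
  case (Suc n)
  define h where "h g = (rot g, \<lambda>i\<in>{..<p}. R n #> st g i)" for g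
  have "h ` carrier G \<subseteq> {..<p} \<times> ({..<p} \<rightarrow>\<^sub>E rcosets (R n))"
    by (auto simp: h_def RCOSETS_def intro!: bexI[of _ "st _ _"])
  then have fin: "finite (h ` carrier G)"
    by (rule finite_subset) (use Suc in \<open>auto intro: finite_PiE\<close>)
  have key: "inv g \<otimes> f \<in> R (Suc n)" if fg: "f \<in> carrier G" "g \<in> carrier G" "h f = h g" for f g
  proof -
    have rot: "rot f = rot g" and st: "\<And>i. i < p \<Longrightarrow> R n #> st f i = R n #> st g i"
      using fg(3) by (auto simp: h_def restrict_def fun_eq_iff split: if_splits)
    define r where "r = inv g \<otimes> f"
    have r: "r \<in> carrier G" "f = g \<otimes> r" using fg by (simp_all add: r_def m_assoc[symmetric])
    have "(rot r + rot g) mod p = (0 + rot g) mod p"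
      using rot_mult[of g r] r fg rot by (simp add: add.commute)
    then have r0: "rot r = 0" by (rule add_mod_cancel) (use r in auto)
    have "st r i \<in> R n" if i: "i < p" for i
    proof -
      have "inv (st g i) \<otimes> st f i \<in> R n" using st[OF i] R_coset_eq fg i by simp
      moreover have "st f i = st g i \<otimes> st r i" using st_mult0[OF fg(2) r(1) r0 i] r by simp
      ultimately show ?thesis using fg r i by (simp add: m_assoc[symmetric])
    qed
    then have "r \<in> R (Suc n)" using r r0 by simp
    then show ?thesis by (simp only: r_def)
  qed
  show ?case by (rule normal.finite_rcosets_invariant[OF R_normal fin key])
qed

lemma R_exp: "g \<in> carrier G \<Longrightarrow> g [^] (p ^ (e + n)) \<in> R n"
proof (induction n arbitrary: g)
  case 0
  then show ?case by (simp add: K_exp)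
next
  case (Suc n)
  have gp: "g [^] p \<in> carrier G" "rot (g [^] p) = 0" using Suc.prems rot_pow_p by auto
  have eq: "g [^] (p ^ (e + Suc n)) = (g [^] p) [^] (p ^ (e + n))"
    using Suc.prems by (simp add: nat_pow_pow)
  have "st (g [^] (p ^ (e + Suc n))) i \<in> R n" if "i < p" for i
    unfolding eq using gp that Suc.IH by (simp add: st_pow0)
  moreover have "rot (g [^] (p ^ (e + Suc n))) = 0"
    unfolding eq using gp by (simp add: rot_pow)
  ultimately show ?case using Suc.prems by simp
qed

lemma finite_p_group_quotient: "finite_p_group p (G Mod R n)"
proof (rule group.p_group_order[OF _ p_prime])
  interpret N: normal "R n" G by (rule R_normal)
  show grp: "group (G Mod R n)" by (rule N.factorgroup_is_group)
  show "finite (carrier (G Mod R n))" using R_finite by (simp add: FactGroup_def)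
  fix z assume "z \<in> carrier (G Mod R n)"
  then obtain g where g: "g \<in> carrier G" "z = R n #> g" by (auto simp: carrier_FactGroup)
  have "z [^]\<^bsub>G Mod R n\<^esub> (p ^ (e + n)) = R n #> (g [^] (p ^ (e + n)))"
    using g N.r_coset_hom_Mod grp is_group group_hom.hom_nat_pow[of G "G Mod R n" "\<lambda>g. R n #> g" g]
    by (simp add: group_hom_def group_hom_axioms_def)
  also have "\<dots> = R n" using R_exp[OF g(1)] N.rcos_const by simp
  finally show "z [^]\<^bsub>G Mod R n\<^esub> (p ^ (e + n)) = \<one>\<^bsub>G Mod R n\<^esub>" by simp
qed

lemma finite_subset_separated:
  assumes "finite S" "S \<subseteq> carrier G"
  shows "\<exists>n. inj_on (\<lambda>g. R n #> g) S"
proof -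
  let ?D = "{(g, h) \<in> S \<times> S. g \<noteq> h}"
  have "\<exists>n. inv h \<otimes> g \<notin> R n" if gh: "(g, h) \<in> ?D" for g h
  proof (rule R_trivial)
    have "g \<in> carrier G" "h \<in> carrier G" "g \<noteq> h" using gh assms by auto
    note gh' = this
    show "inv h \<otimes> g \<in> carrier G" using gh' by simp
    show "inv h \<otimes> g \<noteq> \<one>"
    proof
      assume "inv h \<otimes> g = \<one>"
      then have "h \<otimes> (inv h \<otimes> g) = h \<otimes> \<one>" by simp
      then show False using gh' by (simp add: cancel)
    qed
  qed
  then have "\<forall>z\<in>?D. \<exists>n. inv (snd z) \<otimes> fst z \<notin> R n" by auto
  from bchoice[OF this] obtain N where N: "\<forall>z\<in>?D. inv (snd z) \<otimes> fst z \<notin> R (N z)" ..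
  define M where "M = sum N ?D"
  have fin: "finite ?D" by (rule finite_subset[of _ "S \<times> S"]) (use assms in auto)
  have "inj_on (\<lambda>g. R M #> g) S"
  proof (rule inj_onI, rule ccontr)
    fix g h assume *: "g \<in> S" "h \<in> S" "R M #> g = R M #> h" "g \<noteq> h"
    then have D: "(g, h) \<in> ?D" by simp
    have "N (g, h) \<le> M" unfolding M_def by (rule member_le_sum[OF D _ fin]) simp
    then have "R M \<subseteq> R (N (g, h))" by (rule R_antimono)
    moreover have "inv h \<otimes> g \<notin> R (N (g, h))" using bspec[OF N D] by simp
    moreover have "inv h \<otimes> g \<in> R M" using * R_coset_eq[of g h M] assms(2) by blast
    ultimately show False by blast
  qed
  then show ?thesis by blast
qed

text \<open>
  Conjugation of \<open>v\<close> to \<open>u\<close> modulo \<open>R n\<close> can be corrected to true conjugation without leaving the coset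
  modulo \<open>K\<close>. Remembering this coset is what makes the property pass from the sections to the group.
  The relation is vacuous if \<open>u\<close> and \<open>v\<close> are not conjugate modulo \<open>R n\<close>, in which case the finite
  quotient by \<open>R n\<close> separates them.
\<close>

definition approx :: "(nat list \<Rightarrow> nat list) \<Rightarrow> (nat list \<Rightarrow> nat list) \<Rightarrow> nat \<Rightarrow> bool" where
  "approx u v n \<longleftrightarrow> (\<forall>g\<in>carrier G. (\<exists>r\<in>R n. u \<otimes> g = g \<otimes> v \<otimes> r) \<longrightarrow>
     (\<exists>k\<in>K. u \<otimes> (g \<otimes> k) = (g \<otimes> k) \<otimes> v))"

definition detected :: "(nat list \<Rightarrow> nat list) \<Rightarrow> (nat list \<Rightarrow> nat list) \<Rightarrow> bool" where
  "detected u v \<longleftrightarrow> (\<exists>n. approx u v n)"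

lemma approx_mono: "approx u v m \<Longrightarrow> m \<le> n \<Longrightarrow> approx u v n"
  unfolding approx_def using R_antimono by blast

lemma detected_conj:
  assumes u: "u \<in> carrier G" and v: "v \<in> carrier G" and x: "x \<in> carrier G" and y: "y \<in> carrier G"
    and P: "detected u v"
  shows "detected (x \<otimes> u \<otimes> inv x) (y \<otimes> v \<otimes> inv y)"
proof -
  obtain n where n: "approx u v n" using P by (auto simp: detected_def)
  have "approx (x \<otimes> u \<otimes> inv x) (y \<otimes> v \<otimes> inv y) n"
    unfolding approx_def
  proof (intro ballI impI)
    fix g assume g: "g \<in> carrier G" and "\<exists>r\<in>R n. x \<otimes> u \<otimes> inv x \<otimes> g = g \<otimes> (y \<otimes> v \<otimes> inv y) \<otimes> r"
    then obtain r where r: "r \<in> R n" "x \<otimes> u \<otimes> inv x \<otimes> g = g \<otimes> (y \<otimes> v \<otimes> inv y) \<otimes> r" by blast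
    have rG: "r \<in> carrier G" using r R_carrier by blast
    let ?g = "inv x \<otimes> g \<otimes> y" and ?r = "inv y \<otimes> r \<otimes> y"
    have "u \<otimes> ?g = inv x \<otimes> (x \<otimes> u \<otimes> inv x \<otimes> g) \<otimes> y"
      using u x y g by (simp add: m_assoc cancel)
    also have "\<dots> = ?g \<otimes> v \<otimes> ?r"
      unfolding r(2) using v x y g rG by (simp add: m_assoc cancel)
    finally have "\<exists>r\<in>R n. u \<otimes> ?g = ?g \<otimes> v \<otimes> r" using R_conj' r y by blast
    then obtain k where k: "k \<in> K" "u \<otimes> (?g \<otimes> k) = (?g \<otimes> k) \<otimes> v"
      using n[unfolded approx_def, rule_format, of ?g] x y g by blast
    have kG: "k \<in> carrier G" using k K_carrier by blast
    let ?k = "y \<otimes> k \<otimes> inv y"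
    have gk: "g \<otimes> ?k = x \<otimes> (?g \<otimes> k) \<otimes> inv y" 
      using x y g kG by (simp add: m_assoc cancel)
    have "x \<otimes> u \<otimes> inv x \<otimes> (g \<otimes> ?k) = x \<otimes> (u \<otimes> (?g \<otimes> k)) \<otimes> inv y"
      using u x y g kG by (simp add: m_assoc cancel)
    also have "\<dots> = (x \<otimes> (?g \<otimes> k) \<otimes> inv y) \<otimes> (y \<otimes> v \<otimes> inv y)"
      unfolding k(2) using v x y g kG by (simp add: m_assoc cancel)
    also have "\<dots> = (g \<otimes> ?k) \<otimes> (y \<otimes> v \<otimes> inv y)" by (simp only: gk)
    finally show "\<exists>k\<in>K. x \<otimes> u \<otimes> inv x \<otimes> (g \<otimes> k) = g \<otimes> k \<otimes> (y \<otimes> v \<otimes> inv y)"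
      using R_conj[of k 0 y] k y by auto
  qed
  then show ?thesis by (auto simp: detected_def)
qed

lemma detected_rot_differ:
  assumes u: "u \<in> carrier G" and v: "v \<in> carrier G" and "rot u \<noteq> rot v"
  shows "detected u v"
  unfolding detected_def approx_def
proof (intro exI ballI impI)
  fix g assume g: "g \<in> carrier G" and "\<exists>r\<in>R 0. u \<otimes> g = g \<otimes> v \<otimes> r"
  then obtain r where r: "r \<in> R 0" "u \<otimes> g = g \<otimes> v \<otimes> r" by blast
  have "rot (u \<otimes> g) = rot (g \<otimes> v \<otimes> r)" by (simp only: r(2))
  then have "(rot u + rot g) mod p = (rot v + rot g) mod p"
    using u v g R_carrier[OF r(1)] R_rot[OF r(1)] by (simp add: rot_mult add.commute)
  then have "rot u = rot v" by (rule add_mod_cancel) (use u v in auto)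
  then show "\<exists>k\<in>K. u \<otimes> (g \<otimes> k) = g \<otimes> k \<otimes> v" using assms by simp
qed

lemma uniform_approx:
  assumes "\<And>i j. i < p \<Longrightarrow> j < p \<Longrightarrow> detected (f i) (h j)"
  shows "\<exists>n. \<forall>i<p. \<forall>j<p. approx (f i) (h j) n"
proof -
  have "\<forall>z\<in>{..<p} \<times> {..<p}. \<exists>n. approx (f (fst z)) (h (snd z)) n"
    using assms by (auto simp: detected_def)
  from bchoice[OF this] obtain N where N: "\<forall>z\<in>{..<p} \<times> {..<p}. approx (f (fst z)) (h (snd z)) (N z)" ..
  have "approx (f i) (h j) (sum N ({..<p} \<times> {..<p}))" if ij: "i < p" "j < p" for i j
  proof (rule approx_mono)
    show "approx (f i) (h j) (N (i, j))" using bspec[OF N, of "(i, j)"] ij by simp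
    show "N (i, j) \<le> sum N ({..<p} \<times> {..<p})" using ij by (intro member_le_sum) auto
  qed
  then show ?thesis by blast
qed

text \<open>
  If \<open>u\<close> and \<open>v\<close> fix the first level, an approximate conjugator consists of approximate conjugators between
  their sections. Each is corrected by some \<open>\<kappa> i \<in> K\<close>, and the branching assumption assembles the corrections
  into one element of \<open>K\<close>.
\<close>

lemma detected_stab:
  assumes u: "u \<in> carrier G" "rot u = 0" and v: "v \<in> carrier G" "rot v = 0"
    and P: "\<And>i j. i < p \<Longrightarrow> j < p \<Longrightarrow> detected (st u i) (st v j)"
  shows "detected u v"
proof -
  obtain n where n: "\<And>i j. i < p \<Longrightarrow> j < p \<Longrightarrow> approx (st u i) (st v j) n"
    using uniform_approx[of "st u" "st v"] P by blast
  have "approx u v (Suc n)"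
    unfolding approx_def
  proof (intro ballI impI)
    fix g assume g: "g \<in> carrier G" and "\<exists>r\<in>R (Suc n). u \<otimes> g = g \<otimes> v \<otimes> r"
    then obtain r where r: "r \<in> R (Suc n)" "u \<otimes> g = g \<otimes> v \<otimes> r" by blast
    have rG: "r \<in> carrier G" "rot r = 0" "\<And>i. i < p \<Longrightarrow> st r i \<in> R n" using r by auto
    have "\<exists>k\<in>K. st u ((i + rot g) mod p) \<otimes> (st g i \<otimes> k) = (st g i \<otimes> k) \<otimes> st v i" if i: "i < p" for i
    proof -
      have "st (u \<otimes> g) i = st (g \<otimes> v \<otimes> r) i" by (simp only: r(2))
      then have "st u ((i + rot g) mod p) \<otimes> st g i = st g i \<otimes> st v i \<otimes> st r i"
        using u v g rG i by (simp add: st_mult rot_mult)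
      then show ?thesis
        using n[of "(i + rot g) mod p" i, unfolded approx_def, rule_format, of "st g i"] i g rG(3)[OF i]
        by (meson mod_less_divisor p_pos st_closed)
    qed
    then obtain \<kappa> where \<kappa>: "\<And>i. i < p \<Longrightarrow> \<kappa> i \<in> K"
      "\<And>i. i < p \<Longrightarrow> st u ((i + rot g) mod p) \<otimes> (st g i \<otimes> \<kappa> i) = (st g i \<otimes> \<kappa> i) \<otimes> st v i" by metis
    obtain k where k: "k \<in> K" "\<And>i. i < p \<Longrightarrow> st k i = \<kappa> i" using K_branch[of \<kappa>] \<kappa> by blast
    have kG: "k \<in> carrier G" "rot k = 0" using k K_carrier K_rot by auto
    have "u \<otimes> (g \<otimes> k) = (g \<otimes> k) \<otimes> v"
    proof (rule st_rot_eqI)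
      show "rot (u \<otimes> (g \<otimes> k)) = rot ((g \<otimes> k) \<otimes> v)" using u v g kG by (simp add: rot_mult)
      fix i assume i: "i < p"
      show "st (u \<otimes> (g \<otimes> k)) i = st ((g \<otimes> k) \<otimes> v) i"
        using u v g kG i k(2)[OF i] \<kappa>(2)[OF i] by (simp add: st_mult rot_mult)
    qed (use u v g kG in auto)
    then show "\<exists>k\<in>K. u \<otimes> (g \<otimes> k) = (g \<otimes> k) \<otimes> v" using k by blast
  qed
  then show ?thesis by (auto simp: detected_def)
qed


text \<open>
  If \<open>u\<close> and \<open>v\<close> rotate the first level by the same non-zero amount \<open>m\<close>, then \<open>u g = g v\<close> determines all
  sections of \<open>g\<close> from its section at \<open>0\<close>, by going around the cycle \<open>0, m, 2m, \<dots>\<close>; the condition that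
  remains after one round is that this section conjugates a section of \<open>v\<^sup>p\<close> to a section of \<open>u\<^sup>p\<close>.
  Corrections stay in \<open>K\<close> because an error in \<open>R n\<close> lies in \<open>K\<close>, which is normal.
\<close>

lemma detected_rot:
  assumes u: "u \<in> carrier G" and v: "v \<in> carrier G" and rot: "rot u = rot v" "rot u \<noteq> 0"
    and P: "\<And>i j. i < p \<Longrightarrow> j < p \<Longrightarrow> detected (st (u [^] p) i) (st (v [^] p) j)"
  shows "detected u v"
proof -
  define m where "m = rot u"
  have m: "rot u = m" "rot v = m" using rot by (simp_all add: m_def)
  have cop: "coprime m p"
    using p_prime rot(2) rot_less[OF u] unfolding m_def
    by (metis coprime_commute nat_dvd_not_less neq0_conv prime_imp_coprime)
  obtain n where n: "\<And>i j. i < p \<Longrightarrow> j < p \<Longrightarrow> approx (st (u [^] p) i) (st (v [^] p) j) n"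
    using uniform_approx[of "st (u [^] p)" "st (v [^] p)"] P by blast
  \<comment> \<open>As \<open>m\<close> is prime to \<open>p\<close>, the cycle \<open>0, m, 2m, \<dots>\<close> visits every first-level vertex once.\<close>
  have inj: "inj_on (\<lambda>i. i * m mod p) {..<p}" and surj: "(\<lambda>i. i * m mod p) ` {..<p} = {..<p}"
    using affine_inj_mod[OF cop, of 0] affine_image_mod[OF cop p_pos, of 0] by simp_all
  define idx where "idx = inv_into {..<p} (\<lambda>i. i * m mod p)"
  have idx: "idx x < p" "idx x * m mod p = x" if "x < p" for x
  proof -
    have "x \<in> (\<lambda>i. i * m mod p) ` {..<p}" using surj that by simp
    then show "idx x < p" "idx x * m mod p = x"
      using inv_into_into[of x "\<lambda>i. i * m mod p" "{..<p}"] f_inv_into_f[of x "\<lambda>i. i * m mod p" "{..<p}"]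
      by (simp_all add: idx_def)
  qed
  have idx_eq: "idx (i * m mod p) = i" if "i < p" for i
    using inv_into_f_f[OF inj] that by (simp add: idx_def)
  have "approx u v (Suc n)"
    unfolding approx_def
  proof (intro ballI impI)
    fix g assume g: "g \<in> carrier G" and "\<exists>r\<in>R (Suc n). u \<otimes> g = g \<otimes> v \<otimes> r"
    then obtain r where r: "r \<in> R (Suc n)" "u \<otimes> g = g \<otimes> v \<otimes> r" by blast
    have rG: "r \<in> carrier G" using R_carrier[OF r(1)] .
    define j where "j = rot g"
    have j: "j < p" using g by (simp add: j_def)
    define U where "U i = st (u [^] i) j" for i :: nat
    define V where "V i = st (v [^] i) 0" for i :: nat
    have UV: "U i \<in> carrier G" "V i \<in> carrier G" for i using u v j by (simp_all add: U_def V_def)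
    have U_Suc: "U (Suc i) = st u ((j + i * m) mod p) \<otimes> U i" for i
      unfolding U_def using st_pow_Suc[OF u j, of i] m by simp
    have V_Suc: "V (Suc i) = st v (i * m mod p) \<otimes> V i" for i
      unfolding V_def using st_pow_Suc[OF v p_pos, of i] m by simp
    have "\<exists>s\<in>R (Suc n). u [^] i \<otimes> g = g \<otimes> v [^] i \<otimes> s" for i :: nat
    proof (induction i)
      case 0
      show ?case using g R_one[of "Suc n"] by (intro bexI[of _ \<one>]) auto
    next
      case (Suc i)
      then obtain s where s: "s \<in> R (Suc n)" "u [^] i \<otimes> g = g \<otimes> v [^] i \<otimes> s" by blast
      have sG: "s \<in> carrier G" using R_carrier[OF s(1)] .
      have "u [^] Suc i \<otimes> g = u [^] i \<otimes> (u \<otimes> g)" using u g by (simp add: m_assoc)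
      also have "\<dots> = (u [^] i \<otimes> g) \<otimes> v \<otimes> r" unfolding r(2) using u v g rG by (simp add: m_assoc)
      also have "\<dots> = g \<otimes> v [^] Suc i \<otimes> ((inv v \<otimes> s \<otimes> v) \<otimes> r)"
        unfolding s(2) using v g rG sG by (simp add: m_assoc cancel)
      finally show ?case using R_mult[OF R_conj'[OF s(1) v] r(1)] by blast
    qed
    then obtain s where s: "\<And>i. s i \<in> R (Suc n)" "\<And>i::nat. u [^] i \<otimes> g = g \<otimes> v [^] i \<otimes> s i" by metis
    have sG: "s i \<in> carrier G" "rot (s i) = 0" "st (s i) 0 \<in> R n" for i using s(1)[of i] by auto
    have key: "U i \<otimes> st g 0 = st g (i * m mod p) \<otimes> V i \<otimes> st (s i) 0" for i
    proof -
      have "st (u [^] i \<otimes> g) 0 = st (g \<otimes> v [^] i \<otimes> s i) 0" by (simp only: s(2))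
      then show ?thesis
        using u v g sG[of i] m by (simp add: st_mult rot_mult rot_pow U_def V_def j_def)
    qed
    have "\<exists>r\<in>R n. st (u [^] p) j \<otimes> st g 0 = st g 0 \<otimes> st (v [^] p) 0 \<otimes> r"
      using key[of p] sG(3)[of p] by (auto simp: U_def V_def)
    then obtain k0 where k0: "k0 \<in> K" "U p \<otimes> (st g 0 \<otimes> k0) = (st g 0 \<otimes> k0) \<otimes> V p"
      using n[OF j p_pos, unfolded approx_def, rule_format, of "st g 0"] g by (auto simp: U_def V_def)
    have k0G: "k0 \<in> carrier G" using k0 K_carrier by blast
    define \<kappa> where "\<kappa> i = V i \<otimes> (st (s i) 0 \<otimes> k0) \<otimes> inv (V i)" for i
    have \<kappa>K: "\<kappa> i \<in> K" for i
    proof -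
      have "st (s i) 0 \<otimes> k0 \<in> R 0" using R_mult[of "st (s i) 0" 0 k0] R_K[OF sG(3)] k0 by simp
      then show ?thesis using R_conj[of _ 0 "V i"] UV by (simp add: \<kappa>_def)
    qed
    have g': "st g (i * m mod p) \<otimes> \<kappa> i = U i \<otimes> (st g 0 \<otimes> k0) \<otimes> inv (V i)" for i
    proof -
      have "st g (i * m mod p) \<otimes> \<kappa> i = (st g (i * m mod p) \<otimes> V i \<otimes> st (s i) 0) \<otimes> k0 \<otimes> inv (V i)"
        using g UV sG k0G by (simp add: \<kappa>_def m_assoc)
      also have "\<dots> = U i \<otimes> (st g 0 \<otimes> k0) \<otimes> inv (V i)"
        unfolding key[symmetric] using g UV k0G by (simp add: m_assoc)
      finally show ?thesis .
    qed
    obtain k where k: "k \<in> K" "\<And>x. x < p \<Longrightarrow> st k x = \<kappa> (idx x)"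
      using K_branch[of "\<lambda>x. \<kappa> (idx x)"] \<kappa>K by blast
    have kG: "k \<in> carrier G" "rot k = 0" using k K_carrier K_rot by auto
    define h where "h = st g 0 \<otimes> k0"
    have h: "h \<in> carrier G" using g k0G by (simp add: h_def)
    have gk: "st (g \<otimes> k) (i * m mod p) = U i \<otimes> h \<otimes> inv (V i)" if "i < p" for i
      using st_mult0[OF g kG, of "i * m mod p"] k(2)[of "i * m mod p"] idx_eq[OF that] g'[of i]
      by (simp add: h_def)
    have closing: "st (g \<otimes> k) (Suc i * m mod p) = U (Suc i) \<otimes> h \<otimes> inv (V (Suc i))" if i: "i < p" for i
    proof (cases "Suc i < p")
      case True
      then show ?thesis by (rule gk)
    next
      case False
      then have eq: "Suc i = p" using i by simp
      have "U p \<otimes> h \<otimes> inv (V p) = h"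
        using k0(2) UV h by (simp add: h_def[symmetric] m_assoc)
      moreover have "U 0 = \<one>" "V 0 = \<one>" using j by (simp_all add: U_def V_def)
      ultimately show ?thesis using gk[of 0] h eq by simp
    qed
    have "u \<otimes> (g \<otimes> k) = (g \<otimes> k) \<otimes> v"
    proof (rule st_rot_eqI)
      show "rot (u \<otimes> (g \<otimes> k)) = rot ((g \<otimes> k) \<otimes> v)" using u v g kG m by (simp add: rot_mult add.commute)
      fix x assume x: "x < p"
      define i where "i = idx x"
      have i: "i < p" "x = i * m mod p" using idx[OF x] by (simp_all add: i_def)
      have "st (u \<otimes> (g \<otimes> k)) x = st u ((j + i * m) mod p) \<otimes> st (g \<otimes> k) (i * m mod p)"
        using st_mult[OF u _ x, of "g \<otimes> k"] g kG i by (simp add: rot_mult j_def mod_simps add.commute)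
      also have "\<dots> = U (Suc i) \<otimes> h \<otimes> inv (V i)"
        using gk[OF i(1)] U_Suc[of i] u UV h by (simp add: m_assoc)
      also have "\<dots> = (U (Suc i) \<otimes> h \<otimes> inv (V (Suc i))) \<otimes> st v (i * m mod p)"
        using V_Suc[of i] v UV[of i] UV[of "Suc i"] h by (simp add: m_assoc inv_mult_group)
      also have "\<dots> = st (g \<otimes> k) (Suc i * m mod p) \<otimes> st v (i * m mod p)"
        by (simp only: closing[OF i(1)])
      also have "\<dots> = st ((g \<otimes> k) \<otimes> v) x"
        using st_mult[OF _ v x, of "g \<otimes> k"] g kG i m by (simp add: mod_simps add.commute)
      finally show "st (u \<otimes> (g \<otimes> k)) x = st ((g \<otimes> k) \<otimes> v) x" .
    qed (use u v g kG in auto)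
    then show "\<exists>k\<in>K. u \<otimes> (g \<otimes> k) = (g \<otimes> k) \<otimes> v" using k by blast
  qed
  then show ?thesis by (auto simp: detected_def)
qed

lemma torsion_stab:
  assumes u: "u \<in> carrier G" "rot u = 0" and tor: "\<And>i. i < p \<Longrightarrow> \<exists>n>0. st u i [^] (n::nat) = \<one>"
  shows "\<exists>n>0. u [^] (n::nat) = \<one>"
proof -
  have "\<forall>i\<in>{..<p}. \<exists>n. n > 0 \<and> st u i [^] (n::nat) = \<one>" using tor by blast
  from bchoice[OF this] obtain f where f: "\<forall>i\<in>{..<p}. f i > 0 \<and> st u i [^] (f i :: nat) = \<one>" ..
  define n where "n = prod f {..<p}"
  have "st (u [^] n) i = \<one>" if i: "i < p" for i
  proof -
    have "f i dvd n" unfolding n_def using i by (intro dvd_prodI) auto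
    then obtain m where m: "n = f i * m" by (auto simp: dvd_def)
    have "st u i [^] n = (st u i [^] f i) [^] m" using u i m by (simp add: nat_pow_pow)
    also have "\<dots> = \<one>" using f i by simp
    finally show ?thesis using st_pow0[OF u i] by simp
  qed
  then have "u [^] n = \<one>" using u by (intro st_rot_eqI[OF nat_pow_closed one_closed]) (simp_all add: rot_pow)
  moreover have "n > 0" unfolding n_def using f by (intro prod_pos) auto
  ultimately show ?thesis by blast
qed

end

text \<open>
  The measure \<open>\<mu>\<close> drops strictly in passing to the sections of \<open>u\<close>, or of \<open>u\<^sup>p\<close> if \<open>u\<close> moves the first
  level, until it reaches \<open>0\<close>. For pairs the sum of the measures drops as soon as one of them is positive,
  so only pairs of elements of measure \<open>0\<close> have to be treated by hand.
\<close>

locale contracting_branch_group = branch_group +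
  fixes \<mu> :: "(nat list \<Rightarrow> nat list) \<Rightarrow> nat"
  assumes descent_stab: "u \<in> carrier G \<Longrightarrow> rot u = 0 \<Longrightarrow> i < p \<Longrightarrow> \<mu> (sec p u i) \<le> \<mu> u - 1"
    and descent_rot: "u \<in> carrier G \<Longrightarrow> rot u \<noteq> 0 \<Longrightarrow> i < p \<Longrightarrow> \<mu> (sec p (u [^] p) i) \<le> \<mu> u - 1"
    and base_detected: "u \<in> carrier G \<Longrightarrow> v \<in> carrier G \<Longrightarrow> \<mu> u = 0 \<Longrightarrow> \<mu> v = 0 \<Longrightarrow> detected u v"
    and base_torsion: "u \<in> carrier G \<Longrightarrow> \<mu> u = 0 \<Longrightarrow> \<exists>n>0. u [^] (n::nat) = \<one>"
begin

lemma torsion: "u \<in> carrier G \<Longrightarrow> \<exists>n>0. u [^] (n::nat) = \<one>"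
proof (induction "\<mu> u" arbitrary: u rule: less_induct)
  case less
  note u = less.prems
  show ?case
  proof (cases "\<mu> u = 0")
    case True
    then show ?thesis using base_torsion u by blast
  next
    case False
    show ?thesis
    proof (cases "rot u = 0")
      case True
      have "\<exists>n>0. st u i [^] (n::nat) = \<one>" if "i < p" for i
        using less.hyps[of "st u i"] descent_stab[OF u True that] False u that by simp
      then show ?thesis by (rule torsion_stab[OF u True])
    next
      case rot: False
      have "\<exists>n>0. st (u [^] p) i [^] (n::nat) = \<one>" if "i < p" for i
        using less.hyps[of "st (u [^] p) i"] descent_rot[OF u rot that] False u that by simp
      then have "\<exists>n>0. (u [^] p) [^] (n::nat) = \<one>"
        by (rule torsion_stab[OF nat_pow_closed[OF u] rot_pow_p[OF u]])
      then obtain n where "n > 0" "(u [^] p) [^] (n::nat) = \<one>" by blast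
      then show ?thesis using u by (intro exI[of _ "p * n"]) (simp add: nat_pow_pow)
    qed
  qed
qed

lemma all_detected: "u \<in> carrier G \<Longrightarrow> v \<in> carrier G \<Longrightarrow> detected u v"
proof (induction "\<mu> u + \<mu> v" arbitrary: u v rule: less_induct)
  case less
  note u = less.prems(1) and v = less.prems(2)
  consider "\<mu> u = 0" "\<mu> v = 0" | "rot u \<noteq> rot v" | "\<mu> u + \<mu> v > 0" "rot u = rot v" by fastforce
  then show ?case
  proof cases
    case 1
    then show ?thesis using base_detected u v by blast
  next
    case 2
    then show ?thesis using detected_rot_differ u v by blast
  next
    case 3
    show ?thesis
    proof (cases "rot u = 0")
      case True
      have "detected (st u i) (st v j)" if "i < p" "j < p" for i j
      proof (rule less.hyps)
        have "rot v = 0" using True 3 by simp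
        then show "\<mu> (st u i) + \<mu> (st v j) < \<mu> u + \<mu> v"
          using descent_stab[OF u True that(1)] descent_stab[OF v _ that(2)] 3(1) by linarith
      qed (use u v that in simp_all)
      then show ?thesis using detected_stab[OF u True v] True 3 by simp
    next
      case False
      have "detected (st (u [^] p) i) (st (v [^] p) j)" if "i < p" "j < p" for i j
      proof (rule less.hyps)
        have "rot v \<noteq> 0" using False 3 by simp
        then show "\<mu> (st (u [^] p) i) + \<mu> (st (v [^] p) j) < \<mu> u + \<mu> v"
          using descent_rot[OF u False that(1)] descent_rot[OF v _ that(2)] 3(1) by linarith
      qed (use u v that in simp_all)
      then show ?thesis using detected_rot[OF u v 3(2) False] by blast
    qed
  qed
qed

theorem conjugacy_separable: "p_conjugacy_separable p G"
proof (rule p_conjugacy_separableI[OF is_group])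
  fix g h assume g: "g \<in> carrier G" and h: "h \<in> carrier G" and nc: "\<not> conjugate_in G g h"
  obtain n where n: "approx h g n" using all_detected[OF h g] by (auto simp: detected_def)
  interpret N: normal "R n" G by (rule R_normal)
  let ?\<pi> = "\<lambda>x. R n #> x"
  have "\<not> conjugate_in (G Mod R n) (?\<pi> g) (?\<pi> h)"
  proof
    assume "conjugate_in (G Mod R n) (?\<pi> g) (?\<pi> h)"
    then obtain x where x: "x \<in> carrier G"
      "?\<pi> h = ?\<pi> x \<otimes>\<^bsub>G Mod R n\<^esub> ?\<pi> g \<otimes>\<^bsub>G Mod R n\<^esub> inv\<^bsub>G Mod R n\<^esub> ?\<pi> x"
      by (auto simp: conjugate_in_def carrier_FactGroup)
    then have "?\<pi> h = ?\<pi> (x \<otimes> g \<otimes> inv x)"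
      using g N.inv_FactGroup[of "?\<pi> x"] by (simp add: N.rcos_sum N.rcos_inv carrier_FactGroup)
    then have "inv (x \<otimes> g \<otimes> inv x) \<otimes> h \<in> R n" using R_coset_eq g h x by simp
    then have "inv x \<otimes> (inv (x \<otimes> g \<otimes> inv x) \<otimes> h) \<otimes> x \<in> R n" by (rule R_conj'[OF _ x(1)])
    moreover have "h \<otimes> x = x \<otimes> g \<otimes> (inv x \<otimes> (inv (x \<otimes> g \<otimes> inv x) \<otimes> h) \<otimes> x)"
      using g h x by (simp add: m_assoc cancel inv_mult_group)
    ultimately obtain k where k: "k \<in> K" "h \<otimes> (x \<otimes> k) = (x \<otimes> k) \<otimes> g"
      using n x unfolding approx_def by blast
    have "h = (x \<otimes> k) \<otimes> g \<otimes> inv (x \<otimes> k)"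
      using k g h x K_carrier[OF k(1)] by (metis inv_solve_right m_closed)
    then show False using nc x K_carrier[OF k(1)] by (auto simp: conjugate_in_def)
  qed
  moreover have "?\<pi> \<in> epi G (G Mod R n)"
    using N.r_coset_hom_Mod by (auto simp: epi_def carrier_FactGroup)
  ultimately show "\<exists>(Q :: (nat list \<Rightarrow> nat list) set monoid) \<pi>. finite_p_group p Q \<and> \<pi> \<in> epi G Q \<and>
             \<not> conjugate_in Q (\<pi> g) (\<pi> h)"
    using finite_p_group_quotient by blast
qed

end



section \<open>Words over the rooted cycle and the directed elements\<close>

text \<open>
  If no two neighbouring entries satisfy \<open>P\<close>, at most \<open>(length l + 1) / 2\<close> entries do, with equality only if
  both ends do; and when the list is read cyclically the ends are neighbours, too.
\<close>

lemma majority_adjacent: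
  assumes "length l \<ge> 2" "2 * length (filter P l) > length l"
  shows "(\<exists>l1 z z' l2. l = l1 @ z # z' # l2 \<and> P z \<and> P z') \<or> (\<exists>z l' z'. l = z # l' @ [z'] \<and> P z \<and> P z')"
proof (rule ccontr)
  assume contra: "\<not> ?thesis"
  have gen: "2 * length (filter P l) \<le> length l + 1 \<and>
      (2 * length (filter P l) = length l + 1 \<longrightarrow> P (hd l) \<and> P (last l)) \<and>
      (l \<noteq> [] \<and> \<not> P (hd l) \<longrightarrow> 2 * length (filter P l) \<le> length l)"
    if "\<not> (\<exists>l1 z z' l2. l = l1 @ z # z' # l2 \<and> P z \<and> P z')" "l \<noteq> []" for l
    using that
  proof (induction "length l" arbitrary: l rule: less_induct)
    case less
    obtain z l' where l: "l = z # l'" using less.prems by (cases l) auto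
    show ?case
    proof (cases l')
      case Nil
      then show ?thesis using l by auto
    next
      case (Cons y l'')
      have sub: "\<not> (\<exists>l1 z z' l2. l' = l1 @ z # z' # l2 \<and> P z \<and> P z')"
      proof
        assume "\<exists>l1 z z' l2. l' = l1 @ z # z' # l2 \<and> P z \<and> P z'"
        then obtain l1 z1 z' l2 where "l' = l1 @ z1 # z' # l2" "P z1" "P z'" by blast
        then have "l = (z # l1) @ z1 # z' # l2" using l by simp
        then show False using less.prems(1) \<open>P z1\<close> \<open>P z'\<close> by blast
      qed
      have sub2: "\<not> (\<exists>l1 z z' l2. l'' = l1 @ z # z' # l2 \<and> P z \<and> P z')"
      proof
        assume "\<exists>l1 z z' l2. l'' = l1 @ z # z' # l2 \<and> P z \<and> P z'"
        then obtain l1 z1 z' l2 where "l'' = l1 @ z1 # z' # l2" "P z1" "P z'" by blast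
        then have "l = (z # y # l1) @ z1 # z' # l2" using l Cons by simp
        then show False using less.prems(1) \<open>P z1\<close> \<open>P z'\<close> by blast
      qed
      have zy: "\<not> (P z \<and> P y)" using less.prems(1) l Cons by (metis append_Nil)
      note IH = less.hyps[OF _ sub] and IH2 = less.hyps[OF _ sub2]
      show ?thesis
      proof (cases "P z")
        case True
        then have y: "\<not> P y" using zy by simp
        show ?thesis
        proof (cases "l'' = []")
          case True
          then show ?thesis using l Cons y \<open>P z\<close> by auto
        next
          case False
          then show ?thesis using IH2 l Cons y \<open>P z\<close> by auto
        qed
      next
        case False
        then show ?thesis using IH l Cons by auto
      qed
    qed
  qed
  have ne: "l \<noteq> []" using assms by auto
  have "P (hd l)" "P (last l)" using gen[of l] contra assms ne by auto
  moreover obtain z l' z' where "l = z # l' @ [z']"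
    using assms(1) by (cases l; cases "tl l" rule: rev_cases) auto
  ultimately show False using contra by auto
qed

lemma sum_length_filter:
  fixes n :: nat
  assumes "\<And>z. z \<in> set l \<Longrightarrow> card {t \<in> {..<n}. P t z} = 1"
  shows "(\<Sum>t<n. length (filter (P t) l)) = length l"
  using assms
proof (induction l)
  case (Cons z l)
  have "(\<Sum>t<n. length (filter (P t) (z # l))) = (\<Sum>t<n. (if P t z then 1 else 0) + length (filter (P t) l))"
    by (rule sum.cong) auto
  also have "\<dots> = card {t \<in> {..<n}. P t z} + length l"
  proof -
    have "(\<Sum>t<n. if P t z then 1 else (0::nat)) = card {t \<in> {..<n}. P t z}"
      unfolding card_eq_sum by (rule sum.inter_filter[symmetric]) simp
    then show ?thesis using Cons by (simp add: sum.distrib)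
  qed
  finally show ?case using Cons.prems by simp
qed simp

context rot_group
begin

lemma sum_rotate:
  fixes f :: "nat \<Rightarrow> 'b :: comm_monoid_add"
  shows "(\<Sum>i<p. f ((i + r) mod p)) = (\<Sum>i<p. f i)"
proof -
  have "(\<Sum>i<p. f i) = (\<Sum>i\<in>(\<lambda>i. (r + i * 1) mod p) ` {..<p}. f i)"
    using affine_image_mod[of 1 p r] by simp
  also have "\<dots> = (\<Sum>i<p. f ((r + i * 1) mod p))"
    by (rule sum.reindex_cong[OF affine_inj_mod[of 1 p r]]) auto
  finally show ?thesis by (simp add: add.commute)
qed

text \<open>
  The total rotation on the second level, a homomorphism to the integers modulo \<open>p\<close>: multiplying permutes
  the sections of the left factor.
\<close>

definition tot :: "(nat list \<Rightarrow> nat list) \<Rightarrow> nat" where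
  "tot g = (\<Sum>i<p. rot (st g i)) mod p"

lemma tot_mult:
  assumes "g \<in> carrier G" "h \<in> carrier G"
  shows "tot (g \<otimes> h) = (tot g + tot h) mod p"
proof -
  have "(\<Sum>i<p. rot (st (g \<otimes> h) i)) mod p = (\<Sum>i<p. (rot (st g ((i + rot h) mod p)) + rot (st h i)) mod p) mod p"
    using assms by (simp add: st_mult rot_mult)
  also have "\<dots> = (\<Sum>i<p. rot (st g ((i + rot h) mod p)) + rot (st h i)) mod p"
    by (rule mod_sum_eq)
  also have "\<dots> = ((\<Sum>i<p. rot (st g i)) + (\<Sum>i<p. rot (st h i))) mod p"
    by (simp only: sum.distrib sum_rotate[of "\<lambda>i. rot (st g i)"])
  finally show ?thesis unfolding tot_def by (simp add: mod_simps)
qed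

end

locale rooted_group = rot_group +
  assumes a_closed[simp]: "rooted_cycle p \<in> carrier G"
begin

abbreviation a where "a \<equiv> rooted_cycle p"

lemma rot_a[simp]: "rot a = 1"
  using p_gt_1 by (simp add: rot_def rooted_cycle_def)

lemma st_a[simp]: "i < p \<Longrightarrow> st a i = \<one>"
  by (auto simp: sec_def one_eq rooted_cycle_def fun_eq_iff restrict_def)

lemma rot_a_pow[simp]: "rot (a [^] (k::nat)) = k mod p"
  by (simp add: rot_pow)

lemma st_a_pow[simp]: "i < p \<Longrightarrow> st (a [^] (k::nat)) i = \<one>"
  by (induction k arbitrary: i) (simp_all add: st_mult)

lemma a_pow_p: "a [^] p = \<one>"
  by (rule st_rot_eqI) simp_all

lemma a_pow_mod: "a [^] (k mod p) = a [^] k"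
  by (rule st_rot_eqI) simp_all

lemma a_pow_mult: "a [^] (k::nat) \<otimes> a [^] (m::nat) = a [^] (k + m)"
  by (simp add: nat_pow_mult)

lemma a_pow_inv: "inv (a [^] (k::nat)) = a [^] (p - k mod p)"
proof (rule inv_equality)
  have "a [^] (p - k mod p) \<otimes> a [^] (k mod p) = a [^] p"
    using mod_less_divisor[OF p_pos, of k] by (simp add: nat_pow_mult)
  then show "a [^] (p - k mod p) \<otimes> a [^] k = \<one>" by (simp add: a_pow_mod a_pow_p)
qed simp_all

end

text \<open>
  Grigorchuk's group and the Gupta--Sidki groups are generated by \<open>a\<close> and a finite group \<open>B\<close> of elements that fix the
  first level, reproduce an element of \<open>B\<close> at the last vertex and have powers of \<open>a\<close> as their other sections:
  \<open>B = {1, b, c, d}\<close> and \<open>B = \<langle>t\<rangle>\<close>. The length of a word only counts letters from \<open>B\<close>, so each letter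
  contributes to the length of exactly one section.
\<close>

locale spinal_group = rooted_group +
  fixes B
  assumes p_prime: "Factorial_Ring.prime p"
    and B_subgroup: "subgroup B G"
    and B_rot: "x \<in> B \<Longrightarrow> rot x = 0"
    and B_dir: "x \<in> B \<Longrightarrow> sec p x (p - 1) \<in> B"
    and B_fin: "x \<in> B \<Longrightarrow> i < p - 1 \<Longrightarrow> \<exists>k::nat. sec p x i = rooted_cycle p [^] k"
    and generated: "subgroup H G \<Longrightarrow> rooted_cycle p \<in> H \<Longrightarrow> B \<subseteq> H \<Longrightarrow> H = carrier G"
begin

lemma B_carrier[simp]: "x \<in> B \<Longrightarrow> x \<in> carrier G"
  using B_subgroup by (rule subgroup.mem_carrier)

lemma B_mult[simp]: "x \<in> B \<Longrightarrow> y \<in> B \<Longrightarrow> x \<otimes> y \<in> B"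
  using B_subgroup by (rule subgroup.m_closed)

lemma B_one[simp]: "\<one> \<in> B"
  using B_subgroup by (rule subgroup.one_closed)

lemma B_inv[simp]: "x \<in> B \<Longrightarrow> inv x \<in> B"
  using B_subgroup by (rule subgroup.m_inv_closed)

text \<open>
  A letter \<open>(j, x)\<close> stands for the conjugate of \<open>x\<close> by \<open>a\<^sup>j\<close>; its section in \<open>B\<close> sits at the vertex before
  \<open>j\<close>. Every element is a product of letters followed by a power of \<open>a\<close>.
\<close>

definition el :: "nat \<times> (nat list \<Rightarrow> nat list) \<Rightarrow> nat list \<Rightarrow> nat list" where
  "el z = a [^] fst z \<otimes> snd z \<otimes> inv (a [^] fst z)"

primrec ev where
  "ev [] = \<one>"
| "ev (z # l) = el z \<otimes> ev l"

definition letters where "letters = {..<p} \<times> B"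

lemma letters_D: "z \<in> letters \<Longrightarrow> fst z < p" "z \<in> letters \<Longrightarrow> snd z \<in> B"
  by (auto simp: letters_def)

lemma el_closed[simp]: "z \<in> letters \<Longrightarrow> el z \<in> carrier G"
  by (auto simp: el_def letters_def)

lemma ev_closed[simp]: "l \<in> lists letters \<Longrightarrow> ev l \<in> carrier G"
  by (induction l) auto

lemma ev_append: "l \<in> lists letters \<Longrightarrow> l' \<in> lists letters \<Longrightarrow> ev (l @ l') = ev l \<otimes> ev l'"
  by (induction l) (auto simp: m_assoc)

lemma rot_el[simp]: "z \<in> letters \<Longrightarrow> rot (el z) = 0"
  by (auto simp: el_def letters_def rot_conj B_rot)

lemma rot_ev[simp]: "l \<in> lists letters \<Longrightarrow> rot (ev l) = 0"
  by (induction l) (auto simp: rot_mult)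

lemma st_el:
  assumes z: "z \<in> letters" and i: "i < p"
  shows "st (el z) ((i + fst z) mod p) = st (snd z) i"
  using st_conj[of "snd z" "a [^] fst z" i] z i by (simp add: el_def B_rot letters_D mod_simps)

lemma st_el_dir:
  assumes z: "z \<in> letters" and y: "y < p" "(y + 1) mod p = fst z"
  shows "st (el z) y = st (snd z) (p - 1)"
proof -
  have "(p - 1 + fst z) mod p = (p - 1 + (y + 1)) mod p" by (simp only: y(2)[symmetric] mod_add_right_eq)
  also have "\<dots> = y" using y p_gt_1 by simp
  finally show ?thesis using st_el[OF z, of "p - 1"] p_gt_1 by simp
qed

lemma st_el_fin:
  assumes z: "z \<in> letters" and y: "y < p" "(y + 1) mod p \<noteq> fst z"
  shows "\<exists>k::nat. st (el z) y = a [^] k"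
proof -
  define i where "i = (y + (p - fst z)) mod p"
  have zp: "fst z < p" using z by (rule letters_D)
  have iy: "(i + fst z) mod p = y"
    unfolding i_def mod_add_left_eq using y zp by simp
  have i: "i < p" by (simp add: i_def)
  have "i \<noteq> p - 1"
  proof
    assume "i = p - 1"
    then have "(y + 1) mod p = ((p - 1 + fst z) mod p + 1) mod p" using iy by simp
    also have "\<dots> = (p - 1 + fst z + 1) mod p" by (rule mod_add_left_eq)
    also have "\<dots> = fst z" using zp by simp
    finally show False using y by simp
  qed
  then have "i < p - 1" using i by simp
  then show ?thesis using st_el[OF z i] iy B_fin[OF letters_D(2)[OF z]] by simp
qed

lemma a_pow_el:
  assumes "x \<in> B"
  shows "a [^] (k::nat) \<otimes> x = el (k mod p, x) \<otimes> a [^] k"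
  using assms by (simp add: el_def a_pow_mod m_assoc)

lemma a_pow_conj_el:
  assumes "z \<in> letters"
  shows "a [^] (k::nat) \<otimes> el z = el ((k + fst z) mod p, snd z) \<otimes> a [^] k"
proof -
  have "a [^] (k + fst z) = a [^] k \<otimes> a [^] fst z" by (simp add: nat_pow_mult)
  then show ?thesis
    using assms letters_D[OF assms] by (simp add: el_def a_pow_mod m_assoc inv_mult_group)
qed

definition rotate_letters where
  "rotate_letters k = map (\<lambda>z. ((k + fst z) mod p, snd z))"

lemma rotate_letters[simp]: "l \<in> lists letters \<Longrightarrow> rotate_letters k l \<in> lists letters"
  by (induction l) (auto simp: rotate_letters_def letters_def)

lemma a_pow_ev:
  assumes "l \<in> lists letters"
  shows "a [^] (k::nat) \<otimes> ev l = ev (rotate_letters k l) \<otimes> a [^] k"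
  using assms
proof (induction l rule: list.induct)
  case (Cons z l)
  have z1: "z \<in> letters" and l: "l \<in> lists letters" using Cons.prems by auto
  have z: "z \<in> letters" "((k + fst z) mod p, snd z) \<in> letters"
    using z1 letters_D[OF z1] by (auto simp: letters_def)
  have "a [^] k \<otimes> ev (z # l) = el ((k + fst z) mod p, snd z) \<otimes> (a [^] k \<otimes> ev l)"
    using a_pow_conj_el[OF z(1), of k] z l by (simp add: m_assoc[symmetric])
  then show ?case using Cons.IH l z rotate_letters[OF l, of k] by (simp add: rotate_letters_def m_assoc)
qed (simp add: rotate_letters_def)

text \<open>
  The list records the letters from \<open>B\<close> in a product of such letters and powers of \<open>a\<close>, but not where the
  powers of \<open>a\<close> are; this is all that section words need.
\<close>

inductive wd where
  wd_Nil: "wd [] (a [^] (k::nat))"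
| wd_Cons: "wd xs u \<Longrightarrow> x \<in> B \<Longrightarrow> wd (x # xs) (a [^] (k::nat) \<otimes> x \<otimes> u)"

lemma wd_closed: "wd xs u \<Longrightarrow> u \<in> carrier G"
  by (induction rule: wd.induct) auto

lemma wd_one: "wd [] \<one>"
  using wd_Nil[of 0] by simp

lemma wd_a: "wd xs u \<Longrightarrow> wd xs (a [^] (k::nat) \<otimes> u)"
proof (induction rule: wd.induct)
  case (wd_Nil m)
  then show ?case using wd.wd_Nil[of "k + m"] by (simp add: a_pow_mult)
next
  case (wd_Cons xs u x m)
  have "a [^] k \<otimes> (a [^] m \<otimes> x \<otimes> u) = a [^] (k + m) \<otimes> x \<otimes> u"
    using wd_Cons wd_closed by (simp add: a_pow_mult[symmetric] m_assoc)
  then show ?case using wd.wd_Cons[of xs u x "k + m"] wd_Cons by simp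
qed

lemma wd_B: "x \<in> B \<Longrightarrow> wd [x] x"
  using wd_Cons[OF wd_one, of x 0] by simp

lemma wd_mult: "wd xs u \<Longrightarrow> wd ys v \<Longrightarrow> wd (xs @ ys) (u \<otimes> v)"
proof (induction rule: wd.induct)
  case (wd_Nil m)
  then show ?case by (simp add: wd_a)
next
  case (wd_Cons xs u x m)
  then show ?case using wd.wd_Cons[of "xs @ ys" "u \<otimes> v" x m] wd_closed by (simp add: m_assoc)
qed

lemma wd_ev: "wd xs u \<Longrightarrow> \<exists>l k. l \<in> lists letters \<and> map snd l = xs \<and> u = ev l \<otimes> a [^] (k::nat)"
proof (induction rule: wd.induct)
  case (wd_Nil k)
  show ?case by (rule exI[of _ "[]"]) auto
next
  case (wd_Cons xs u x k)
  then obtain l m where l: "l \<in> lists letters" "map snd l = xs" "u = ev l \<otimes> a [^] (m::nat)" by blast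
  let ?l = "(k mod p, x) # rotate_letters k l"
  have lt: "(k mod p, x) \<in> letters" using wd_Cons by (simp add: letters_def)
  have "a [^] k \<otimes> x \<otimes> u = el (k mod p, x) \<otimes> (a [^] k \<otimes> ev l) \<otimes> a [^] m"
    unfolding a_pow_el[OF wd_Cons.hyps(2)] l(3) using l lt by (simp add: m_assoc)
  also have "\<dots> = ev ?l \<otimes> a [^] (k + m)"
    unfolding a_pow_ev[OF l(1)] using l lt by (simp add: m_assoc a_pow_mult)
  finally have "a [^] k \<otimes> x \<otimes> u = ev ?l \<otimes> a [^] (k + m)" .
  moreover have "?l \<in> lists letters" using l lt by simp
  moreover have "map snd ?l = x # xs" using l by (simp add: rotate_letters_def o_def)
  ultimately show ?case by (intro exI[of _ ?l] exI[of _ "k + m"] conjI)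
qed

lemma ev_wd: "l \<in> lists letters \<Longrightarrow> wd (map snd l) (ev l)"
proof (induction l)
  case Nil
  then show ?case by (simp add: wd_one)
next
  case (Cons z l)
  then have z: "z \<in> letters" and l: "l \<in> lists letters" by auto
  have "wd [snd z] (el z)"
  proof -
    have "wd [snd z] (a [^] fst z \<otimes> snd z \<otimes> a [^] (p - fst z mod p))"
      by (rule wd_Cons[OF wd_Nil]) (rule letters_D[OF z])
    then show ?thesis by (simp add: el_def a_pow_inv)
  qed
  then show ?case using wd_mult[OF _ Cons.IH[OF l]] by fastforce
qed

lemma wd_exists:
  assumes "u \<in> carrier G" shows "\<exists>xs. wd xs u"
proof -
  have "{u. \<exists>xs. wd xs u} = carrier G"
  proof (rule generated)
    show "subgroup {u. \<exists>xs. wd xs u} G"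
    proof (rule subgroupI)
      show "{u. \<exists>xs. wd xs u} \<subseteq> carrier G" using wd_closed by blast
      show "{u. \<exists>xs. wd xs u} \<noteq> {}" using wd_one by blast
      fix u assume "u \<in> {u. \<exists>xs. wd xs u}"
      then obtain xs where "wd xs u" by blast
      then have "\<exists>ys. wd ys (inv u)"
      proof (induction rule: wd.induct)
        case (wd_Nil k)
        show ?case unfolding a_pow_inv using wd.wd_Nil by blast
      next
        case (wd_Cons xs u x k)
        then obtain ys where ys: "wd ys (inv u)" by blast
        have "inv (a [^] k \<otimes> x \<otimes> u) = inv u \<otimes> (inv x \<otimes> a [^] (p - k mod p))"
          using wd_Cons wd_closed by (simp add: inv_mult_group a_pow_inv m_assoc)
        moreover have "wd (ys @ ([inv x] @ [])) (inv u \<otimes> (inv x \<otimes> a [^] (p - k mod p)))"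
          by (intro wd_mult ys wd_B wd.wd_Nil) (use wd_Cons in simp)
        ultimately show ?case by metis
      qed
      then show "inv u \<in> {u. \<exists>xs. wd xs u}" by simp
    next
      fix u v assume "u \<in> {u. \<exists>xs. wd xs u}" "v \<in> {u. \<exists>xs. wd xs u}"
      then show "u \<otimes> v \<in> {u. \<exists>xs. wd xs u}" using wd_mult by blast
    qed
    show "a \<in> {u. \<exists>xs. wd xs u}" using wd_Nil[of 1] by auto
    show "B \<subseteq> {u. \<exists>xs. wd xs u}" using wd_B by blast
  qed
  then show ?thesis using assms by blast
qed

text \<open>
  Lengths are taken up to conjugation, so that a word may be rotated cyclically before it is shortened.
\<close>

definition rep where
  "rep xs u \<longleftrightarrow> u \<in> carrier G \<and> (\<exists>w. wd xs w \<and> (\<exists>x\<in>carrier G. u = x \<otimes> w \<otimes> inv x))"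

definition len where
  "len u = (LEAST n. \<exists>xs. rep xs u \<and> length xs = n)"

lemma wd_rep: "wd xs u \<Longrightarrow> rep xs u"
  unfolding rep_def using wd_closed by (auto intro!: exI[of _ u] bexI[of _ \<one>])

lemma rep_conj:
  assumes "rep xs u" "x \<in> carrier G"
  shows "rep xs (x \<otimes> u \<otimes> inv x)"
proof -
  obtain w y where w: "wd xs w" "y \<in> carrier G" "u = y \<otimes> w \<otimes> inv y" using assms(1) by (auto simp: rep_def)
  then have "x \<otimes> u \<otimes> inv x = (x \<otimes> y) \<otimes> w \<otimes> inv (x \<otimes> y)"
    using assms(2) wd_closed[OF w(1)] by (simp add: m_assoc inv_mult_group)
  then show ?thesis using w assms wd_closed[OF w(1)] unfolding rep_def by (metis inv_closed m_closed)
qed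

lemma rep_conj_iff:
  assumes "u \<in> carrier G" "x \<in> carrier G"
  shows "rep xs (x \<otimes> u \<otimes> inv x) \<longleftrightarrow> rep xs u"
proof
  assume rep: "rep xs (x \<otimes> u \<otimes> inv x)"
  have "inv x \<otimes> (x \<otimes> u \<otimes> inv x) \<otimes> inv (inv x) = u" using assms by (simp add: m_assoc cancel)
  then show "rep xs u" using rep_conj[OF rep inv_closed[OF assms(2)]] by (simp only:)
next
  assume "rep xs u"
  then show "rep xs (x \<otimes> u \<otimes> inv x)" by (rule rep_conj[OF _ assms(2)])
qed

lemma rep_exists: "u \<in> carrier G \<Longrightarrow> \<exists>xs. rep xs u \<and> length xs = len u"
  unfolding len_def by (rule LeastI_ex) (use wd_exists wd_rep in blast)

lemma len_le: "rep xs u \<Longrightarrow> len u \<le> length xs"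
  unfolding len_def by (rule Least_le) blast

lemma len_conj: "u \<in> carrier G \<Longrightarrow> x \<in> carrier G \<Longrightarrow> len (x \<otimes> u \<otimes> inv x) = len u"
  unfolding len_def by (simp add: rep_conj_iff)

lemma rep_ev:
  assumes "rep xs u"
  shows "\<exists>l k x. l \<in> lists letters \<and> map snd l = xs \<and> x \<in> carrier G \<and>
    u = x \<otimes> (ev l \<otimes> a [^] (k::nat)) \<otimes> inv x \<and> rot u = k mod p"
proof -
  obtain w x where w: "wd xs w" "x \<in> carrier G" "u = x \<otimes> w \<otimes> inv x" using assms by (auto simp: rep_def)
  obtain l k where l: "l \<in> lists letters" "map snd l = xs" "w = ev l \<otimes> a [^] (k::nat)" using wd_ev[OF w(1)] by blast
  have "rot u = rot w" unfolding w(3) by (rule rot_conj[OF wd_closed[OF w(1)] w(2)])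
  then have "rot u = k mod p" using l by (simp add: rot_mult)
  then show ?thesis using w l by blast
qed

lemma rep_mult_comm:
  assumes "wd xs u" "wd ys v" shows "rep (ys @ xs) (u \<otimes> v)"
proof -
  have c: "u \<in> carrier G" "v \<in> carrier G" using assms wd_closed by auto
  have "rep (ys @ xs) (v \<otimes> u)" using wd_mult[OF assms(2,1)] by (rule wd_rep)
  then have "rep (ys @ xs) (u \<otimes> (v \<otimes> u) \<otimes> inv u)" using c by (intro rep_conj) auto
  then show ?thesis using c by (simp add: m_assoc)
qed

lemma ev_section:
  assumes "l \<in> lists letters" "y < p"
  shows "wd (map (\<lambda>z. st (snd z) (p - 1)) (filter (\<lambda>z. fst z = (y + 1) mod p) l)) (st (ev l) y)"
  using assms(1)
proof (induction l rule: list.induct)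
  case Nil
  then show ?case using assms(2) by (simp add: wd_one)
next
  case (Cons z l)
  then have z: "z \<in> letters" and l: "l \<in> lists letters" by auto
  have st: "st (ev (z # l)) y = st (el z) y \<otimes> st (ev l) y"
    using z l assms(2) by (simp add: st_mult0)
  show ?case
  proof (cases "fst z = (y + 1) mod p")
    case True
    have "wd [st (snd z) (p - 1)] (st (el z) y)"
      using st_el_dir[OF z assms(2)] True B_dir[OF letters_D(2)[OF z]] by (simp add: wd_B)
    then show ?thesis using wd_mult[OF _ Cons.IH[OF l]] True st by fastforce
  next
    case False
    then obtain k :: nat where "st (el z) y = a [^] k" using st_el_fin[OF z assms(2)] by metis
    then show ?thesis using wd_a[OF Cons.IH[OF l], of k] False st by simp
  qed
qed

lemma el_merge: "(j, x) \<in> letters \<Longrightarrow> (j, x') \<in> letters \<Longrightarrow> el (j, x) \<otimes> el (j, x') = el (j, x \<otimes> x')"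
  by (simp add: el_def letters_def m_assoc cancel)

lemma len_ev_merge:
  assumes l: "l1 \<in> lists letters" "l2 \<in> lists letters" and z: "(j, x) \<in> letters" "(j, x') \<in> letters"
  shows "len (ev (l1 @ (j, x) # (j, x') # l2) \<otimes> a [^] (k::nat)) \<le> Suc (length l1 + length l2)"
proof -
  have z': "(j, x \<otimes> x') \<in> letters" using z by (auto simp: letters_def)
  have "ev (l1 @ (j, x) # (j, x') # l2) = ev (l1 @ (j, x \<otimes> x') # l2)"
    using l z z' by (simp add: ev_append m_assoc[symmetric] el_merge[symmetric])
  moreover have "rep (map snd (l1 @ (j, x \<otimes> x') # l2) @ []) (ev (l1 @ (j, x \<otimes> x') # l2) \<otimes> a [^] k)"
    using l z' by (intro wd_rep wd_mult wd_Nil ev_wd) auto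
  ultimately show ?thesis using len_le by fastforce
qed

lemma conj_section:
  assumes w: "w \<in> carrier G" "rot w = 0" and x: "x \<in> carrier G" and y: "y < p"
  shows "\<exists>i<p. \<exists>z\<in>carrier G. st (x \<otimes> w \<otimes> inv x) y = z \<otimes> st w i \<otimes> inv z"
proof -
  define i where "i = (y + (p - rot x)) mod p"
  have "(i + rot x) mod p = y"
    unfolding i_def mod_add_left_eq using y rot_less[OF x] by simp
  moreover have "i < p" by (simp add: i_def)
  ultimately show ?thesis using st_conj[OF w(1) x w(2)] x by (metis st_closed)
qed

text \<open>
  In a shortest word of the conjugacy class, read cyclically, neighbouring letters have different positions
  \<open>j\<close>, since otherwise they would merge into one letter. Hence at most half of the letters contribute to any
  given section.
\<close>

lemma len_section_stab:
  assumes u: "u \<in> carrier G" "rot u = 0" and n: "len u \<ge> 2" and y: "y < p"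
  shows "len (st u y) \<le> len u div 2"
proof -
  obtain xs where xs: "rep xs u" "length xs = len u" using rep_exists[OF u(1)] by blast
  obtain l k x where l: "l \<in> lists letters" "map snd l = xs" and x: "x \<in> carrier G"
    and ux: "u = x \<otimes> (ev l \<otimes> a [^] (k::nat)) \<otimes> inv x" "rot u = k mod p"
    using rep_ev[OF xs(1)] by blast
  have "a [^] k = \<one>" using a_pow_mod[of k] u ux by simp
  then have ue: "u = x \<otimes> ev l \<otimes> inv x" using ux l by simp
  have lenl: "length l = len u" "len (ev l) = len u"
    using xs l ue len_conj[of "ev l" x] x by auto
  obtain i z where i: "i < p" "z \<in> carrier G" "st u y = z \<otimes> st (ev l) i \<otimes> inv z"
    using conj_section[of "ev l" x y] l x y ue by auto
  let ?P = "\<lambda>z. fst z = (i + 1) mod p"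
  have "2 * length (filter ?P l) \<le> length l"
  proof (rule ccontr)
    assume "\<not> ?thesis"
    then consider l1 z z' l2 where "l = l1 @ z # z' # l2" "?P z" "?P z'"
      | z l' z' where "l = z # l' @ [z']" "?P z" "?P z'"
      using majority_adjacent[of l ?P] lenl n by fastforce
    then show False
    proof cases
      case 1
      have "len (ev (l1 @ (fst z, snd z) # (fst z, snd z') # l2) \<otimes> a [^] (0::nat)) \<le> Suc (length l1 + length l2)"
        by (rule len_ev_merge) (use 1 l in \<open>auto simp: letters_def\<close>)
      moreover have "l1 @ (fst z, snd z) # (fst z, snd z') # l2 = l" using 1 by (simp add: prod_eq_iff)
      ultimately have "len (ev l) \<le> Suc (length l1 + length l2)" using l by simp
      then show False using lenl 1 by simp
    next
      case 2
      have lt: "z \<in> letters" "z' \<in> letters" "l' \<in> lists letters" using 2 l by auto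
      have "ev l = el z \<otimes> (ev l' \<otimes> el z')" using lt 2 by (simp add: ev_append)
      then have "inv (el z) \<otimes> ev l \<otimes> inv (inv (el z)) = ev (l' @ [z', z])"
        using lt by (simp add: ev_append m_assoc cancel)
      then have "len (ev l) = len (ev (l' @ [z', z]))"
        using len_conj[of "ev l" "inv (el z)"] lt l by simp
      moreover have "len (ev (l' @ (fst z', snd z') # (fst z', snd z) # []) \<otimes> a [^] (0::nat))
          \<le> Suc (length l' + length ([] :: (nat \<times> (nat list \<Rightarrow> nat list)) list))"
        by (rule len_ev_merge) (use 2 lt in \<open>auto simp: letters_def\<close>)
      moreover have "l' @ (fst z', snd z') # (fst z', snd z) # [] = l' @ [z', z]" using 2 by (simp add: prod_eq_iff)
      ultimately have "len (ev l) \<le> Suc (length l')" using lt by (simp add: ev_append)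
      then show False using lenl 2 by simp
    qed
  qed
  moreover have "len (st u y) \<le> length (filter ?P l)"
    using len_le[OF wd_rep[OF ev_section[OF l(1) i(1)]]] i l by (simp add: len_conj)
  ultimately show ?thesis using lenl by linarith
qed

lemma short_stab:
  assumes u: "u \<in> carrier G" "rot u = 0" and n: "len u \<le> 1"
  shows "\<exists>x\<in>B. \<exists>y\<in>carrier G. u = y \<otimes> x \<otimes> inv y"
proof -
  obtain xs where xs: "rep xs u" "length xs = len u" using rep_exists[OF u(1)] by blast
  obtain l k x where l: "l \<in> lists letters" "map snd l = xs" and x: "x \<in> carrier G"
    and ux: "u = x \<otimes> (ev l \<otimes> a [^] (k::nat)) \<otimes> inv x" "rot u = k mod p"
    using rep_ev[OF xs(1)] by blast
  have "a [^] k = \<one>" using a_pow_mod[of k] u ux by simp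
  then have ue: "u = x \<otimes> ev l \<otimes> inv x" using ux l by simp
  have "length l \<le> 1" using xs l n by auto
  then consider "l = []" | z where "l = [z]" by (cases l) auto
  then show ?thesis
  proof cases
    case 1
    then show ?thesis using ue x by (intro bexI[of _ \<one>] bexI[of _ \<one>]) auto
  next
    case 2
    then have z: "z \<in> letters" "snd z \<in> B" using l letters_D by auto
    have "u = (x \<otimes> a [^] fst z) \<otimes> snd z \<otimes> inv (x \<otimes> a [^] fst z)"
      using ue 2 z x by (simp add: el_def m_assoc inv_mult_group)
    moreover have "x \<otimes> a [^] fst z \<in> carrier G" using x by simp
    ultimately have "\<exists>y\<in>carrier G. u = y \<otimes> snd z \<otimes> inv y" by (rule bexI)
    then show ?thesis using z(2) by (rule bexI)
  qed
qed

lemma len_0: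
  assumes u: "u \<in> carrier G" and n: "len u = 0"
  shows "\<exists>y\<in>carrier G. u = y \<otimes> a [^] rot u \<otimes> inv y"
proof -
  obtain xs where xs: "rep xs u" "length xs = len u" using rep_exists[OF u(1)] by blast
  obtain l k x where l: "l \<in> lists letters" "map snd l = xs" and x: "x \<in> carrier G"
    and ux: "u = x \<otimes> (ev l \<otimes> a [^] (k::nat)) \<otimes> inv x" "rot u = k mod p"
    using rep_ev[OF xs(1)] by blast
  have "l = []" using l xs n by auto
  then show ?thesis using ux x by (auto simp: a_pow_mod)
qed

lemma conj_pow: "w \<in> carrier G \<Longrightarrow> x \<in> carrier G \<Longrightarrow>
    (x \<otimes> w \<otimes> inv x) [^] (n::nat) = x \<otimes> w [^] n \<otimes> inv x"
  by (induction n) (simp_all add: m_assoc cancel)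

text \<open>
  A section of \<open>u\<^sup>p\<close> is the product of all sections of \<open>u\<close>, each taken once. So it has as many letters as
  \<open>u\<close>, and each letter \<open>x\<close> of \<open>u\<close> turns into its section at the last vertex.
\<close>

lemma rep_section_rot:
  assumes u: "rep xs u" and rot: "rot u \<noteq> 0" and y: "y < p"
  shows "\<exists>ys. rep ys (st (u [^] p) y) \<and> length ys = length xs \<and> (\<lambda>x. st x (p - 1)) ` set xs \<subseteq> set ys"
proof -
  obtain l k x where l: "l \<in> lists letters" "map snd l = xs" and x: "x \<in> carrier G"
    and ux: "u = x \<otimes> (ev l \<otimes> a [^] (k::nat)) \<otimes> inv x" "rot u = k mod p"
    using rep_ev[OF u] by blast
  define m where "m = k mod p"
  define w where "w = ev l \<otimes> a [^] k"
  have w: "w \<in> carrier G" "rot w = m" using l by (simp_all add: w_def m_def rot_mult)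
  have m: "m \<noteq> 0" "m < p" using rot ux by (simp_all add: m_def)
  have cop: "coprime m p"
    using p_prime m by (metis coprime_commute nat_dvd_not_less neq0_conv prime_imp_coprime)
  have up: "u [^] p = x \<otimes> w [^] p \<otimes> inv x" using conj_pow[OF w(1) x] ux by (simp add: w_def)
  obtain y' z where y': "y' < p" "z \<in> carrier G" "st (u [^] p) y = z \<otimes> st (w [^] p) y' \<otimes> inv z"
    using conj_section[of "w [^] p" x y] w x y up rot_pow_p by auto
  \<comment> \<open>In the \<open>t\<close>-th factor the letters at position \<open>c + t * m\<close> contribute.\<close>
  define c where "c = y' + m + 1"
  define P where "P t z \<longleftrightarrow> fst z = (c + t * m) mod p" for t and z :: "nat \<times> (nat list \<Rightarrow> nat list)"
  have stw: "wd (map (\<lambda>z. st (snd z) (p - 1)) (filter (P t) l)) (st w ((y' + t * m) mod p))" for t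
  proof -
    let ?i = "((y' + t * m) mod p + m) mod p"
    have "st w ((y' + t * m) mod p) = st (ev l) ?i"
      using l by (simp add: w_def st_mult m_def mod_simps)
    moreover have "(?i + 1) mod p = (c + t * m) mod p"
      by (simp add: c_def mod_simps add_ac)
    ultimately show ?thesis using ev_section[OF l(1), of ?i] unfolding P_def[abs_def] by simp
  qed
  have "\<exists>ys. wd ys (st (w [^] i) y') \<and> length ys = (\<Sum>t<i. length (filter (P t) l)) \<and>
      (\<forall>t<i. \<forall>z\<in>set l. P t z \<longrightarrow> st (snd z) (p - 1) \<in> set ys)" for i :: nat
  proof (induction i)
    case 0
    then show ?case using y' by (intro exI[of _ "[]"]) (simp add: wd_one)
  next
    case (Suc i)
    then obtain ys where ys: "wd ys (st (w [^] i) y')" "length ys = (\<Sum>t<i. length (filter (P t) l))"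
      "\<forall>t<i. \<forall>z\<in>set l. P t z \<longrightarrow> st (snd z) (p - 1) \<in> set ys" by blast
    have "st (w [^] Suc i) y' = st w ((y' + i * m) mod p) \<otimes> st (w [^] i) y'"
      using st_pow_Suc[OF w(1) y'(1), of i] w by simp
    then have "wd (map (\<lambda>z. st (snd z) (p - 1)) (filter (P i) l) @ ys) (st (w [^] Suc i) y')"
      using wd_mult[OF stw[of i] ys(1)] by simp
    then show ?case using ys
      by (intro exI[of _ "map (\<lambda>z. st (snd z) (p - 1)) (filter (P i) l) @ ys"]) (auto simp: less_Suc_eq)
  qed
  then obtain ys where ys: "wd ys (st (w [^] p) y')" "length ys = (\<Sum>t<p. length (filter (P t) l))"
      "\<forall>t<p. \<forall>z\<in>set l. P t z \<longrightarrow> st (snd z) (p - 1) \<in> set ys" by blast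
  have one: "\<exists>t. {t \<in> {..<p}. P t z} = {t}" if z: "z \<in> set l" for z
  proof -
    have "fst z \<in> (\<lambda>t. (c + t * m) mod p) ` {..<p}"
      unfolding affine_image_mod[OF cop p_pos] using z l letters_D(1)[of z] by auto
    then obtain t where t: "t < p" "fst z = (c + t * m) mod p" by auto
    have uniq: "s = t" if "s < p" "P s z" for s
      by (rule inj_onD[OF affine_inj_mod[OF cop, of c]]) (use t that in \<open>simp_all add: P_def\<close>)
    have "P t z" using t by (simp only: P_def)
    then have "{t \<in> {..<p}. P t z} = {t}" using t(1) uniq by blast
    then show ?thesis by blast
  qed
  have "card {t \<in> {..<p}. P t z} = 1" if "z \<in> set l" for z
    using one[OF that] by (simp only: card_1_singleton_iff One_nat_def)
  then have "length ys = length l" unfolding ys(2) by (rule sum_length_filter)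
  moreover have "rep ys (st (u [^] p) y)"
    unfolding y'(3) using rep_conj[OF wd_rep[OF ys(1)] y'(2)] .
  moreover have "(\<lambda>x. st x (p - 1)) ` set xs \<subseteq> set ys"
  proof
    fix q assume "q \<in> (\<lambda>x. st x (p - 1)) ` set xs"
    then obtain z where z: "z \<in> set l" "q = st (snd z) (p - 1)" using l by auto
    then obtain t where "{t \<in> {..<p}. P t z} = {t}" using one by blast
    then have "t < p" "P t z" by blast+
    then show "q \<in> set ys" using ys(3) z by simp
  qed
  ultimately show ?thesis using l by auto
qed

lemma tot_zero:
  assumes B: "\<And>x. x \<in> B \<Longrightarrow> tot x = 0" and g: "g \<in> carrier G"
  shows "tot g = 0"
proof -
  have "{g \<in> carrier G. tot g = 0} = carrier G"
  proof (rule generated)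
    show "subgroup {g \<in> carrier G. tot g = 0} G"
    proof (rule subgroupI)
      fix g assume "g \<in> {g \<in> carrier G. tot g = 0}"
      then have g: "g \<in> carrier G" "tot g = 0" by auto
      have "(tot (inv g) + tot g) mod p = tot \<one>" using tot_mult[of "inv g" g] g by simp
      then show "inv g \<in> {g \<in> carrier G. tot g = 0}" using g by (simp add: tot_def)
    qed (auto simp: tot_mult tot_def[of \<one>] intro!: exI[of _ \<one>])
    show "a \<in> {g \<in> carrier G. tot g = 0}" by (simp add: tot_def)
    show "B \<subseteq> {g \<in> carrier G. tot g = 0}" using B by auto
  qed
  then show ?thesis using g by auto
qed

end



section \<open>Self-similarity from generators\<close>

lemma carrier_tree_aut_group: "carrier (tree_aut_group p) = tree_aut p"
  by (simp add: tree_aut_group_def)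

lemma mult_tree_aut_group:
  "f \<in> tree_aut p \<Longrightarrow> g \<in> tree_aut p \<Longrightarrow> f \<otimes>\<^bsub>tree_aut_group p\<^esub> g = compose (regular_tree p) f g"
  by (simp add: tree_aut_group_def BijGroup_def tree_aut_def)

lemma mod_back:
  fixes x k p :: nat
  assumes "x < p"
  shows "((x + (p - k mod p)) mod p + k) mod p = x"
proof -
  have "k mod p < p" using assms by simp
  then have "x + (p - k mod p) + k mod p = x + p" by simp
  then have "(x + (p - k mod p) + k mod p) mod p = x" using assms by simp
  then show ?thesis by (metis mod_add_left_eq mod_add_right_eq)
qed

text \<open>
  Rotating the first level and having sections in the group are both inherited by products and inverses, so
  it suffices to check them for generators.
\<close>

lemma rot_group_subgroup_generated:
  fixes S
  assumes p: "p > 1" and S: "S \<subseteq> tree_aut p"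
    and rot: "\<And>s. s \<in> S \<Longrightarrow> \<exists>k. \<forall>x<p. s [x] = [(x + k) mod p]"
    and sec: "\<And>s x. s \<in> S \<Longrightarrow> x < p \<Longrightarrow> sec p s x \<in> generate (tree_aut_group p) S"
  shows "rot_group p (subgroup_generated (tree_aut_group p) S)"
proof -
  let ?T = "tree_aut_group p" and ?t = "regular_tree p"
  interpret T: group ?T by (rule group_tree_aut_group)
  define \<Gamma> where "\<Gamma> = generate ?T S"
  have G: "subgroup \<Gamma> ?T" unfolding \<Gamma>_def by (rule T.generate_is_subgroup) (simp add: carrier_tree_aut_group S)
  have Gt: "g \<in> tree_aut p" if "g \<in> \<Gamma>" for g
    using subgroup.subset[OF G] that by (auto simp: carrier_tree_aut_group)
  have app: "(f \<otimes>\<^bsub>?T\<^esub> g) w = f (g w)" if "f \<in> \<Gamma>" "g \<in> \<Gamma>" "w \<in> ?t" for f g w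
    using that by (simp add: mult_tree_aut_group Gt compose_eq)
  have cl: "f w \<in> ?t" if "f \<in> \<Gamma>" "w \<in> ?t" for f w using tree_aut_props(1)[OF Gt] that by blast
  have ext: "f \<in> extensional ?t" if "f \<in> \<Gamma>" for f
    using Gt[OF that] by (auto simp: tree_aut_def Bij_def)
  define H where "H = {g \<in> \<Gamma>. (\<exists>k. \<forall>x<p. g [x] = [(x + k) mod p]) \<and> (\<forall>x<p. sec p g x \<in> \<Gamma>)}"
  have "subgroup H ?T"
  proof (rule T.subgroupI)
    show "H \<subseteq> carrier ?T" using Gt by (auto simp: H_def carrier_tree_aut_group)
    have "sec p \<one>\<^bsub>?T\<^esub> x = \<one>\<^bsub>?T\<^esub>" if "x < p" for x
      using that by (auto simp: sec_def one_tree_aut_group fun_eq_iff restrict_def)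
    then have "\<one>\<^bsub>?T\<^esub> \<in> H"
      using subgroup.one_closed[OF G] by (auto simp: H_def one_tree_aut_group intro!: exI[of _ 0])
    then show "H \<noteq> {}" by blast
  next
    fix g assume "g \<in> H"
    then obtain k where g: "g \<in> \<Gamma>" "\<And>x. x < p \<Longrightarrow> g [x] = [(x + k) mod p]" "\<And>x. x < p \<Longrightarrow> sec p g x \<in> \<Gamma>"
      by (auto simp: H_def)
    let ?h = "inv\<^bsub>?T\<^esub> g"
    have h: "?h \<in> \<Gamma>" using subgroup.m_inv_closed[OF G g(1)] .
    have gT: "g \<in> carrier ?T" using g subgroup.subset[OF G] by blast
    have hg: "?h (g w) = w" if w: "w \<in> ?t" for w
      using app[OF h g(1) w] T.l_inv[OF gT] w by (simp add: one_tree_aut_group)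
    have step: "?h [x] = [(x + (p - k mod p)) mod p] \<and> sec p ?h x \<in> \<Gamma>" if x: "x < p" for x
    proof -
      define y where "y = (x + (p - k mod p)) mod p"
      have y: "y < p" "(y + k) mod p = x" using mod_back[OF x] p by (simp_all add: y_def)
      have "g [y] = [x]" using g(2)[OF y(1)] y(2) by simp
      then have "?h [x] = [y]" using hg[of "[y]"] y by simp
      moreover have "sec p ?h x = inv\<^bsub>?T\<^esub> (sec p g y)"
      proof
        fix u
        let ?q = "sec p g y"
        have q: "?q \<in> \<Gamma>" "inv\<^bsub>?T\<^esub> ?q \<in> \<Gamma>" using g(3)[OF y(1)] subgroup.m_inv_closed[OF G] by auto
        show "sec p ?h x u = (inv\<^bsub>?T\<^esub> ?q) u"
        proof (cases "u \<in> ?t")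
          case True
          let ?v = "(inv\<^bsub>?T\<^esub> ?q) u"
          have v: "?v \<in> ?t" using cl[OF q(2) True] .
          have "?q \<in> carrier ?T" using q subgroup.subset[OF G] by blast
          then have "?q ?v = u" using app[OF q True] T.r_inv[of ?q] True by (simp add: one_tree_aut_group)
          then have "g (y # ?v) = x # u"
            using tree_aut_Cons[OF Gt[OF g(1)] y(1) v] \<open>g [y] = [x]\<close> by simp
          then have "?h (x # u) = y # ?v" using hg[of "y # ?v"] y v by simp
          then show ?thesis using True by (simp add: sec_def)
        next
          case False
          then show ?thesis using extensional_arb[OF ext[OF q(2)] False] by (simp add: sec_def)
        qed
      qed
      then have "sec p ?h x \<in> \<Gamma>" using g(3)[OF y(1)] subgroup.m_inv_closed[OF G] by simp
      ultimately show ?thesis by (simp add: y_def)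
    qed
    then have "\<forall>x<p. ?h [x] = [(x + (p - k mod p)) mod p]" "\<forall>x<p. sec p ?h x \<in> \<Gamma>" by simp_all
    then show "?h \<in> H" using h unfolding H_def by blast
  next
    fix f g assume "f \<in> H" "g \<in> H"
    then obtain k m where f: "f \<in> \<Gamma>" "\<And>x. x < p \<Longrightarrow> f [x] = [(x + k) mod p]" "\<And>x. x < p \<Longrightarrow> sec p f x \<in> \<Gamma>"
      and g: "g \<in> \<Gamma>" "\<And>x. x < p \<Longrightarrow> g [x] = [(x + m) mod p]" "\<And>x. x < p \<Longrightarrow> sec p g x \<in> \<Gamma>"
      by (auto simp: H_def)
    have fg: "f \<otimes>\<^bsub>?T\<^esub> g \<in> \<Gamma>" using subgroup.m_closed[OF G f(1) g(1)] .
    have 1: "(f \<otimes>\<^bsub>?T\<^esub> g) [x] = [(x + (m + k)) mod p]" if "x < p" for x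
      using that p app[OF f(1) g(1), of "[x]"] f(2)[of "(x + m) mod p"] g(2)[OF that] by (simp add: mod_simps add.assoc)
    have 2: "sec p (f \<otimes>\<^bsub>?T\<^esub> g) x \<in> \<Gamma>" if x: "x < p" for x
    proof -
      let ?f = "sec p f ((x + m) mod p)" and ?g = "sec p g x"
      have c: "?f \<in> \<Gamma>" "?g \<in> \<Gamma>" using f g x p by auto
      have "sec p (f \<otimes>\<^bsub>?T\<^esub> g) x = ?f \<otimes>\<^bsub>?T\<^esub> ?g"
      proof
        fix u
        show "sec p (f \<otimes>\<^bsub>?T\<^esub> g) x u = (?f \<otimes>\<^bsub>?T\<^esub> ?g) u"
        proof (cases "u \<in> ?t")
          case True
          have "g (x # u) = ((x + m) mod p) # ?g u"
            using tree_aut_Cons[OF Gt[OF g(1)] x True] g(2)[OF x] by simp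
          moreover have "tl (f (((x + m) mod p) # ?g u)) = ?f (?g u)"
            using cl[OF c(2) True] by (simp add: sec_def[of p f])
          ultimately show ?thesis
            using True x app[OF f(1) g(1), of "x # u"] app[OF c True] by (simp add: sec_def[of p "f \<otimes>\<^bsub>?T\<^esub> g"])
        next
          case False
          then show ?thesis
            using extensional_arb[OF ext[OF subgroup.m_closed[OF G c]] False]
            by (simp add: sec_def[of p "f \<otimes>\<^bsub>?T\<^esub> g"])
        qed
      qed
      then show ?thesis using subgroup.m_closed[OF G c] by simp
    qed
    have "\<forall>x<p. (f \<otimes>\<^bsub>?T\<^esub> g) [x] = [(x + (m + k)) mod p]" using 1 by simp
    then show "f \<otimes>\<^bsub>?T\<^esub> g \<in> H" using fg 2 unfolding H_def by auto
  qed
  moreover have "S \<subseteq> H"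
    using rot sec by (auto simp: H_def \<Gamma>_def generate.incl)
  ultimately have "\<Gamma> \<subseteq> H" unfolding \<Gamma>_def by (intro T.generate_subgroup_incl)
  have carr: "carrier (subgroup_generated ?T S) = \<Gamma>"
    using S by (simp add: carrier_subgroup_generated carrier_tree_aut_group \<Gamma>_def Int_absorb1)
  show ?thesis
  proof (unfold_locales)
    fix g h assume "g \<in> carrier (subgroup_generated ?T S)" "h \<in> carrier (subgroup_generated ?T S)"
    then show "g \<otimes>\<^bsub>subgroup_generated ?T S\<^esub> h = compose ?t g h"
      using carr Gt by (simp add: mult_tree_aut_group)
  next
    fix g x assume g: "g \<in> carrier (subgroup_generated ?T S)" and x: "x < p"
    then have gH: "g \<in> H" using \<open>\<Gamma> \<subseteq> H\<close> carr by blast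
    then obtain k where k: "\<And>x. x < p \<Longrightarrow> g [x] = [(x + k) mod p]" by (auto simp: H_def)
    have "rot g = k mod p" using k[of 0] p by (simp add: rot_def)
    then show "g [x] = [(x + rot g) mod p]" using k[OF x] by (simp add: mod_simps)
    show "sec p g x \<in> carrier (subgroup_generated ?T S)" using gH x carr by (simp add: H_def)
  qed (use p carr Gt T.group_subgroup_generated[unfolded group_def group_axioms_def monoid_def] in \<open>auto simp: one_tree_aut_group\<close>)
qed

lemma (in group) subgroup_generated_eqI:
  assumes H: "subgroup H (subgroup_generated G S)" and S: "S \<subseteq> H" "S \<subseteq> carrier G"
  shows "H = carrier (subgroup_generated G S)"
proof
  show "H \<subseteq> carrier (subgroup_generated G S)" by (rule subgroup.subset[OF H])
  have "subgroup (carrier (subgroup_generated G S)) G" by (rule subgroup_subgroup_generated)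
  moreover have "subgroup H (G\<lparr>carrier := carrier (subgroup_generated G S)\<rparr>)"
    using H by (simp add: subgroup_generated_def)
  ultimately have "subgroup H G" by (rule incl_subgroup)
  then show "carrier (subgroup_generated G S) \<subseteq> H"
    using S by (simp add: carrier_subgroup_generated Int_absorb1 generate_subgroup_incl)
qed

lemma sec_level_tuple:
  assumes "x < p" "gs ! x \<in> extensional (regular_tree p)"
  shows "sec p (level_tuple p gs) x = gs ! x"
  using assms by (auto simp: sec_def level_tuple_def fun_eq_iff restrict_def extensional_def)

section \<open>Short elements and branching\<close>

context rot_group
begin

lemma rot_section_pow:
  assumes "u \<in> carrier G" "i < p"
  shows "rot (st (u [^] n) i) = (\<Sum>t<n. rot (st u ((i + t * rot u) mod p))) mod p"
proof (induction n)
  case 0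
  then show ?case using assms by simp
next
  case (Suc n)
  have "rot (st (u [^] Suc n) i) = (rot (st u ((i + n * rot u) mod p)) + rot (st (u [^] n) i)) mod p"
    unfolding st_pow_Suc[OF assms] using assms by (simp add: rot_mult)
  then show ?case unfolding Suc by (simp add: mod_simps add.commute)
qed

lemma rot_section_pow_p:
  assumes "u \<in> carrier G" "i < p" "coprime (rot u) p"
  shows "rot (st (u [^] p) i) = tot u"
proof -
  have "(\<Sum>t<p. rot (st u ((i + t * rot u) mod p))) = (\<Sum>t\<in>(\<lambda>t. (i + t * rot u) mod p) ` {..<p}. rot (st u t))"
    by (simp add: sum.reindex[OF affine_inj_mod[OF assms(3)]])
  then show ?thesis
    using rot_section_pow[OF assms(1,2)] affine_image_mod[OF assms(3) p_pos] by (simp add: tot_def)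
qed

end

context spinal_group
begin

lemma coprime_rot: "u \<in> carrier G \<Longrightarrow> rot u \<noteq> 0 \<Longrightarrow> coprime (rot u) p"
  using p_prime rot_less[of u] prime_imp_coprime[of p "rot u"] nat_dvd_not_less[of "rot u" p]
  by (simp add: coprime_commute)

text \<open>
  These are the conjugates of elements of \<open>\<langle>a\<rangle> \<union> B\<close>; they form the set on which the length
  argument stops, and which is closed under taking sections.
\<close>

definition short where
  "short u \<longleftrightarrow> len u = 0 \<or> rot u = 0 \<and> len u \<le> 1"

lemma short_cases:
  assumes u: "u \<in> carrier G" "short u"
  shows "\<exists>w y. (w \<in> B \<or> (\<exists>k::nat. w = a [^] k)) \<and> y \<in> carrier G \<and> u = y \<otimes> w \<otimes> inv y"
proof (cases "len u = 0")
  case True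
  then obtain y where "y \<in> carrier G" "u = y \<otimes> a [^] rot u \<otimes> inv y" using len_0[OF u(1)] by blast
  then have "(a [^] rot u \<in> B \<or> (\<exists>k::nat. a [^] rot u = a [^] k)) \<and> y \<in> carrier G \<and> u = y \<otimes> a [^] rot u \<otimes> inv y"
    by blast
  then show ?thesis by (intro exI)
next
  case False
  then have "rot u = 0" "len u \<le> 1" using u(2) by (simp_all add: short_def)
  then obtain x y where "x \<in> B" "y \<in> carrier G" "u = y \<otimes> x \<otimes> inv y"
    using short_stab[OF u(1)] by blast
  then show ?thesis by blast
qed

lemma short_conj: "u \<in> carrier G \<Longrightarrow> x \<in> carrier G \<Longrightarrow> short (x \<otimes> u \<otimes> inv x) \<longleftrightarrow> short u"
  by (simp add: short_def len_conj rot_conj)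

lemma short_a: "short (a [^] (k::nat))"
  using len_le[OF wd_rep[OF wd_Nil]] by (simp add: short_def)

lemma short_B: "x \<in> B \<Longrightarrow> short x"
  using len_le[OF wd_rep[OF wd_B]] by (simp add: short_def B_rot)

lemma short_section_B: "x \<in> B \<Longrightarrow> i < p \<Longrightarrow> short (st x i)"
proof (cases "i < p - 1")
  case True
  then show "x \<in> B \<Longrightarrow> i < p \<Longrightarrow> short (st x i)" using B_fin[of x i] short_a by auto
next
  case False
  assume "x \<in> B" "i < p"
  moreover from this False have "i = p - 1" by simp
  ultimately show "short (st x i)" using B_dir short_B by simp
qed

lemma short_section:
  assumes u: "u \<in> carrier G" "rot u = 0" "short u" and i: "i < p"
  shows "short (st u i)"
proof -
  obtain w y where w: "w \<in> B \<or> (\<exists>k::nat. w = a [^] k)" "y \<in> carrier G" "u = y \<otimes> w \<otimes> inv y"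
    using short_cases[OF u(1,3)] by blast
  have wG: "w \<in> carrier G" using w by auto
  have w0: "rot w = 0" using rot_conj[OF wG w(2)] w u by simp
  have "short (st w j)" if "j < p" for j
    using w(1) short_section_B short_a[of 0] that by auto
  then show ?thesis
    using conj_section[OF wG w0 w(2) i] w(3) wG by (auto simp: short_conj)
qed

lemma short_section_pow:
  assumes u: "u \<in> carrier G" "rot u \<noteq> 0" "short u" and i: "i < p"
  shows "short (st (u [^] p) i)"
proof -
  have "rep [] u" using u rep_exists[OF u(1)] by (simp add: short_def)
  then obtain ys where "rep ys (st (u [^] p) i)" "length ys = 0" using rep_section_rot[OF _ u(2) i] by fastforce
  then show ?thesis using len_le by (fastforce simp: short_def)
qed

lemma short_torsion:
  assumes u: "u \<in> carrier G" "short u" and B: "\<And>x. x \<in> B \<Longrightarrow> x [^] p = \<one>"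
  shows "\<exists>n>0. u [^] (n::nat) = \<one>"
proof -
  obtain w y where w: "w \<in> B \<or> (\<exists>k::nat. w = a [^] k)" "y \<in> carrier G" "u = y \<otimes> w \<otimes> inv y"
    using short_cases[OF u] by blast
  have "(a [^] k) [^] p = \<one>" for k :: nat
    using a_pow_p by (simp add: nat_pow_pow mult.commute[of k]) (simp add: nat_pow_pow[symmetric])
  then have "w [^] p = \<one>" using w(1) B by auto
  then have "u [^] p = \<one>" using w by (auto simp: conj_pow)
  then show ?thesis using p_pos by blast
qed

lemma short_descent_rot:
  assumes u: "u \<in> carrier G" "rot u \<noteq> 0" and i: "i < p"
  shows "len (st (u [^] p) i) \<le> len u"
  using rep_exists[OF u(1)] rep_section_rot[OF _ u(2) i] len_le by metis

text \<open>
  Conjugation by \<open>a\<close> moves the single non-trivial coordinate around, and tuples are products of such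
  elements.
\<close>

lemma branch_tuple:
  assumes K: "K \<lhd> G" and K_rot: "\<And>k. k \<in> K \<Longrightarrow> rot k = 0"
    and first: "\<And>k. k \<in> K \<Longrightarrow> \<exists>g\<in>K. st g 0 = k \<and> (\<forall>i. 0 < i \<and> i < p \<longrightarrow> st g i = \<one>)"
    and f: "\<And>i. i < p \<Longrightarrow> f i \<in> K"
  shows "\<exists>k\<in>K. \<forall>i<p. st k i = f i"
proof -
  interpret K: normal K G by (rule K)
  have KG: "k \<in> carrier G" if "k \<in> K" for k using K.mem_carrier that .
  have "\<exists>k\<in>K. \<forall>i<p. st k i = (if i < n then f i else \<one>)" if "n \<le> p" for n
    using that
  proof (induction n)
    case 0
    then show ?case by (intro bexI[of _ \<one>]) auto
  next
    case (Suc n)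
    then obtain k where k: "k \<in> K" "\<And>i. i < p \<Longrightarrow> st k i = (if i < n then f i else \<one>)" by auto
    obtain g where g: "g \<in> K" "st g 0 = f n" "\<And>i. 0 < i \<Longrightarrow> i < p \<Longrightarrow> st g i = \<one>"
      using first[OF f[of n]] Suc.prems by auto
    define h where "h = a [^] n \<otimes> g \<otimes> inv (a [^] n)"
    have h: "h \<in> K" unfolding h_def by (rule K.inv_op_closed2) (use g in simp_all)
    have sth: "st h ((j + n) mod p) = st g j" if "j < p" for j
      using st_conj[OF KG[OF g(1)] nat_pow_closed[OF a_closed, of n] K_rot[OF g(1)] that] that KG[OF g(1)]
      by (simp add: h_def mod_simps)
    have "st (k \<otimes> h) i = (if i < Suc n then f i else \<one>)" if i: "i < p" for i
    proof -
      define j where "j = (i + (p - n mod p)) mod p"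
      have j: "j < p" "(j + n) mod p = i" using mod_back[OF i, of n] by (simp_all add: j_def)
      have "st (k \<otimes> h) i = (if i < n then f i else \<one>) \<otimes> st g j"
        using st_mult0[OF KG[OF k(1)] KG[OF h] K_rot[OF h] i] k(2)[OF i] sth[OF j(1)] j(2) by simp
      moreover have "j = 0 \<longleftrightarrow> i = n" using j Suc.prems by (auto simp: j_def)
      ultimately show ?thesis
        using g(2) g(3)[of j] j(1) f[OF i] KG Suc.prems by (cases "j = 0") auto
    qed
    then show ?case using k h by (intro bexI[of _ "k \<otimes> h"]) auto
  qed
  from this[of p] show ?thesis by auto
qed

text \<open>
  Sections at \<open>0\<close> of elements that fix the first level form a subgroup. It contains \<open>B\<close>, because conjugating by
  \<open>a\<close> moves the section in \<open>B\<close> from the last vertex to \<open>0\<close>.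
\<close>

lemma first_section_onto:
  assumes a0: "\<exists>g\<in>carrier G. rot g = 0 \<and> st g 0 = a"
    and B0: "\<And>x. x \<in> B \<Longrightarrow> \<exists>y\<in>B. st y (p - 1) = x"
    and g: "g \<in> carrier G"
  shows "\<exists>y\<in>carrier G. rot y = 0 \<and> st y 0 = g"
proof -
  let ?H = "{g. \<exists>y\<in>carrier G. rot y = 0 \<and> st y 0 = g}"
  have "?H = carrier G"
  proof (rule generated)
    show "subgroup ?H G"
    proof (rule subgroupI)
      show "?H \<subseteq> carrier G" by auto
      show "?H \<noteq> {}" using one_closed rot_one by blast
      show "inv g \<in> ?H" if "g \<in> ?H" for g
        using that by (auto simp: rot_inv st_inv0 intro!: bexI[of _ "inv _"])
      fix g h assume "g \<in> ?H" "h \<in> ?H"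
      then obtain x y where "x \<in> carrier G" "rot x = 0" "st x 0 = g" "y \<in> carrier G" "rot y = 0" "st y 0 = h"
        by blast
      then show "g \<otimes> h \<in> ?H" by (auto simp: rot_mult st_mult0 intro!: bexI[of _ "x \<otimes> y"])
    qed
    show "a \<in> ?H" using a0 by blast
    show "B \<subseteq> ?H"
    proof
      fix x assume "x \<in> B"
      then obtain y where y: "y \<in> B" "st y (p - 1) = x" using B0 by blast
      have lt: "(1, y) \<in> letters" using y p_gt_1 by (simp add: letters_def)
      have "st (el (1, y)) 0 = x" using st_el_dir[OF lt, of 0] y p_gt_1 by simp
      then show "x \<in> ?H" using lt by (auto intro!: bexI[of _ "el (1, y)"])
    qed
  qed
  then show ?thesis using g by blast
qed

end



section \<open>Invariants on the second level and short pairs\<close>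

context rot_group
begin

text \<open>
  Reading the rotations of the sections as coefficients of a polynomial \<open>f\<close> modulo \<open>X\<^sup>p - 1\<close> over the field
  with \<open>p\<close> elements, \<open>tot\<close> is \<open>f(1)\<close> and \<open>tau\<close> is \<open>-f'(1)\<close>. Multiplying by \<open>X\<close> changes \<open>f'(1)\<close> by
  \<open>f(1)\<close>; hence \<open>tau\<close> is additive where \<open>tot\<close> vanishes.
\<close>

definition tau :: "(nat list \<Rightarrow> nat list) \<Rightarrow> int" where
  "tau g = (- (\<Sum>i<p. int i * int (rot (st g i)))) mod int p"

lemma tau_mult:
  assumes g: "g \<in> carrier G" and h: "h \<in> carrier G" and tot: "tot g = 0"
  shows "tau (g \<otimes> h) = (tau g + tau h) mod int p"
proof -
  define r where "r = rot h"
  define F where "F i = int (rot (st g i))" for i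
  define H where "H i = int (rot (st h i))" for i
  define E where "E i = int (rot (st (g \<otimes> h) i))" for i
  have E: "int p dvd E i - (F ((i + r) mod p) + H i)" if "i < p" for i
  proof -
    have "rot (st (g \<otimes> h) i) = (rot (st g ((i + r) mod p)) + rot (st h i)) mod p"
      using g h that by (simp add: st_mult rot_mult r_def)
    then have "E i mod int p = (F ((i + r) mod p) + H i) mod int p"
      unfolding E_def F_def H_def by (simp add: zmod_int)
    then show ?thesis by (simp add: mod_eq_dvd_iff)
  qed
  have "int p dvd (\<Sum>i<p. int i * (E i - (F ((i + r) mod p) + H i)))"
    using E by (intro dvd_sum) auto
  then have 1: "int p dvd (\<Sum>i<p. int i * E i) - ((\<Sum>i<p. int i * F ((i + r) mod p)) + (\<Sum>i<p. int i * H i))"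
    by (simp add: right_diff_distrib distrib_left sum_subtractf sum.distrib)
  have "int p dvd int ((i + r) mod p) - int (i + r)" for i
    by (simp add: zmod_int mod_eq_dvd_iff[symmetric])
  then have "int p dvd (\<Sum>i<p. (int ((i + r) mod p) - int (i + r)) * F ((i + r) mod p))"
    by (intro dvd_sum) auto
  then have "int p dvd (\<Sum>i<p. int ((i + r) mod p) * F ((i + r) mod p)) -
      ((\<Sum>i<p. int i * F ((i + r) mod p)) + int r * (\<Sum>i<p. F ((i + r) mod p)))"
    by (simp add: left_diff_distrib distrib_right sum_subtractf sum.distrib sum_distrib_left)
  then have 2: "int p dvd (\<Sum>i<p. int i * F i) - ((\<Sum>i<p. int i * F ((i + r) mod p)) + int r * (\<Sum>i<p. F i))"
    by (simp only: sum_rotate[of "\<lambda>i. int i * F i" r] sum_rotate[of F r])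
  have "int p dvd (\<Sum>i<p. F i)"
  proof -
    have "p dvd (\<Sum>i<p. rot (st g i))" using tot by (simp add: tot_def mod_eq_0_iff_dvd)
    then have "int p dvd int (\<Sum>i<p. rot (st g i))" by (simp only: int_dvd_int_iff)
    then show ?thesis by (simp add: F_def)
  qed
  then have "int p dvd ((\<Sum>i<p. int i * F i) - ((\<Sum>i<p. int i * F ((i + r) mod p)) + int r * (\<Sum>i<p. F i)))
      + int r * (\<Sum>i<p. F i)"
    using 2 by (intro dvd_add dvd_mult)
  then have "int p dvd (\<Sum>i<p. int i * F i) - (\<Sum>i<p. int i * F ((i + r) mod p))" by simp
  then have "int p dvd ((\<Sum>i<p. int i * F i) - (\<Sum>i<p. int i * F ((i + r) mod p))) -
     ((\<Sum>i<p. int i * E i) - ((\<Sum>i<p. int i * F ((i + r) mod p)) + (\<Sum>i<p. int i * H i)))"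
    using 1 by (rule dvd_diff)
  then have "int p dvd (- (\<Sum>i<p. int i * E i)) - (- (\<Sum>i<p. int i * F i) + - (\<Sum>i<p. int i * H i))"
    by (simp add: algebra_simps)
  then have "(- (\<Sum>i<p. int i * E i)) mod int p = (- (\<Sum>i<p. int i * F i) + - (\<Sum>i<p. int i * H i)) mod int p"
    by (simp only: mod_eq_dvd_iff)
  then show ?thesis unfolding tau_def E_def F_def H_def by (simp only: mod_add_eq)
qed

lemma tau_one: "tau \<one> = 0"
  by (simp add: tau_def)

lemma tau_mod[simp]: "tau g mod int p = tau g"
  by (simp add: tau_def)

end

locale spinal_branch_group = spinal_group + branch_group
begin

lemma detected_one: "detected \<one> \<one>"
proof -
  have "\<one> \<in> K" using R_one[of 0] by simp
  then show ?thesis unfolding detected_def approx_def by (intro exI ballI impI bexI[of _ \<one>]) auto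
qed

text \<open>
  The \<open>p\<close>-th power of \<open>a\<^sup>k\<close> is trivial, so going around the cycle reduces every non-trivial power of \<open>a\<close>
  to the pair \<open>(1, 1)\<close>.
\<close>

lemma detected_a_pow: "detected (a [^] (k::nat)) (a [^] (m::nat))"
proof (cases "k mod p = m mod p")
  case False
  then show ?thesis by (intro detected_rot_differ) auto
next
  case True
  then have eq: "a [^] m = a [^] k" using a_pow_mod by metis
  show ?thesis
  proof (cases "k mod p = 0")
    case True
    then have "a [^] k = \<one>" using a_pow_mod[of k] by simp
    then show ?thesis using eq detected_one by simp
  next
    case False
    have "(a [^] k) [^] p = \<one>"
      using a_pow_p by (simp add: nat_pow_pow mult.commute[of k]) (simp add: nat_pow_pow[symmetric])
    then have "detected (st ((a [^] k) [^] p) i) (st ((a [^] k) [^] p) j)" if "i < p" "j < p" for i j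
      using that detected_one by simp
    then have "detected (a [^] k) (a [^] k)"
      by (rule detected_rot[rotated 4]) (use False in simp_all)
    then show ?thesis by (simp only: eq)
  qed
qed

text \<open>
  A power of \<open>a\<close> and an element of \<open>B\<close> differ on the first level unless the former is trivial.
\<close>

lemma detected_short:
  assumes B: "\<And>x y. x \<in> B \<Longrightarrow> y \<in> B \<Longrightarrow> detected x y"
    and u: "u \<in> carrier G" "short u" and v: "v \<in> carrier G" "short v"
  shows "detected u v"
proof -
  obtain w y where w: "w \<in> B \<or> (\<exists>k::nat. w = a [^] k)" and y: "y \<in> carrier G" "u = y \<otimes> w \<otimes> inv y"
    using short_cases[OF u] by blast
  obtain w' y' where w': "w' \<in> B \<or> (\<exists>k::nat. w' = a [^] k)" and y': "y' \<in> carrier G" "v = y' \<otimes> w' \<otimes> inv y'"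
    using short_cases[OF v] by blast
  have G: "w \<in> carrier G" "w' \<in> carrier G" using w w' by auto
  have aB: "a [^] k \<in> B" if "p dvd k" for k :: nat
  proof -
    have "a [^] k = \<one>" using that a_pow_mod[of k] by simp
    then show ?thesis by simp
  qed
  have "detected w w'"
  proof (cases "rot w = rot w'")
    case False
    then show ?thesis using detected_rot_differ G by blast
  next
    case True
    show ?thesis
    proof (cases "rot w = 0")
      case True
      then have "w \<in> B" "w' \<in> B" using w w' aB \<open>rot w = rot w'\<close> by auto
      then show ?thesis by (rule B)
    next
      case False
      then have "w \<notin> B" "w' \<notin> B" using B_rot True by auto
      then show ?thesis using w w' detected_a_pow by auto
    qed
  qed
  then show ?thesis unfolding y(2) y'(2) by (rule detected_conj[OF G y(1) y'(1)])
qed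

end

lemma (in group) comm_pow:
  assumes "x \<in> carrier G" "y \<in> carrier G" "x \<otimes> y = y \<otimes> x"
  shows "x [^] (m::nat) \<otimes> y [^] (n::nat) = y [^] n \<otimes> x [^] m"
proof -
  have 1: "x \<otimes> y [^] n = y [^] n \<otimes> x"
  proof (induction n)
    case (Suc n)
    have "x \<otimes> y [^] Suc n = (x \<otimes> y [^] n) \<otimes> y" using assms by (simp add: m_assoc)
    also have "\<dots> = y [^] n \<otimes> (x \<otimes> y)" unfolding Suc using assms by (simp add: m_assoc)
    also have "\<dots> = y [^] Suc n \<otimes> x" unfolding assms(3) using assms by (simp add: m_assoc)
    finally show ?case .
  qed (use assms in simp)
  show ?thesis
  proof (induction m)
    case (Suc m)
    have "x [^] Suc m \<otimes> y [^] n = x [^] m \<otimes> (x \<otimes> y [^] n)" using assms by (simp add: m_assoc)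
    also have "\<dots> = (x [^] m \<otimes> y [^] n) \<otimes> x" unfolding 1 using assms by (simp add: m_assoc)
    also have "\<dots> = y [^] n \<otimes> x [^] Suc m" unfolding Suc using assms by (simp add: m_assoc)
    finally show ?case .
  qed (use assms in simp)
qed

section \<open>The Gupta--Sidki groups\<close>

locale gupta_sidki =
  fixes p :: nat
  assumes prime: "Factorial_Ring.prime p" and p3: "p \<ge> 3"
begin

abbreviation (input) GS where "GS \<equiv> gupta_sidki_group p"
abbreviation (input) t where "t \<equiv> gs_t p"

lemma gs_in: "gs_a p \<in> tree_aut p" "gs_t p \<in> tree_aut p"
  using gs_generators[OF p3] by (auto simp: carrier_tree_aut_group)

lemma gs_incl: "gs_a p \<in> carrier GS" "gs_t p \<in> carrier GS"
  using gs_in by (auto simp: gupta_sidki_group_def carrier_subgroup_generated carrier_tree_aut_group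
      intro: generate.incl)

lemma ext_tree: "f \<in> tree_aut p \<Longrightarrow> f \<in> extensional (regular_tree p)"
  by (auto simp: tree_aut_def Bij_def)

lemma sec_t:
  assumes "x < p"
  shows "sec p t x = (if x = 0 then gs_a p else if x = 1 then inv\<^bsub>tree_aut_group p\<^esub> (gs_a p)
               else if x = p - 1 then t else \<one>\<^bsub>tree_aut_group p\<^esub>)"
proof -
  let ?gs = "[gs_a p, inv\<^bsub>tree_aut_group p\<^esub> (gs_a p)]
             @ replicate (p - 3) \<one>\<^bsub>tree_aut_group p\<^esub> @ [gs_t p]"
  have nth: "?gs ! x = (if x = 0 then gs_a p else if x = 1 then inv\<^bsub>tree_aut_group p\<^esub> (gs_a p)
               else if x = p - 1 then gs_t p else \<one>\<^bsub>tree_aut_group p\<^esub>)"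
    using assms p3 by (auto simp: nth_append nth_Cons')
  have "?gs ! x \<in> tree_aut p"
    unfolding nth using gs_in inv_in_tree_aut one_in_tree_aut by auto
  then have "sec p (level_tuple p ?gs) x = ?gs ! x" by (intro sec_level_tuple assms ext_tree)
  moreover have "sec p t x = sec p (level_tuple p ?gs) x"
    by (rule arg_cong[OF gs_t_equation[OF p3]])
  ultimately show ?thesis by (simp only: nth)
qed

lemma t_level1: "x < p \<Longrightarrow> t [x] = [x]"
proof -
  assume x: "x < p"
  let ?gs = "[gs_a p, inv\<^bsub>tree_aut_group p\<^esub> (gs_a p)]
             @ replicate (p - 3) \<one>\<^bsub>tree_aut_group p\<^esub> @ [gs_t p]"
  have "t [x] = level_tuple p ?gs [x]" by (rule fun_cong[OF gs_t_equation[OF p3]])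
  also have "\<dots> = x # (?gs ! x) []" using x by (simp add: level_tuple_def)
  finally have "t [x] = x # (?gs ! x) []" .
  moreover have "?gs ! x \<in> set ?gs" using x p3 by (intro nth_mem) simp
  then have "?gs ! x \<in> tree_aut p"
    using gs_in inv_in_tree_aut[OF gs_in(1)] one_in_tree_aut by (auto simp: set_replicate_conv_if split: if_splits)
  then have "(?gs ! x) [] = []" using tree_aut_props(4)[of "?gs ! x" p "[]"] by simp
  ultimately show ?thesis by simp
qed

lemma rot_group_GS: "rot_group p GS"
  unfolding gupta_sidki_group_def
proof (rule rot_group_subgroup_generated)
  let ?S = "{gs_a p, gs_t p}"
  interpret T: group "tree_aut_group p" by (rule group_tree_aut_group)
  fix s x assume s: "s \<in> ?S"
  show "\<exists>k. \<forall>x<p. s [x] = [(x + k) mod p]"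
  proof (cases "s = gs_a p")
    case True
    then show ?thesis by (intro exI[of _ 1]) (simp add: gs_a_def rooted_cycle_def)
  next
    case False
    then show ?thesis using s t_level1 by (intro exI[of _ 0]) simp
  qed
  assume x: "x < p"
  have "sec p (gs_a p) x = \<one>\<^bsub>tree_aut_group p\<^esub>"
    using x by (auto simp: gs_a_def sec_def rooted_cycle_def one_tree_aut_group fun_eq_iff restrict_def)
  then show "sec p s x \<in> generate (tree_aut_group p) ?S"
    using s sec_t[OF x] by (auto intro: generate.intros)
qed (use gs_in p3 in auto)

end

sublocale gupta_sidki \<subseteq> rooted_group p "gupta_sidki_group p"
  using rot_group_GS gs_incl by (simp add: rooted_group_def rooted_group_axioms_def gs_a_def)

context gupta_sidki
begin

lemma t_closed[simp]: "t \<in> carrier GS" by (rule gs_incl)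

lemma st_t: "x < p \<Longrightarrow> st t x = (if x = 0 then a else if x = 1 then inv\<^bsub>GS\<^esub> a
               else if x = p - 1 then t else \<one>\<^bsub>GS\<^esub>)"
proof -
  interpret T: group "tree_aut_group p" by (rule group_tree_aut_group)
  have "inv\<^bsub>GS\<^esub> a = inv\<^bsub>tree_aut_group p\<^esub> (gs_a p)"
    using gs_incl unfolding gupta_sidki_group_def by (simp add: gs_a_def)
  moreover have "\<one>\<^bsub>GS\<^esub> = \<one>\<^bsub>tree_aut_group p\<^esub>" by (simp add: gupta_sidki_group_def)
  ultimately show "x < p \<Longrightarrow> ?thesis" using sec_t by (simp add: gs_a_def)
qed

lemma rot_t[simp]: "rot t = 0"
  using t_level1[of 0] p3 by (simp add: rot_def)

lemma inv_a_pow_p: "(inv\<^bsub>GS\<^esub> a) [^]\<^bsub>GS\<^esub> p = \<one>\<^bsub>GS\<^esub>"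
  using a_pow_p nat_pow_inv[of a p] by simp

text \<open>
  The section of \<open>t\<^sup>p\<close> at the last vertex is \<open>t\<^sup>p\<close> again, so this is an induction on words.
\<close>

lemma t_pow_p: "t [^]\<^bsub>GS\<^esub> p = \<one>\<^bsub>GS\<^esub>"
proof (rule app_eqI)
  fix w assume "w \<in> regular_tree p"
  then show "(t [^]\<^bsub>GS\<^esub> p) w = \<one>\<^bsub>GS\<^esub> w"
  proof (induction w)
    case Nil
    then show ?case by (simp add: app_Nil)
  next
    case (Cons x w)
    then have x: "x < p" and w: "w \<in> regular_tree p" by auto
    have "(t [^]\<^bsub>GS\<^esub> p) (x # w) = x # (st t x [^]\<^bsub>GS\<^esub> p) w"
      using x w by (simp add: app_Cons rot_pow st_pow0)
    also have "(st t x [^]\<^bsub>GS\<^esub> p) w = w"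
    proof (cases "x = p - 1")
      case True
      have "x \<noteq> 0" "x \<noteq> 1" using True p3 by linarith+
      then have "st t x = t" unfolding st_t[OF x] using True by (simp only: if_False if_True simp_thms)
      then show ?thesis using Cons.IH[OF w] w by (simp add: one_eq)
    next
      case False
      then have "st t x [^]\<^bsub>GS\<^esub> p = \<one>\<^bsub>GS\<^esub>" using x a_pow_p inv_a_pow_p by (simp add: st_t)
      then show ?thesis using w by (simp add: one_eq)
    qed
    finally show ?case using x w by (simp add: one_eq)
  qed
qed simp_all

definition spine where "spine = range (\<lambda>e::nat. t [^]\<^bsub>GS\<^esub> e)"

lemma spine_I: "t [^]\<^bsub>GS\<^esub> (e::nat) \<in> spine" by (auto simp: spine_def)

lemma t_pow_mod: "t [^]\<^bsub>GS\<^esub> (e mod p) = t [^]\<^bsub>GS\<^esub> e"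
proof -
  have "t [^]\<^bsub>GS\<^esub> e = t [^]\<^bsub>GS\<^esub> (p * (e div p) + e mod p)" by simp
  also have "\<dots> = (t [^]\<^bsub>GS\<^esub> p) [^]\<^bsub>GS\<^esub> (e div p) \<otimes>\<^bsub>GS\<^esub> t [^]\<^bsub>GS\<^esub> (e mod p)"
    by (simp only: nat_pow_mult[OF t_closed, symmetric] nat_pow_pow[OF t_closed])
  finally show ?thesis by (simp add: t_pow_p)
qed

lemma t_pow_inv: "inv\<^bsub>GS\<^esub> (t [^]\<^bsub>GS\<^esub> e) = t [^]\<^bsub>GS\<^esub> ((p - 1) * e)"
proof (rule inv_equality)
  have "(p - 1) * e + e = p * e" using p3 by (cases p) auto
  then show "t [^]\<^bsub>GS\<^esub> ((p - 1) * e) \<otimes>\<^bsub>GS\<^esub> t [^]\<^bsub>GS\<^esub> e = \<one>\<^bsub>GS\<^esub>"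
    using t_pow_mod[of "p * e"] by (simp add: nat_pow_mult)
qed simp_all

lemma st_t_pow: "x < p \<Longrightarrow> st (t [^]\<^bsub>GS\<^esub> (e::nat)) x = st t x [^]\<^bsub>GS\<^esub> e"
  by (simp add: st_pow0)

end

sublocale gupta_sidki \<subseteq> spinal_group p "gupta_sidki_group p" spine
proof (rule spinal_group.intro[OF rooted_group_axioms], rule spinal_group_axioms.intro)
  show "Factorial_Ring.prime p" by (rule prime)
  show "subgroup spine GS"
  proof (rule subgroupI)
    show "spine \<subseteq> carrier GS" by (auto simp: spine_def)
    show "spine \<noteq> {}" by (auto simp: spine_def)
    show "inv\<^bsub>GS\<^esub> x \<in> spine" if "x \<in> spine" for x
      using that by (auto simp: spine_def t_pow_inv)
    show "x \<otimes>\<^bsub>GS\<^esub> y \<in> spine" if "x \<in> spine" "y \<in> spine" for x y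
      using that by (auto simp: spine_def nat_pow_mult)
  qed
  show "rot x = 0" if "x \<in> spine" for x using that by (auto simp: spine_def rot_pow)
  show "sec p x (p - 1) \<in> spine" if "x \<in> spine" for x
    using that p3 by (auto simp: spine_def st_t_pow st_t)
  show "\<exists>k::nat. sec p x i = a [^]\<^bsub>GS\<^esub> k" if xi: "x \<in> spine" "i < p - 1" for x i
  proof -
    obtain e :: nat where e: "x = t [^]\<^bsub>GS\<^esub> e" using xi by (auto simp: spine_def)
    have "inv\<^bsub>GS\<^esub> a = a [^]\<^bsub>GS\<^esub> (p - 1)" using a_pow_inv[of 1] p3 by simp
    then have "st t i \<in> {a [^]\<^bsub>GS\<^esub> (1::nat), a [^]\<^bsub>GS\<^esub> (p - 1), a [^]\<^bsub>GS\<^esub> (0::nat)}"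
      using xi by (simp add: st_t)
    then obtain k :: nat where "st t i = a [^]\<^bsub>GS\<^esub> k" by blast
    then show ?thesis using xi e by (auto simp: st_t_pow nat_pow_pow)
  qed
  fix H assume H: "subgroup H GS" "a \<in> H" "spine \<subseteq> H"
  interpret T: group "tree_aut_group p" by (rule group_tree_aut_group)
  have "t \<in> H" using spine_I[of 1] H by auto
  then show "H = carrier GS"
    using H gs_in T.subgroup_generated_eqI[of H "{gs_a p, gs_t p}"]
    by (simp add: gupta_sidki_group_def carrier_tree_aut_group gs_a_def)
qed



context gupta_sidki
begin

lemma sum_single:
  fixes f :: "nat \<Rightarrow> 'b :: comm_monoid_add"
  assumes "j < n" "\<And>i. i < n \<Longrightarrow> i \<noteq> j \<Longrightarrow> f i = 0"
  shows "(\<Sum>i<n. f i) = f j"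
proof -
  have "(\<Sum>i<n. f i) = sum f {j}" by (rule sum.mono_neutral_right) (use assms in auto)
  then show ?thesis by simp
qed

lemma rot_inv_a: "rot (inv\<^bsub>GS\<^esub> a) = p - 1"
  using p3 by (simp add: rot_inv)

lemma rot_st_t: "x < p \<Longrightarrow> rot (st t x) = (if x = 0 then 1 else if x = 1 then p - 1 else 0)"
  using p3 by (simp add: st_t rot_inv_a)

lemma tot_t: "tot t = 0"
proof -
  have "(\<Sum>i<p. rot (st t i)) = (\<Sum>i<p. (if i = 0 then 1 else 0) + (if i = 1 then p - 1 else 0))"
    by (rule sum.cong) (auto simp: rot_st_t)
  also have "\<dots> = p" using p3 by (simp add: sum.distrib)
  finally show ?thesis by (simp add: tot_def)
qed

lemma tot_GS: "g \<in> carrier GS \<Longrightarrow> tot g = 0"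
proof (rule tot_zero)
  fix x assume "x \<in> spine"
  then obtain e :: nat where e: "x = t [^]\<^bsub>GS\<^esub> e" by (auto simp: spine_def)
  have "tot (t [^]\<^bsub>GS\<^esub> e) = 0"
    by (induction e) (simp_all add: tot_mult tot_t, simp add: tot_def)
  then show "tot x = 0" using e by simp
qed

text \<open>
  The rotations of \<open>t\<close> give the polynomial \<open>1 - X\<close>, with derivative \<open>-1\<close>.
\<close>

lemma tau_t: "tau t = 1"
proof -
  have "(\<Sum>i<p. int i * int (rot (st t i))) = int 1 * int (rot (st t 1))"
    by (rule sum_single) (use p3 in \<open>auto simp: rot_st_t\<close>)
  then have "tau t = (- int (p - 1)) mod int p" using p3 by (simp add: tau_def rot_st_t)
  also have "- int (p - 1) = 1 + int p * (-1)" using p3 by simp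
  also have "(1 + int p * (-1)) mod int p = 1 mod int p" by (rule mod_mult_self2)
  also have "\<dots> = 1" using p3 by simp
  finally show ?thesis .
qed

lemma tau_GS: "g \<in> carrier GS \<Longrightarrow> h \<in> carrier GS \<Longrightarrow> tau (g \<otimes>\<^bsub>GS\<^esub> h) = (tau g + tau h) mod int p"
  by (rule tau_mult) (simp_all add: tot_GS)

lemma tau_pow: "g \<in> carrier GS \<Longrightarrow> tau (g [^]\<^bsub>GS\<^esub> (n::nat)) = (int n * tau g) mod int p"
  by (induction n) (simp_all add: tau_one tau_GS mod_simps algebra_simps)

lemma tau_cancel: "tau r = 0" if "(tau g + tau r) mod int p = tau g"
proof -
  have "int p dvd tau g + tau r - tau g"
    using that tau_mod[of g] by (metis mod_eq_dvd_iff)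
  then have "int p dvd tau r" by simp
  then have "tau r mod int p = 0" by (rule dvd_imp_mod_0)
  then show ?thesis by (simp only: tau_mod)
qed

text \<open>
  The derived subgroup, described by the two homomorphisms to the cyclic group of order \<open>p\<close> that count the
  exponents of \<open>a\<close> and of \<open>t\<close>. In this form the index and the exponent of the quotient are immediate.
\<close>

definition K where "K = {g \<in> carrier GS. rot g = 0 \<and> tau g = 0}"

lemma K_quotient:
  assumes "f \<in> carrier GS" "g \<in> carrier GS" "rot f = rot g" "tau f = tau g"
  shows "inv\<^bsub>GS\<^esub> g \<otimes>\<^bsub>GS\<^esub> f \<in> K"
proof -
  define r where "r = inv\<^bsub>GS\<^esub> g \<otimes>\<^bsub>GS\<^esub> f"
  have r: "r \<in> carrier GS" "g \<otimes>\<^bsub>GS\<^esub> r = f" using assms by (simp_all add: r_def cancel)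
  have "(rot r + rot g) mod p = (0 + rot g) mod p"
    using rot_mult[OF assms(2) r(1)] r assms by (simp add: add.commute)
  then have "rot r = 0" by (rule add_mod_cancel) (use r in auto)
  moreover have "tau r = 0" using tau_GS[OF assms(2) r(1)] r assms by (intro tau_cancel[of g]) simp
  ultimately show ?thesis using r by (simp add: K_def r_def)
qed

lemma K_subgroup: "subgroup K GS"
proof (rule subgroupI)
  show "K \<noteq> {}" using tau_one by (auto simp: K_def intro!: exI[of _ "\<one>\<^bsub>GS\<^esub>"])
  show "inv\<^bsub>GS\<^esub> g \<in> K" if g: "g \<in> K" for g
  proof -
    have "inv\<^bsub>GS\<^esub> g \<otimes>\<^bsub>GS\<^esub> \<one>\<^bsub>GS\<^esub> \<in> K"
      by (rule K_quotient) (use g tau_one in \<open>auto simp: K_def\<close>)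
    then show ?thesis using g by (simp add: K_def)
  qed
  show "g \<otimes>\<^bsub>GS\<^esub> h \<in> K" if "g \<in> K" "h \<in> K" for g h
    using that by (auto simp: K_def rot_mult tau_GS)
qed (auto simp: K_def)

lemma tau_conj:
  assumes "g \<in> carrier GS" "x \<in> carrier GS"
  shows "tau (x \<otimes>\<^bsub>GS\<^esub> g \<otimes>\<^bsub>GS\<^esub> inv\<^bsub>GS\<^esub> x) = tau g"
proof -
  have "(tau x + tau (inv\<^bsub>GS\<^esub> x)) mod int p = 0"
    using tau_GS[of x "inv\<^bsub>GS\<^esub> x"] assms tau_one by simp
  then have "(tau g + (tau x + tau (inv\<^bsub>GS\<^esub> x)) mod int p) mod int p = tau g" by simp
  moreover have "tau (x \<otimes>\<^bsub>GS\<^esub> g \<otimes>\<^bsub>GS\<^esub> inv\<^bsub>GS\<^esub> x) = (tau g + (tau x + tau (inv\<^bsub>GS\<^esub> x))) mod int p"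
    using assms by (simp add: tau_GS mod_simps algebra_simps)
  ultimately show ?thesis by (simp add: mod_simps)
qed

lemma K_normal: "K \<lhd> GS"
  unfolding normal_inv_iff using K_subgroup by (auto simp: K_def rot_conj tau_conj)

lemma K_finite: "finite (rcosets\<^bsub>GS\<^esub> K)"
proof (rule normal.finite_rcosets_invariant[OF K_normal])
  have "(\<lambda>g. (rot g, tau g)) ` carrier GS \<subseteq> {..<p} \<times> {0..<int p}"
    using p3 by (auto simp: tau_def)
  then show "finite ((\<lambda>g. (rot g, tau g)) ` carrier GS)" by (rule finite_subset) simp
qed (use K_quotient in auto)

lemma K_exponent: "g \<in> carrier GS \<Longrightarrow> g [^]\<^bsub>GS\<^esub> (p ^ 1) \<in> K"
  by (simp add: K_def rot_pow tau_pow)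

lemma st_el_minus:
  assumes "j < p" "x \<in> spine" "y < p"
  shows "st (el (j, x)) y = st x ((y + (p - j)) mod p)"
  using st_el[of "(j, x)" "(y + (p - j)) mod p"] mod_back[of y p j] assms by (simp add: letters_def)

text \<open>
  Two elements whose supports on the first level meet only at \<open>0\<close>, so that their commutator has a
  single non-trivial section. The products are chosen so that this also holds for \<open>p = 3\<close>, where
  \<open>[t\<^sub>1, t\<^sub>0]\<close> itself has two.
\<close>

definition t1t0 where "t1t0 = el (1, t) \<otimes>\<^bsub>GS\<^esub> el (0, t)"
definition t2t1 where "t2t1 = el (2, t) \<otimes>\<^bsub>GS\<^esub> el (1, t)"

lemma t_spine: "t \<in> spine" using spine_I[of 1] by simp

lemma t_letters: "j < p \<Longrightarrow> (j, t) \<in> letters"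
  using t_spine by (simp add: letters_def)

lemma tt_closed: "t1t0 \<in> carrier GS" "t2t1 \<in> carrier GS" "rot t1t0 = 0" "rot t2t1 = 0"
  using t_letters p3 by (auto simp: t1t0_def t2t1_def rot_mult)

lemma st_el_t:
  assumes y: "y < p"
  shows "st (el (0, t)) y = st t y"
    and "st (el (1, t)) y = st t (if y = 0 then p - 1 else y - 1)"
    and "st (el (2, t)) y = st t (if y = 0 then p - 2 else if y = 1 then p - 1 else y - 2)"
proof -
  have 1: "(y + (p - 1)) mod p = (if y = 0 then p - 1 else y - 1)"
  proof (cases y)
    case (Suc k)
    then have "y + (p - 1) = k + p" using p3 by simp
    then show ?thesis using Suc y by simp
  qed (use p3 in simp)
  have 2: "(y + (p - 2)) mod p = (if y = 0 then p - 2 else if y = 1 then p - 1 else y - 2)"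
  proof (cases "y < 2")
    case True
    then have "y = 0 \<or> y = 1" by auto
    then show ?thesis using p3 by auto
  next
    case False
    then have "y + (p - 2) = (y - 2) + p" using p3 by simp
    then have "(y + (p - 2)) mod p = y - 2" by (simp only: mod_add_self2) (use y in simp)
    then show ?thesis using False by simp
  qed
  show "st (el (0, t)) y = st t y" using st_el_minus[of 0 t y] t_spine y by simp
  show "st (el (1, t)) y = st t (if y = 0 then p - 1 else y - 1)"
    using st_el_minus[of 1 t y] t_spine y p3 1 by simp
  show "st (el (2, t)) y = st t (if y = 0 then p - 2 else if y = 1 then p - 1 else y - 2)"
    using st_el_minus[of 2 t y] t_spine y p3 2 by simp
qed

lemma st_t1t0: "y < p \<Longrightarrow> st t1t0 y = st t (if y = 0 then p - 1 else y - 1) \<otimes>\<^bsub>GS\<^esub> st t y"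
  using st_mult0[of "el (1, t)" "el (0, t)" y] t_letters p3 st_el_t[of y] by (simp add: t1t0_def)

lemma st_t2t1: "y < p \<Longrightarrow> st t2t1 y = st t (if y = 0 then p - 2 else if y = 1 then p - 1 else y - 2)
     \<otimes>\<^bsub>GS\<^esub> st t (if y = 0 then p - 1 else y - 1)"
  using st_mult0[of "el (2, t)" "el (1, t)" y] t_letters p3 st_el_t[of y] by (simp add: t2t1_def)

text \<open>
  For \<open>p = 4\<close> the supports would meet at \<open>3\<close>.
\<close>

lemma p_ne_4: "p \<noteq> 4"
proof
  assume "p = 4"
  then have "2 dvd p" by simp
  then show False using prime p3 prime_nat_iff by auto
qed

lemma st_t_vals:
  "st t 0 = a" "st t (Suc 0) = inv\<^bsub>GS\<^esub> a" "st t (p - 1) = t"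
  "2 \<le> x \<Longrightarrow> x < p - 1 \<Longrightarrow> st t x = \<one>\<^bsub>GS\<^esub>"
proof -
  show "st t 0 = a" "st t (Suc 0) = inv\<^bsub>GS\<^esub> a" using p3 by (simp_all add: st_t)
  have "p - 1 \<noteq> 0" "p - 1 \<noteq> 1" "p - 1 < p" using p3 by linarith+
  then show "st t (p - 1) = t" using st_t[of "p - 1"] by (simp only: if_False if_True simp_thms)
  assume "2 \<le> x" "x < p - 1"
  then have "x \<noteq> 0" "x \<noteq> 1" "x \<noteq> p - 1" "x < p" by linarith+
  then show "st t x = \<one>\<^bsub>GS\<^esub>" using st_t[of x] by (simp only: if_False if_True simp_thms)
qed

lemma disjoint_support:
  assumes y: "0 < y" "y < p"
  shows "st t1t0 y = \<one>\<^bsub>GS\<^esub> \<or> st t2t1 y = \<one>\<^bsub>GS\<^esub>"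
proof -
  consider "y = 1" | "y = 2" | "3 \<le> y" "y < p - 1" | "y = p - 1" "3 \<le> y" using y by linarith
  then show ?thesis
  proof cases
    case 1
    then show ?thesis using st_t1t0[OF y(2)] st_t_vals by simp
  next
    case 2
    then show ?thesis using st_t2t1[OF y(2)] st_t_vals by simp
  next
    case 3
    then show ?thesis using st_t1t0[OF y(2)] st_t_vals(4)[of y] st_t_vals(4)[of "y - 1"] by simp
  next
    case 4
    then have "p \<ge> 5" using p_ne_4 by linarith
    then show ?thesis
      using 4 st_t2t1[OF y(2)] st_t_vals(4)[of "y - 2"] st_t_vals(4)[of "y - 1"] by simp
  qed
qed

text \<open>
  The elements of \<open>K\<close> that occur alone in the first coordinate; the aim is \<open>N = K\<close>.
\<close>

definition N where
  "N = {k \<in> K. \<exists>g\<in>carrier GS. rot g = 0 \<and> st g 0 = k \<and> (\<forall>i. 0 < i \<and> i < p \<longrightarrow> st g i = \<one>\<^bsub>GS\<^esub>)}"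

lemma onto: "g \<in> carrier GS \<Longrightarrow> \<exists>y\<in>carrier GS. rot y = 0 \<and> st y 0 = g"
proof (rule first_section_onto)
  show "\<exists>g\<in>carrier GS. rot g = 0 \<and> st g 0 = a"
    by (rule bexI[of _ t]) (simp_all add: st_t_vals)
  show "\<exists>y\<in>spine. st y (p - 1) = x" if x: "x \<in> spine" for x
    using x p3 st_t_vals(3) by (intro bexI[OF _ x]) (auto simp: spine_def st_t_pow)
qed

lemma N_normal: "N \<lhd> GS"
  unfolding normal_inv_iff
proof (intro conjI ballI)
  show "subgroup N GS"
  proof (rule subgroupI)
    show "N \<subseteq> carrier GS" by (auto simp: N_def K_def)
    have "\<one>\<^bsub>GS\<^esub> \<in> N"
      using subgroup.one_closed[OF K_subgroup] by (auto simp: N_def intro!: bexI[of _ "\<one>\<^bsub>GS\<^esub>"])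
    then show "N \<noteq> {}" by blast
    fix k assume "k \<in> N"
    then obtain g where k: "k \<in> K" and g: "g \<in> carrier GS" "rot g = 0" "st g 0 = k"
      "\<forall>i. 0 < i \<and> i < p \<longrightarrow> st g i = \<one>\<^bsub>GS\<^esub>" by (auto simp: N_def)
    show "inv\<^bsub>GS\<^esub> k \<in> N"
      unfolding N_def using subgroup.m_inv_closed[OF K_subgroup k] g
      by (auto simp: rot_inv st_inv0 intro!: bexI[of _ "inv\<^bsub>GS\<^esub> g"])
    fix l assume "l \<in> N"
    then obtain h where l: "l \<in> K" and h: "h \<in> carrier GS" "rot h = 0" "st h 0 = l"
      "\<forall>i. 0 < i \<and> i < p \<longrightarrow> st h i = \<one>\<^bsub>GS\<^esub>" by (auto simp: N_def)
    show "k \<otimes>\<^bsub>GS\<^esub> l \<in> N"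
      unfolding N_def using subgroup.m_closed[OF K_subgroup k l] g h
      by (auto simp: rot_mult st_mult0 intro!: bexI[of _ "g \<otimes>\<^bsub>GS\<^esub> h"])
  qed
  fix x k assume x: "x \<in> carrier GS" and "k \<in> N"
  then obtain g where k: "k \<in> K" and g: "g \<in> carrier GS" "rot g = 0" "st g 0 = k"
    "\<forall>i. 0 < i \<and> i < p \<longrightarrow> st g i = \<one>\<^bsub>GS\<^esub>" by (auto simp: N_def)
  obtain y where y: "y \<in> carrier GS" "rot y = 0" "st y 0 = x" using onto[OF x] by blast
  have st: "st (y \<otimes>\<^bsub>GS\<^esub> g \<otimes>\<^bsub>GS\<^esub> inv\<^bsub>GS\<^esub> y) i = st y i \<otimes>\<^bsub>GS\<^esub> st g i \<otimes>\<^bsub>GS\<^esub> inv\<^bsub>GS\<^esub> (st y i)" if "i < p" for i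
    using st_conj[OF g(1) y(1) g(2) that] y that by simp
  show "x \<otimes>\<^bsub>GS\<^esub> k \<otimes>\<^bsub>GS\<^esub> inv\<^bsub>GS\<^esub> x \<in> N"
    unfolding N_def using normal.inv_op_closed2[OF K_normal x k] g y
    by (auto simp: st rot_conj intro!: bexI[of _ "y \<otimes>\<^bsub>GS\<^esub> g \<otimes>\<^bsub>GS\<^esub> inv\<^bsub>GS\<^esub> y"])
qed

lemma commutator_N:
  "st t1t0 0 \<otimes>\<^bsub>GS\<^esub> st t2t1 0 \<otimes>\<^bsub>GS\<^esub> inv\<^bsub>GS\<^esub> (st t1t0 0) \<otimes>\<^bsub>GS\<^esub> inv\<^bsub>GS\<^esub> (st t2t1 0) \<in> N"
proof -
  let ?c = "t1t0 \<otimes>\<^bsub>GS\<^esub> t2t1 \<otimes>\<^bsub>GS\<^esub> inv\<^bsub>GS\<^esub> t1t0 \<otimes>\<^bsub>GS\<^esub> inv\<^bsub>GS\<^esub> t2t1"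
  have c: "?c \<in> carrier GS" "rot ?c = 0" using tt_closed by (simp_all add: rot_mult rot_inv)
  have st: "st ?c i = st t1t0 i \<otimes>\<^bsub>GS\<^esub> st t2t1 i \<otimes>\<^bsub>GS\<^esub> inv\<^bsub>GS\<^esub> (st t1t0 i) \<otimes>\<^bsub>GS\<^esub> inv\<^bsub>GS\<^esub> (st t2t1 i)" if "i < p" for i
    using tt_closed that by (simp add: st_mult0 st_inv0 rot_inv)
  have triv: "st ?c i = \<one>\<^bsub>GS\<^esub>" if "0 < i" "i < p" for i
    unfolding st[OF that(2)] using disjoint_support[OF that] tt_closed that by auto
  have K: "g \<otimes>\<^bsub>GS\<^esub> h \<otimes>\<^bsub>GS\<^esub> inv\<^bsub>GS\<^esub> g \<otimes>\<^bsub>GS\<^esub> inv\<^bsub>GS\<^esub> h \<in> K" if "g \<in> carrier GS" "h \<in> carrier GS" for g h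
  proof -
    have "inv\<^bsub>GS\<^esub> (h \<otimes>\<^bsub>GS\<^esub> g) \<otimes>\<^bsub>GS\<^esub> (g \<otimes>\<^bsub>GS\<^esub> h) \<in> K"
      by (rule K_quotient) (use that in \<open>simp_all add: rot_mult tau_GS add.commute\<close>)
    then have "(h \<otimes>\<^bsub>GS\<^esub> g) \<otimes>\<^bsub>GS\<^esub> (inv\<^bsub>GS\<^esub> (h \<otimes>\<^bsub>GS\<^esub> g) \<otimes>\<^bsub>GS\<^esub> (g \<otimes>\<^bsub>GS\<^esub> h)) \<otimes>\<^bsub>GS\<^esub> inv\<^bsub>GS\<^esub> (h \<otimes>\<^bsub>GS\<^esub> g) \<in> K"
      using that by (intro normal.inv_op_closed2[OF K_normal]) auto
    then show ?thesis using that by (simp add: cancel inv_mult_group m_assoc)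
  qed
  show ?thesis
    unfolding N_def using K[of "st t1t0 0" "st t2t1 0"] tt_closed c triv st[of 0]
    by (auto intro!: bexI[of _ ?c])
qed

text \<open>
  The commutator in \<open>N\<close> makes \<open>a\<close> and \<open>t\<close> commute modulo \<open>N\<close>. For \<open>p = 3\<close> it only shows that
  \<open>a\<close> and \<open>t\<^sup>2\<close> commute, which is the same as \<open>t\<^sup>4 = t\<close>.
\<close>

lemma generators_commute_mod_N:
  assumes \<pi>: "\<pi> = (\<lambda>x. N #>\<^bsub>GS\<^esub> x)" and Q: "Q = GS Mod N"
  shows "\<pi> a \<otimes>\<^bsub>Q\<^esub> \<pi> t = \<pi> t \<otimes>\<^bsub>Q\<^esub> \<pi> a"
proof -
  interpret N: normal N GS by (rule N_normal)
  interpret Q: group Q unfolding Q by (rule N.factorgroup_is_group)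
  have hom: "\<pi> \<in> hom GS Q" unfolding \<pi> Q by (rule N.r_coset_hom_Mod)
  interpret h: group_hom GS Q \<pi> using hom is_group Q.is_group by (simp add: group_hom_def group_hom_axioms_def)
  have c: "\<pi> a \<in> carrier Q" "\<pi> t \<in> carrier Q" by (simp_all add: h.hom_closed)
  define s where "s = (if p = 3 then inv\<^bsub>GS\<^esub> a else \<one>\<^bsub>GS\<^esub>)"
  have s3: "s = inv\<^bsub>GS\<^esub> a" if "p = 3" unfolding s_def if_P[OF that] by (rule refl)
  have s5: "s = \<one>\<^bsub>GS\<^esub>" if "p \<noteq> 3" unfolding s_def if_not_P[OF that] by (rule refl)
  have s: "s \<in> carrier GS"
  proof (cases "p = 3")
    case True
    show ?thesis unfolding s3[OF True] by simp
  next
    case False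
    show ?thesis unfolding s5[OF False] by simp
  qed
  have 0: "st t1t0 0 = t \<otimes>\<^bsub>GS\<^esub> a" using st_t1t0[of 0] st_t_vals by simp
  have "st t (p - 2) = s"
  proof (cases "p = 3")
    case True
    then have "p - 2 = Suc 0" by simp
    then show ?thesis unfolding s3[OF True] using st_t_vals(2) by (simp only:)
  next
    case False
    then show ?thesis unfolding s5[OF False] using p3 p_ne_4 by (intro st_t_vals(4)) linarith+
  qed
  then have 1: "st t2t1 0 = s \<otimes>\<^bsub>GS\<^esub> t" using st_t2t1[of 0] st_t_vals by simp
  let ?x = "t \<otimes>\<^bsub>GS\<^esub> a" and ?y = "s \<otimes>\<^bsub>GS\<^esub> t"
  have xy: "?x \<in> carrier GS" "?y \<in> carrier GS" using s by auto
  have "?x \<otimes>\<^bsub>GS\<^esub> ?y \<otimes>\<^bsub>GS\<^esub> inv\<^bsub>GS\<^esub> ?x \<otimes>\<^bsub>GS\<^esub> inv\<^bsub>GS\<^esub> ?y \<in> N" using commutator_N by (simp only: 0 1)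
  then have "\<pi> (?x \<otimes>\<^bsub>GS\<^esub> ?y \<otimes>\<^bsub>GS\<^esub> inv\<^bsub>GS\<^esub> ?x \<otimes>\<^bsub>GS\<^esub> inv\<^bsub>GS\<^esub> ?y) = \<one>\<^bsub>Q\<^esub>"
    unfolding \<pi> Q by (simp add: N.rcos_const)
  moreover have "\<pi> (?x \<otimes>\<^bsub>GS\<^esub> ?y \<otimes>\<^bsub>GS\<^esub> inv\<^bsub>GS\<^esub> ?x \<otimes>\<^bsub>GS\<^esub> inv\<^bsub>GS\<^esub> ?y)
      = \<pi> ?x \<otimes>\<^bsub>Q\<^esub> \<pi> ?y \<otimes>\<^bsub>Q\<^esub> inv\<^bsub>Q\<^esub> (\<pi> ?y \<otimes>\<^bsub>Q\<^esub> \<pi> ?x)"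
    using xy by (simp only: h.hom_mult h.hom_inv Q.inv_mult_group h.hom_closed Q.m_assoc
        m_closed inv_closed Q.m_closed Q.inv_closed)
  ultimately have "\<pi> ?x \<otimes>\<^bsub>Q\<^esub> \<pi> ?y = \<pi> ?y \<otimes>\<^bsub>Q\<^esub> \<pi> ?x"
    using xy Q.inv_solve_right'[of "\<one>\<^bsub>Q\<^esub>" "\<pi> ?x \<otimes>\<^bsub>Q\<^esub> \<pi> ?y" "\<pi> ?y \<otimes>\<^bsub>Q\<^esub> \<pi> ?x"] h.hom_closed by simp
  then have eq: "\<pi> (?x \<otimes>\<^bsub>GS\<^esub> ?y) = \<pi> (?y \<otimes>\<^bsub>GS\<^esub> ?x)" using xy by simp
  show ?thesis
  proof (cases "p = 3")
    case False
    then have "\<pi> t \<otimes>\<^bsub>Q\<^esub> (\<pi> a \<otimes>\<^bsub>Q\<^esub> \<pi> t) = \<pi> t \<otimes>\<^bsub>Q\<^esub> (\<pi> t \<otimes>\<^bsub>Q\<^esub> \<pi> a)"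
      using eq c s5[OF False] by (simp add: m_assoc)
    then show ?thesis using c by simp
  next
    case True
    have "?x \<otimes>\<^bsub>GS\<^esub> ?y = t \<otimes>\<^bsub>GS\<^esub> t" "?y \<otimes>\<^bsub>GS\<^esub> ?x = inv\<^bsub>GS\<^esub> a \<otimes>\<^bsub>GS\<^esub> (t \<otimes>\<^bsub>GS\<^esub> t \<otimes>\<^bsub>GS\<^esub> a)"
      unfolding s3[OF True] by (simp_all only: m_assoc cancel a_closed t_closed m_closed inv_closed)
    then have "\<pi> a \<otimes>\<^bsub>Q\<^esub> \<pi> (t \<otimes>\<^bsub>GS\<^esub> t) = \<pi> a \<otimes>\<^bsub>Q\<^esub> \<pi> (inv\<^bsub>GS\<^esub> a \<otimes>\<^bsub>GS\<^esub> (t \<otimes>\<^bsub>GS\<^esub> t \<otimes>\<^bsub>GS\<^esub> a))"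
      using eq by simp
    also have "\<dots> = \<pi> (a \<otimes>\<^bsub>GS\<^esub> (inv\<^bsub>GS\<^esub> a \<otimes>\<^bsub>GS\<^esub> (t \<otimes>\<^bsub>GS\<^esub> t \<otimes>\<^bsub>GS\<^esub> a)))"
      by (rule h.hom_mult[symmetric]) simp_all
    also have "\<dots> = \<pi> (t \<otimes>\<^bsub>GS\<^esub> t \<otimes>\<^bsub>GS\<^esub> a)" by (simp only: cancel a_closed t_closed m_closed)
    finally have "\<pi> a \<otimes>\<^bsub>Q\<^esub> \<pi> t [^]\<^bsub>Q\<^esub> (2::nat) = \<pi> t [^]\<^bsub>Q\<^esub> (2::nat) \<otimes>\<^bsub>Q\<^esub> \<pi> a"
      using c by (simp add: numeral_2_eq_2)
    then have "\<pi> a [^]\<^bsub>Q\<^esub> (1::nat) \<otimes>\<^bsub>Q\<^esub> (\<pi> t [^]\<^bsub>Q\<^esub> (2::nat)) [^]\<^bsub>Q\<^esub> (2::nat)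
        = (\<pi> t [^]\<^bsub>Q\<^esub> (2::nat)) [^]\<^bsub>Q\<^esub> (2::nat) \<otimes>\<^bsub>Q\<^esub> \<pi> a [^]\<^bsub>Q\<^esub> (1::nat)"
      using c by (intro Q.comm_pow) auto
    moreover have "(\<pi> t [^]\<^bsub>Q\<^esub> (2::nat)) [^]\<^bsub>Q\<^esub> (2::nat) = \<pi> (t [^]\<^bsub>GS\<^esub> (4::nat))"
      using c by (simp add: Q.nat_pow_pow h.hom_nat_pow)
    moreover have "t [^]\<^bsub>GS\<^esub> (4::nat) = t"
    proof -
      have 41: "4 mod p = (1::nat)" using True by simp
      have "t [^]\<^bsub>GS\<^esub> (4::nat) = t [^]\<^bsub>GS\<^esub> ((4::nat) mod p)" by (rule t_pow_mod[symmetric])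
      also have "\<dots> = t" unfolding 41 by simp
      finally show ?thesis .
    qed
    ultimately show ?thesis using c by simp
  qed
qed

text \<open>
  Modulo \<open>N\<close> the generators commute, so every element is \<open>a\<^sup>i t\<^sup>j\<close> modulo \<open>N\<close>; for an element of \<open>K\<close> the
  two homomorphisms force both exponents to vanish.
\<close>

lemma K_sub_N: "K \<subseteq> N"
proof
  fix k assume k: "k \<in> K"
  interpret N: normal N GS by (rule N_normal)
  define Q where "Q = GS Mod N"
  define \<pi> where "\<pi> = (\<lambda>x. N #>\<^bsub>GS\<^esub> x)"
  interpret Q: group Q unfolding Q_def by (rule N.factorgroup_is_group)
  have hom: "\<pi> \<in> hom GS Q" unfolding \<pi>_def Q_def by (rule N.r_coset_hom_Mod)
  interpret h: group_hom GS Q \<pi> using hom is_group Q.is_group by (simp add: group_hom_def group_hom_axioms_def)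
  define A where "A = \<pi> a"
  define T where "T = \<pi> t"
  have c: "A \<in> carrier Q" "T \<in> carrier Q" by (simp_all add: A_def T_def h.hom_closed)
  have com: "A [^]\<^bsub>Q\<^esub> (i::nat) \<otimes>\<^bsub>Q\<^esub> T [^]\<^bsub>Q\<^esub> (j::nat) = T [^]\<^bsub>Q\<^esub> j \<otimes>\<^bsub>Q\<^esub> A [^]\<^bsub>Q\<^esub> i" for i j
    using generators_commute_mod_N[OF \<pi>_def Q_def] c by (intro Q.comm_pow) (simp_all add: A_def T_def)
  have mult: "(A [^]\<^bsub>Q\<^esub> (i::nat) \<otimes>\<^bsub>Q\<^esub> T [^]\<^bsub>Q\<^esub> (j::nat)) \<otimes>\<^bsub>Q\<^esub> (A [^]\<^bsub>Q\<^esub> (k::nat) \<otimes>\<^bsub>Q\<^esub> T [^]\<^bsub>Q\<^esub> (l::nat))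
      = A [^]\<^bsub>Q\<^esub> (i + k) \<otimes>\<^bsub>Q\<^esub> T [^]\<^bsub>Q\<^esub> (j + l)" for i j k l
  proof -
    have "(A [^]\<^bsub>Q\<^esub> i \<otimes>\<^bsub>Q\<^esub> T [^]\<^bsub>Q\<^esub> j) \<otimes>\<^bsub>Q\<^esub> (A [^]\<^bsub>Q\<^esub> k \<otimes>\<^bsub>Q\<^esub> T [^]\<^bsub>Q\<^esub> l)
      = A [^]\<^bsub>Q\<^esub> i \<otimes>\<^bsub>Q\<^esub> (T [^]\<^bsub>Q\<^esub> j \<otimes>\<^bsub>Q\<^esub> A [^]\<^bsub>Q\<^esub> k) \<otimes>\<^bsub>Q\<^esub> T [^]\<^bsub>Q\<^esub> l" using c by (simp add: Q.m_assoc)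
    also have "\<dots> = (A [^]\<^bsub>Q\<^esub> i \<otimes>\<^bsub>Q\<^esub> A [^]\<^bsub>Q\<^esub> k) \<otimes>\<^bsub>Q\<^esub> (T [^]\<^bsub>Q\<^esub> j \<otimes>\<^bsub>Q\<^esub> T [^]\<^bsub>Q\<^esub> l)"
      unfolding com[symmetric] using c by (simp add: Q.m_assoc)
    finally show ?thesis using c by (simp add: Q.nat_pow_mult)
  qed
  have Tp: "A [^]\<^bsub>Q\<^esub> (p * i) \<otimes>\<^bsub>Q\<^esub> T [^]\<^bsub>Q\<^esub> (p * j) = \<one>\<^bsub>Q\<^esub>" for i j
  proof -
    have "A [^]\<^bsub>Q\<^esub> (p * i) = \<pi> (a [^]\<^bsub>GS\<^esub> (p * i))" by (simp add: A_def h.hom_nat_pow)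
    also have "a [^]\<^bsub>GS\<^esub> (p * i) = \<one>\<^bsub>GS\<^esub>" using a_pow_mod[of "p * i"] by simp
    also have "\<pi> \<one>\<^bsub>GS\<^esub> = \<one>\<^bsub>Q\<^esub>" by (rule h.hom_one)
    finally have 1: "A [^]\<^bsub>Q\<^esub> (p * i) = \<one>\<^bsub>Q\<^esub>" .
    have "T [^]\<^bsub>Q\<^esub> (p * j) = \<pi> (t [^]\<^bsub>GS\<^esub> (p * j))" by (simp add: T_def h.hom_nat_pow)
    also have "t [^]\<^bsub>GS\<^esub> (p * j) = \<one>\<^bsub>GS\<^esub>" using t_pow_mod[of "p * j"] by simp
    also have "\<pi> \<one>\<^bsub>GS\<^esub> = \<one>\<^bsub>Q\<^esub>" by (rule h.hom_one)
    finally show ?thesis using 1 by simp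
  qed
  let ?D = "{g \<in> carrier GS. \<exists>(i::nat) (j::nat). \<pi> g = A [^]\<^bsub>Q\<^esub> i \<otimes>\<^bsub>Q\<^esub> T [^]\<^bsub>Q\<^esub> j}"
  have "?D = carrier GS"
  proof (rule generated)
    show "subgroup ?D GS"
    proof (rule subgroupI)
      have "\<one>\<^bsub>GS\<^esub> \<in> ?D" using Tp[of 0 0] by (auto intro!: exI[of _ 0])
      then show "?D \<noteq> {}" by blast
    next
      fix g assume "g \<in> ?D"
      then obtain i j :: nat where g: "g \<in> carrier GS" "\<pi> g = A [^]\<^bsub>Q\<^esub> i \<otimes>\<^bsub>Q\<^esub> T [^]\<^bsub>Q\<^esub> j" by blast
      have pe: "(p - 1) * i + i = p * i" for i using p3 by (cases p) auto
      have "inv\<^bsub>Q\<^esub> (\<pi> g) = A [^]\<^bsub>Q\<^esub> ((p - 1) * i) \<otimes>\<^bsub>Q\<^esub> T [^]\<^bsub>Q\<^esub> ((p - 1) * j)"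
        unfolding g(2) by (rule Q.inv_equality) (use c mult Tp pe in simp_all)
      then show "inv\<^bsub>GS\<^esub> g \<in> ?D" using g by (auto simp: h.hom_inv)
    next
      fix g h assume "g \<in> ?D" "h \<in> ?D"
      then obtain i j k l :: nat where g: "g \<in> carrier GS" "\<pi> g = A [^]\<^bsub>Q\<^esub> i \<otimes>\<^bsub>Q\<^esub> T [^]\<^bsub>Q\<^esub> j"
        and h: "h \<in> carrier GS" "\<pi> h = A [^]\<^bsub>Q\<^esub> k \<otimes>\<^bsub>Q\<^esub> T [^]\<^bsub>Q\<^esub> l" by blast
      then show "g \<otimes>\<^bsub>GS\<^esub> h \<in> ?D" using mult by auto
    qed auto
    have "\<pi> a = A [^]\<^bsub>Q\<^esub> (1::nat) \<otimes>\<^bsub>Q\<^esub> T [^]\<^bsub>Q\<^esub> (0::nat)" using c by (simp add: A_def[symmetric])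
    then show "a \<in> ?D" using a_closed by blast
    show "spine \<subseteq> ?D"
    proof
      fix x assume "x \<in> spine"
      then obtain e :: nat where e: "x = t [^]\<^bsub>GS\<^esub> e" by (auto simp: spine_def)
      then have "\<pi> x = A [^]\<^bsub>Q\<^esub> (0::nat) \<otimes>\<^bsub>Q\<^esub> T [^]\<^bsub>Q\<^esub> e" using c by (simp add: T_def h.hom_nat_pow)
      moreover have "x \<in> carrier GS" using e by simp
      ultimately show "x \<in> ?D" by blast
    qed
  qed
  then have D: "\<And>g. g \<in> carrier GS \<Longrightarrow> g \<in> ?D" by (simp only:)
  have kG: "k \<in> carrier GS" using k by (simp add: K_def)
  obtain i j :: nat where ij: "\<pi> k = A [^]\<^bsub>Q\<^esub> i \<otimes>\<^bsub>Q\<^esub> T [^]\<^bsub>Q\<^esub> j" using D[OF kG] by blast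
  define w where "w = a [^]\<^bsub>GS\<^esub> i \<otimes>\<^bsub>GS\<^esub> t [^]\<^bsub>GS\<^esub> j"
  have wG: "w \<in> carrier GS" by (simp add: w_def)
  have "\<pi> w = \<pi> (a [^]\<^bsub>GS\<^esub> i) \<otimes>\<^bsub>Q\<^esub> \<pi> (t [^]\<^bsub>GS\<^esub> j)"
    unfolding w_def by (rule h.hom_mult) simp_all
  also have "\<dots> = A [^]\<^bsub>Q\<^esub> i \<otimes>\<^bsub>Q\<^esub> T [^]\<^bsub>Q\<^esub> j"
    unfolding A_def T_def by (simp only: h.hom_nat_pow a_closed t_closed)
  finally have w: "w \<in> carrier GS" "\<pi> k = \<pi> w" using ij wG by simp_all
  have n: "inv\<^bsub>GS\<^esub> w \<otimes>\<^bsub>GS\<^esub> k \<in> N"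
    using w(2) unfolding \<pi>_def by (rule N.rcos_eq_iff[OF kG w(1), THEN iffD1])
  then have wk: "inv\<^bsub>GS\<^esub> w \<otimes>\<^bsub>GS\<^esub> k \<in> K" unfolding N_def by blast
  have "k \<otimes>\<^bsub>GS\<^esub> inv\<^bsub>GS\<^esub> (inv\<^bsub>GS\<^esub> w \<otimes>\<^bsub>GS\<^esub> k) \<in> K"
    by (rule subgroup.m_closed[OF K_subgroup k subgroup.m_inv_closed[OF K_subgroup wk]])
  then have wK: "w \<in> K" using kG wG by (simp add: inv_mult_group cancel)
  then have w0: "rot w = 0" "tau w = 0" by (simp_all add: K_def)
  then have "i mod p = 0" by (simp add: w_def rot_mult rot_pow)
  then have ai: "a [^]\<^bsub>GS\<^esub> i = \<one>\<^bsub>GS\<^esub>" using a_pow_mod[of i] by simp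
  then have "int j mod int p = 0" using w0(2) by (simp add: w_def tau_pow tau_t)
  then have "j mod p = 0" by (simp add: zmod_int[symmetric])
  then have "t [^]\<^bsub>GS\<^esub> j = \<one>\<^bsub>GS\<^esub>" using t_pow_mod[of j] by simp
  then show "k \<in> N" using n ai kG by (simp add: w_def)
qed

lemma K_first:
  assumes "k \<in> K"
  shows "\<exists>g\<in>K. st g 0 = k \<and> (\<forall>i. 0 < i \<and> i < p \<longrightarrow> st g i = \<one>\<^bsub>GS\<^esub>)"
proof -
  obtain g where g: "g \<in> carrier GS" "rot g = 0" "st g 0 = k" "\<forall>i. 0 < i \<and> i < p \<longrightarrow> st g i = \<one>\<^bsub>GS\<^esub>"
    using K_sub_N assms by (auto simp: N_def)
  have "rot (st g i) = 0" if "i < p" for i using g that assms by (cases "i = 0") (auto simp: K_def)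
  then have "tau g = 0" by (simp add: tau_def)
  then show ?thesis using g by (auto simp: K_def)
qed

end

sublocale gupta_sidki \<subseteq> spinal_branch_group p "gupta_sidki_group p" spine K 1
proof (rule spinal_branch_group.intro[OF spinal_group_axioms],
    rule branch_group.intro[OF rot_group_axioms], rule branch_group_axioms.intro)
  show rot0: "rot k = 0" if "k \<in> K" for k using that by (simp add: K_def)
  show "\<exists>k\<in>K. \<forall>i<p. sec p k i = f i" if "\<And>i. i < p \<Longrightarrow> f i \<in> K" for f
    by (rule branch_tuple[OF K_normal rot0 K_first that])
qed (use prime K_normal K_exponent K_finite in auto)

context gupta_sidki
begin

text \<open>
  Powers of \<open>t\<close> with different exponents are separated by \<open>tau\<close>. An element that commutes with
  \<open>u = t\<^sup>e \<noteq> 1\<close> modulo \<open>R 1\<close> preserves the pattern \<open>e, -e, 0, \<dots>, 0\<close> of rotations of the sections of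
  \<open>u\<close>; this pattern has no rotational symmetry as \<open>p\<close> is odd. So it fixes the first level and lies in
  some coset \<open>t\<^sup>s K\<close>, whose representative \<open>t\<^sup>s\<close> commutes with \<open>u\<close>.
\<close>

lemma detected_t: "detected (t [^]\<^bsub>GS\<^esub> (e::nat)) (t [^]\<^bsub>GS\<^esub> (f::nat))"
proof (cases "e mod p = f mod p")
  case False
  have "approx (t [^]\<^bsub>GS\<^esub> e) (t [^]\<^bsub>GS\<^esub> f) 0"
    unfolding approx_def
  proof (intro ballI impI)
    fix g assume g: "g \<in> carrier GS" and "\<exists>r\<in>R 0. t [^]\<^bsub>GS\<^esub> e \<otimes>\<^bsub>GS\<^esub> g = g \<otimes>\<^bsub>GS\<^esub> t [^]\<^bsub>GS\<^esub> f \<otimes>\<^bsub>GS\<^esub> r"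
    then obtain r where "r \<in> R 0" and r3: "t [^]\<^bsub>GS\<^esub> e \<otimes>\<^bsub>GS\<^esub> g = g \<otimes>\<^bsub>GS\<^esub> t [^]\<^bsub>GS\<^esub> f \<otimes>\<^bsub>GS\<^esub> r"
      by blast
    then have "r \<in> K" by simp
    then have r: "r \<in> carrier GS" "tau r = 0" by (simp_all add: K_def)
    have "tau (t [^]\<^bsub>GS\<^esub> e \<otimes>\<^bsub>GS\<^esub> g) = tau (g \<otimes>\<^bsub>GS\<^esub> t [^]\<^bsub>GS\<^esub> f \<otimes>\<^bsub>GS\<^esub> r)" by (simp only: r3)
    then have "(int e + tau g) mod int p = (int f + tau g) mod int p"
      using g r(1,2) by (simp add: tau_GS tau_pow tau_t mod_simps add.commute)
    then have "int p dvd int e - int f" by (simp add: mod_eq_dvd_iff)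
    then have "int (e mod p) = int (f mod p)" by (simp add: mod_eq_dvd_iff[symmetric] zmod_int)
    then show "\<exists>k\<in>K. t [^]\<^bsub>GS\<^esub> e \<otimes>\<^bsub>GS\<^esub> (g \<otimes>\<^bsub>GS\<^esub> k) = g \<otimes>\<^bsub>GS\<^esub> k \<otimes>\<^bsub>GS\<^esub> t [^]\<^bsub>GS\<^esub> f" using False by simp
  qed
  then show ?thesis by (auto simp: detected_def)
next
  case True
  then have eq: "t [^]\<^bsub>GS\<^esub> f = t [^]\<^bsub>GS\<^esub> e" using t_pow_mod by metis
  show ?thesis
  proof (cases "e mod p = 0")
    case True
    then have "t [^]\<^bsub>GS\<^esub> e = \<one>\<^bsub>GS\<^esub>" using t_pow_mod[of e] by simp
    then show ?thesis using eq detected_one by simp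
  next
    case False
    define u where "u = t [^]\<^bsub>GS\<^esub> e"
    have u: "u \<in> carrier GS" "rot u = 0" by (simp_all add: u_def rot_pow)
    have rs: "rot (st u x) = (e * (if x = 0 then 1 else if x = 1 then p - 1 else 0)) mod p" if "x < p" for x
      using that by (simp add: u_def st_t_pow rot_pow rot_st_t)
    have "approx u u 1"
      unfolding approx_def
    proof (intro ballI impI)
      fix g assume g: "g \<in> carrier GS" and "\<exists>r\<in>R 1. u \<otimes>\<^bsub>GS\<^esub> g = g \<otimes>\<^bsub>GS\<^esub> u \<otimes>\<^bsub>GS\<^esub> r"
      then obtain r where r: "r \<in> R 1" "u \<otimes>\<^bsub>GS\<^esub> g = g \<otimes>\<^bsub>GS\<^esub> u \<otimes>\<^bsub>GS\<^esub> r" by blast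
      then have rG: "r \<in> carrier GS" "rot r = 0" "st r 0 \<in> carrier GS" and "st r 0 \<in> K"
        by auto
      then have r0: "rot (st r 0) = 0" using K_rot by blast
      define j where "j = rot g"
      have j: "j < p" using g by (simp add: j_def)
      have "st (u \<otimes>\<^bsub>GS\<^esub> g) 0 = st (g \<otimes>\<^bsub>GS\<^esub> u \<otimes>\<^bsub>GS\<^esub> r) 0" by (simp only: r(2))
      then have "st u j \<otimes>\<^bsub>GS\<^esub> st g 0 = st g 0 \<otimes>\<^bsub>GS\<^esub> st u 0 \<otimes>\<^bsub>GS\<^esub> st r 0"
        using g u rG by (simp add: st_mult rot_mult j_def)
      then have "rot (st u j \<otimes>\<^bsub>GS\<^esub> st g 0) = rot (st g 0 \<otimes>\<^bsub>GS\<^esub> st u 0 \<otimes>\<^bsub>GS\<^esub> st r 0)" by simp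
      then have "(rot (st u j) + rot (st g 0)) mod p = (rot (st u 0) + rot (st g 0)) mod p"
        using g u rG r0 j by (simp add: rot_mult add.commute)
      then have "rot (st u j) = rot (st u 0)"
        by (rule add_mod_cancel) (use u j in auto)
      then have ej: "(e * (if j = 0 then 1 else if j = 1 then p - 1 else 0)) mod p = e mod p"
        using rs[OF j] rs[of 0] by simp
      have "j = 0"
      proof (rule ccontr)
        assume "j \<noteq> 0"
        then have "j = 1" using ej False by (cases "j = 1") auto
        then have "(e * (p - 1)) mod p = e mod p" using ej by simp
        then have "(e * (p - 1) + e) mod p = (e + e) mod p" by (metis mod_add_left_eq)
        moreover have "e * (p - 1) + e = e * p" using p3 by (cases p) auto
        ultimately have "p dvd 2 * e" by (simp add: mod_eq_0_iff_dvd mult_2)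
        then have "p dvd 2 \<or> p dvd e" using prime by (simp add: prime_dvd_mult_iff)
        moreover have "\<not> p dvd 2" using p3 dvd_imp_le[of p 2] by auto
        ultimately show False using False by (simp add: mod_eq_0_iff_dvd)
      qed
      then have g0: "rot g = 0" by (simp add: j_def)
      define s where "s = nat (tau g)"
      have s: "int s = tau g" using p3 by (simp add: s_def tau_def)
      have "inv\<^bsub>GS\<^esub> g \<otimes>\<^bsub>GS\<^esub> t [^]\<^bsub>GS\<^esub> s \<in> K"
        by (rule K_quotient) (use g g0 s in \<open>simp_all add: rot_pow tau_pow tau_t\<close>)
      moreover have "u \<otimes>\<^bsub>GS\<^esub> (g \<otimes>\<^bsub>GS\<^esub> (inv\<^bsub>GS\<^esub> g \<otimes>\<^bsub>GS\<^esub> t [^]\<^bsub>GS\<^esub> s))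
          = g \<otimes>\<^bsub>GS\<^esub> (inv\<^bsub>GS\<^esub> g \<otimes>\<^bsub>GS\<^esub> t [^]\<^bsub>GS\<^esub> s) \<otimes>\<^bsub>GS\<^esub> u"
        using g by (simp add: cancel u_def nat_pow_mult add.commute)
      ultimately show "\<exists>k\<in>K. u \<otimes>\<^bsub>GS\<^esub> (g \<otimes>\<^bsub>GS\<^esub> k) = g \<otimes>\<^bsub>GS\<^esub> k \<otimes>\<^bsub>GS\<^esub> u" by blast
    qed
    then show ?thesis unfolding eq by (auto simp: detected_def u_def)
  qed
qed

text \<open>
  The summand \<open>1\<close> pays for the step from \<open>u\<close> to a section of \<open>u\<^sup>p\<close>: this may keep the length, but the
  result fixes the first level, as its rotation is \<open>tot u = 0\<close>.
\<close>

definition \<mu> where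
  "\<mu> u = (if short u then 0 else 2 * len u + (if rot u = 0 then 0 else 1))"

end

sublocale gupta_sidki \<subseteq> contracting_branch_group p "gupta_sidki_group p" K 1 \<mu>
proof (rule contracting_branch_group.intro[OF branch_group_axioms], rule contracting_branch_group_axioms.intro)
  fix u i assume u: "u \<in> carrier GS" and i: "i < p"
  show "\<mu> (sec p u i) \<le> \<mu> u - 1" if rot: "rot u = 0"
  proof (cases "short u")
    case True
    then show ?thesis using short_section[OF u rot True i] by (simp add: \<mu>_def)
  next
    case False
    then have "len u \<ge> 2" using rot by (simp add: short_def)
    then show ?thesis using len_section_stab[OF u rot _ i] False rot by (auto simp: \<mu>_def)
  qed
  show "\<mu> (sec p (u [^]\<^bsub>GS\<^esub> p) i) \<le> \<mu> u - 1" if rot: "rot u \<noteq> 0"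
  proof (cases "short u")
    case True
    then show ?thesis using short_section_pow[OF u rot True i] by (simp add: \<mu>_def)
  next
    case False
    have "rot (st (u [^]\<^bsub>GS\<^esub> p) i) = 0"
      using rot_section_pow_p[OF u i coprime_rot[OF u rot]] tot_GS[OF u] by simp
    then show ?thesis using short_descent_rot[OF u rot i] False rot by (simp add: \<mu>_def)
  qed
next
  fix u assume u: "u \<in> carrier GS" "\<mu> u = 0"
  then have su: "short u" by (auto simp: \<mu>_def short_def split: if_splits)
  have "x [^]\<^bsub>GS\<^esub> p = \<one>\<^bsub>GS\<^esub>" if "x \<in> spine" for x
    using that t_pow_mod[of "p * e" for e] by (auto simp: spine_def nat_pow_pow mult.commute)
  then show "\<exists>n>0. u [^]\<^bsub>GS\<^esub> (n::nat) = \<one>\<^bsub>GS\<^esub>" by (rule short_torsion[OF u(1) su])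
  fix v assume v: "v \<in> carrier GS" "\<mu> v = 0"
  then have sv: "short v" by (auto simp: \<mu>_def short_def split: if_splits)
  show "detected u v"
    by (rule detected_short[OF _ u(1) su v(1) sv]) (auto simp: spine_def detected_t)
qed



section \<open>Letters of minimal words\<close>

context spinal_group
begin

lemma wd_ConsD: "wd (x # xs) u \<Longrightarrow> \<exists>(k::nat) v. u = a [^] k \<otimes> x \<otimes> v \<and> wd xs v \<and> x \<in> B"
  by (erule wd.cases) blast+

lemma wd_split: "wd (xs @ ys) u \<Longrightarrow> \<exists>v w. wd xs v \<and> wd ys w \<and> u = v \<otimes> w"
proof (induction xs arbitrary: u)
  case Nil
  then show ?case using wd_one wd_closed by (intro exI[of _ \<one>] exI[of _ u]) auto
next
  case (Cons x xs)
  obtain k u' where u: "u = a [^] (k::nat) \<otimes> x \<otimes> u'" "wd (xs @ ys) u'" "x \<in> B"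
    using wd_ConsD[of x "xs @ ys" u] Cons.prems by auto
  obtain v w where vw: "wd xs v" "wd ys w" "u' = v \<otimes> w" using Cons.IH[OF u(2)] by blast
  have "u = (a [^] k \<otimes> x \<otimes> v) \<otimes> w" using u vw wd_closed by (simp add: m_assoc)
  then show ?case using wd_Cons[OF vw(1) u(3), of k] vw(2) by blast
qed

lemma rep_rotate: "rep (xs @ ys) u \<Longrightarrow> rep (ys @ xs) u"
proof -
  assume "rep (xs @ ys) u"
  then obtain w x where w: "wd (xs @ ys) w" "x \<in> carrier G" "u = x \<otimes> w \<otimes> inv x" by (auto simp: rep_def)
  obtain v v' where "wd xs v" "wd ys v'" "w = v \<otimes> v'" using wd_split[OF w(1)] by blast
  then have "rep (ys @ xs) w" using rep_mult_comm by simp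
  then show ?thesis unfolding w(3) by (rule rep_conj[OF _ w(2)])
qed

lemma rep_drop_one: "rep (\<one> # xs) u \<Longrightarrow> rep xs u"
proof -
  assume "rep (\<one> # xs) u"
  then obtain w x where w: "wd (\<one> # xs) w" "x \<in> carrier G" "u = x \<otimes> w \<otimes> inv x"
    unfolding rep_def by blast
  obtain k w' where w': "w = a [^] (k::nat) \<otimes> \<one> \<otimes> w'" "wd xs w'" using wd_ConsD[OF w(1)] by blast
  have "wd xs w" using wd_a[OF w'(2), of k] unfolding w'(1) by simp
  then have "rep xs w" by (rule wd_rep)
  then have "rep xs (x \<otimes> w \<otimes> inv x)" by (rule rep_conj[OF _ w(2)])
  then show ?thesis by (simp only: w(3))
qed

lemma minimal_ne_one:
  assumes "rep xs u" "length xs = len u" "x \<in> set xs"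
  shows "x \<noteq> \<one>"
proof
  assume "x = \<one>"
  then obtain l1 l2 where xs: "xs = l1 @ \<one> # l2" using assms(3) by (auto dest: split_list)
  then have "rep (\<one> # l2 @ l1) u" using rep_rotate[of l1 "\<one> # l2" u] assms(1) by simp
  then have "rep (l2 @ l1) u" by (rule rep_drop_one)
  then have "len u \<le> length (l2 @ l1)" by (rule len_le)
  then show False using xs assms(2) by simp
qed

lemma rep_letters: "rep xs u \<Longrightarrow> set xs \<subseteq> B"
proof -
  have "wd xs w \<Longrightarrow> set xs \<subseteq> B" for w by (induction rule: wd.induct) auto
  then show "rep xs u \<Longrightarrow> set xs \<subseteq> B" by (auto simp: rep_def)
qed

end

section \<open>Grigorchuk's group\<close>

locale grigorchuk
begin

abbreviation (input) GG where "GG \<equiv> grigorchuk_group"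
abbreviation b where "b \<equiv> grig_b"
abbreviation c where "c \<equiv> grig_c"
abbreviation d where "d \<equiv> grig_d"

lemma grig_in: "grig_a \<in> tree_aut 2" "b \<in> tree_aut 2" "c \<in> tree_aut 2" "d \<in> tree_aut 2"
  using grig_generators by (auto simp: carrier_tree_aut_group)

lemma grig_incl: "grig_a \<in> carrier GG" "b \<in> carrier GG" "c \<in> carrier GG" "d \<in> carrier GG"
  using grig_in by (auto simp: grigorchuk_group_def carrier_subgroup_generated carrier_tree_aut_group
      intro: generate.incl)

lemma ext_tree2: "f \<in> tree_aut 2 \<Longrightarrow> f \<in> extensional (regular_tree 2)"
  by (auto simp: tree_aut_def Bij_def)

lemma sec_pair:
  assumes "f = level_tuple 2 [g, h]" "g \<in> tree_aut 2" "h \<in> tree_aut 2"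
  shows "sec 2 f 0 = g" "sec 2 f (Suc 0) = h" "x < 2 \<Longrightarrow> f [x] = [x]"
proof -
  show "sec 2 f 0 = g" "sec 2 f (Suc 0) = h"
    using sec_level_tuple[of 0 2 "[g, h]"] sec_level_tuple[of "Suc 0" 2 "[g, h]"] assms ext_tree2 by simp_all
  show "x < 2 \<Longrightarrow> f [x] = [x]"
    using assms tree_aut_props(4)[of g 2 "[]"] tree_aut_props(4)[of h 2 "[]"]
    by (cases x) (auto simp: level_tuple_def)
qed

lemmas sec_b = sec_pair[OF grig_equations(1) grig_in(1,3)]
lemmas sec_c = sec_pair[OF grig_equations(2) grig_in(1,4)]
lemmas sec_d = sec_pair[OF grig_equations(3) one_in_tree_aut grig_in(2)]

lemma less2: "(x::nat) < 2 \<longleftrightarrow> x = 0 \<or> x = Suc 0"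
  by auto

lemma rot_group_GG: "rot_group 2 GG"
  unfolding grigorchuk_group_def
proof (rule rot_group_subgroup_generated)
  let ?S = "{grig_a, b, c, d}"
  fix s x assume s: "s \<in> ?S"
  show "\<exists>k. \<forall>x<2. s [x] = [(x + k) mod 2]"
  proof (cases "s = grig_a")
    case True
    then show ?thesis by (intro exI[of _ 1]) (simp add: grig_a_def rooted_cycle_def)
  next
    case False
    then show ?thesis using s sec_b(3) sec_c(3) sec_d(3) by (intro exI[of _ 0]) auto
  qed
  assume x: "x < (2::nat)"
  have "sec 2 grig_a x = \<one>\<^bsub>tree_aut_group 2\<^esub>"
    using x by (auto simp: grig_a_def sec_def rooted_cycle_def one_tree_aut_group fun_eq_iff restrict_def)
  then show "sec 2 s x \<in> generate (tree_aut_group 2) ?S"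
    using s x sec_b sec_c sec_d unfolding less2 by (auto intro: generate.intros)
qed (use grig_in in auto)

end

sublocale grigorchuk \<subseteq> rooted_group 2 grigorchuk_group
  using rot_group_GG grig_incl by (simp add: rooted_group_def rooted_group_axioms_def grig_a_def)

context grigorchuk
begin

lemma bcd_closed[simp]: "b \<in> carrier GG" "c \<in> carrier GG" "d \<in> carrier GG" by (rule grig_incl)+

lemma one_GG: "\<one>\<^bsub>GG\<^esub> = \<one>\<^bsub>tree_aut_group 2\<^esub>" by (simp add: grigorchuk_group_def)

lemma st_bcd[simp]: "st b 0 = a" "st b (Suc 0) = c" "st c 0 = a" "st c (Suc 0) = d"
  "st d 0 = \<one>\<^bsub>GG\<^esub>" "st d (Suc 0) = b"
  using sec_b sec_c sec_d by (simp_all add: grig_a_def one_GG)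

lemma rot_bcd[simp]: "rot b = 0" "rot c = 0" "rot d = 0"
  using sec_b(3)[of 0] sec_c(3)[of 0] sec_d(3)[of 0] by (simp_all add: rot_def)

lemma aa[simp]: "a \<otimes>\<^bsub>GG\<^esub> a = \<one>\<^bsub>GG\<^esub>"
  by (rule st_rot_eqI) (simp_all add: rot_mult st_mult)

lemma a_inv[simp]: "inv\<^bsub>GG\<^esub> a = a"
  by (rule inv_equality) simp_all

lemma aa_app: "w \<in> regular_tree 2 \<Longrightarrow> a (a w) = w"
  using app_mult[OF a_closed a_closed, of w] by (simp add: one_eq)

lemma bcd_app:
  assumes "w \<in> regular_tree 2"
  shows "b (b w) = w \<and> c (c w) = w \<and> d (d w) = w \<and> b (c w) = d w \<and> c (d w) = b w \<and> d (b w) = c w"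
  using assms
proof (induction w)
  case Nil
  then show ?case by (simp add: app_Nil)
next
  case (Cons x w)
  then have x: "x = 0 \<or> x = Suc 0" and w: "w \<in> regular_tree 2" by auto
  show ?case using x Cons.IH[OF w] w app_closed
    by (auto simp: app_Cons aa_app one_eq)
qed

lemma one_app: "w \<in> regular_tree 2 \<Longrightarrow> \<one>\<^bsub>GG\<^esub> w = w"
  by (simp add: one_eq)

lemma bcd_table[simp]:
  "b \<otimes>\<^bsub>GG\<^esub> b = \<one>\<^bsub>GG\<^esub>" "c \<otimes>\<^bsub>GG\<^esub> c = \<one>\<^bsub>GG\<^esub>" "d \<otimes>\<^bsub>GG\<^esub> d = \<one>\<^bsub>GG\<^esub>"
  "b \<otimes>\<^bsub>GG\<^esub> c = d" "c \<otimes>\<^bsub>GG\<^esub> d = b" "d \<otimes>\<^bsub>GG\<^esub> b = c"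
  by (rule app_eqI; simp add: app_mult bcd_app one_app)+

lemma bcd_inv[simp]: "inv\<^bsub>GG\<^esub> b = b" "inv\<^bsub>GG\<^esub> c = c" "inv\<^bsub>GG\<^esub> d = d"
  by (rule inv_equality; simp)+

lemma bcd_table'[simp]: "c \<otimes>\<^bsub>GG\<^esub> b = d" "d \<otimes>\<^bsub>GG\<^esub> c = b" "b \<otimes>\<^bsub>GG\<^esub> d = c"
proof -
  show "c \<otimes>\<^bsub>GG\<^esub> b = d" using inv_mult_group[of b c] by simp
  show "d \<otimes>\<^bsub>GG\<^esub> c = b" using inv_mult_group[of c d] by simp
  show "b \<otimes>\<^bsub>GG\<^esub> d = c" using inv_mult_group[of d b] by simp
qed

definition klein where "klein = {\<one>\<^bsub>GG\<^esub>, b, c, d}"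

end

sublocale grigorchuk \<subseteq> spinal_group 2 grigorchuk_group klein
proof (rule spinal_group.intro[OF rooted_group_axioms], rule spinal_group_axioms.intro)
  show "Factorial_Ring.prime (2::nat)" by simp
  show "subgroup klein GG" by (rule subgroupI) (auto simp: klein_def)
  show "rot x = 0" if "x \<in> klein" for x using that by (auto simp: klein_def)
  show "sec 2 x (2 - 1) \<in> klein" if "x \<in> klein" for x
    using that by (auto simp: klein_def)
  show "\<exists>k::nat. sec 2 x i = a [^]\<^bsub>GG\<^esub> k" if x: "x \<in> klein" "i < 2 - 1" for x i
  proof -
    have "sec 2 x i = a [^]\<^bsub>GG\<^esub> (0::nat) \<or> sec 2 x i = a [^]\<^bsub>GG\<^esub> (1::nat)"
      using x by (auto simp: klein_def)
    then show ?thesis by blast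
  qed
  fix H assume H: "subgroup H GG" "a \<in> H" "klein \<subseteq> H"
  interpret T: group "tree_aut_group 2" by (rule group_tree_aut_group)
  show "H = carrier GG"
    using H grig_in T.subgroup_generated_eqI[of H "{grig_a, b, c, d}"]
    by (simp add: grigorchuk_group_def carrier_tree_aut_group grig_a_def klein_def)
qed

context grigorchuk
begin

lemma tot2: "tot g = (rot (st g 0) + rot (st g (Suc 0))) mod 2"
proof -
  have "{..<2::nat} = {0, Suc 0}" by auto
  then show ?thesis by (simp add: tot_def)
qed

lemma tot_bcd[simp]: "tot b = 1" "tot c = 1" "tot d = 0"
  by (simp_all add: tot2)

lemma tot_a: "tot a = 0"
  by (simp add: tot_def)

lemma tot_inv_cancel: "g \<in> carrier GG \<Longrightarrow> (tot g + tot (inv\<^bsub>GG\<^esub> g)) mod 2 = 0"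
  using tot_mult[of g "inv\<^bsub>GG\<^esub> g"] by (simp add: tot_def[of "\<one>\<^bsub>GG\<^esub>"])

lemma tot_conj: 
  assumes "g \<in> carrier GG" "x \<in> carrier GG"
  shows "tot (x \<otimes>\<^bsub>GG\<^esub> g \<otimes>\<^bsub>GG\<^esub> inv\<^bsub>GG\<^esub> x) = tot g"
proof -
  have "tot (x \<otimes>\<^bsub>GG\<^esub> g \<otimes>\<^bsub>GG\<^esub> inv\<^bsub>GG\<^esub> x) = (tot g + (tot x + tot (inv\<^bsub>GG\<^esub> x)) mod 2) mod 2"
    using assms by (simp add: tot_mult mod_simps add_ac)
  also have "\<dots> = tot g mod 2" unfolding tot_inv_cancel[OF assms(2)] by simp
  finally show ?thesis by (simp add: tot_def)
qed

text \<open>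
  The group \<open>K\<close> below, the normal closure of \<open>(ab)\<^sup>2\<close>, is the standard subgroup over which Grigorchuk's
  group is a regular branch group.
\<close>

definition abab where "abab = a \<otimes>\<^bsub>GG\<^esub> b \<otimes>\<^bsub>GG\<^esub> a \<otimes>\<^bsub>GG\<^esub> b"

definition conjs where "conjs = {x \<otimes>\<^bsub>GG\<^esub> abab \<otimes>\<^bsub>GG\<^esub> inv\<^bsub>GG\<^esub> x | x. x \<in> carrier GG}"

definition K where "K = generate GG conjs"

lemma abab_closed[simp]: "abab \<in> carrier GG"
  by (simp add: abab_def)

lemma conjs_carrier: "conjs \<subseteq> carrier GG"
  by (auto simp: conjs_def)

lemma K_normal: "K \<lhd> GG"
  unfolding K_def
proof (rule normal_generateI[OF conjs_carrier])
  fix h g assume "h \<in> conjs" and g: "g \<in> carrier GG"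
  then obtain x where x: "x \<in> carrier GG" "h = x \<otimes>\<^bsub>GG\<^esub> abab \<otimes>\<^bsub>GG\<^esub> inv\<^bsub>GG\<^esub> x" by (auto simp: conjs_def)
  then have "g \<otimes>\<^bsub>GG\<^esub> h \<otimes>\<^bsub>GG\<^esub> inv\<^bsub>GG\<^esub> g = (g \<otimes>\<^bsub>GG\<^esub> x) \<otimes>\<^bsub>GG\<^esub> abab \<otimes>\<^bsub>GG\<^esub> inv\<^bsub>GG\<^esub> (g \<otimes>\<^bsub>GG\<^esub> x)"
    using g by (simp add: m_assoc inv_mult_group)
  then show "g \<otimes>\<^bsub>GG\<^esub> h \<otimes>\<^bsub>GG\<^esub> inv\<^bsub>GG\<^esub> g \<in> conjs" using g x(1) unfolding conjs_def by blast
qed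

lemma K_minimal:
  assumes "subgroup H GG" "\<And>x. x \<in> carrier GG \<Longrightarrow> x \<otimes>\<^bsub>GG\<^esub> abab \<otimes>\<^bsub>GG\<^esub> inv\<^bsub>GG\<^esub> x \<in> H"
  shows "K \<subseteq> H"
  unfolding K_def by (rule generate_subgroup_incl[OF _ assms(1)]) (use assms(2) in \<open>auto simp: conjs_def\<close>)

lemma abab_K: "abab \<in> K"
  unfolding K_def by (rule generate.incl) (auto simp: conjs_def intro!: exI[of _ "\<one>\<^bsub>GG\<^esub>"])

lemma K_rot_tot:
  assumes "k \<in> K" shows "rot k = 0" "tot k = 0"
proof -
  have "K \<subseteq> {g \<in> carrier GG. rot g = 0 \<and> tot g = 0}"
  proof (rule K_minimal)
    show "subgroup {g \<in> carrier GG. rot g = 0 \<and> tot g = 0} GG"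
    proof (rule subgroupI)
      have "\<one>\<^bsub>GG\<^esub> \<in> {g \<in> carrier GG. rot g = 0 \<and> tot g = 0}" by (simp add: tot_def)
      then show "{g \<in> carrier GG. rot g = 0 \<and> tot g = 0} \<noteq> {}" by blast
      fix g assume g: "g \<in> {g \<in> carrier GG. rot g = 0 \<and> tot g = 0}"
      then have "tot (inv\<^bsub>GG\<^esub> g) mod 2 = 0" using tot_inv_cancel[of g] by simp
      then show "inv\<^bsub>GG\<^esub> g \<in> {g \<in> carrier GG. rot g = 0 \<and> tot g = 0}"
        using g by (simp add: rot_inv tot_def)
    qed (auto simp: rot_mult tot_mult)
    have "rot abab = 0" "tot abab = 0" by (simp_all add: abab_def rot_mult tot_mult tot_a)
    then show "x \<otimes>\<^bsub>GG\<^esub> abab \<otimes>\<^bsub>GG\<^esub> inv\<^bsub>GG\<^esub> x \<in> {g \<in> carrier GG. rot g = 0 \<and> tot g = 0}"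
      if "x \<in> carrier GG" for x using that by (simp add: rot_conj tot_conj)
  qed
  then show "rot k = 0" "tot k = 0" using assms by auto
qed

definition ada where "ada = a \<otimes>\<^bsub>GG\<^esub> d \<otimes>\<^bsub>GG\<^esub> a"

lemma ada_closed[simp]: "ada \<in> carrier GG" by (simp add: ada_def)

lemma st_ada[simp]: "st ada 0 = b" "st ada (Suc 0) = \<one>\<^bsub>GG\<^esub>" "rot ada = 0"
  by (simp_all add: ada_def st_mult rot_mult)

lemma ada_sq[simp]: "ada \<otimes>\<^bsub>GG\<^esub> ada = \<one>\<^bsub>GG\<^esub>"
proof (rule st_rot_eqI)
  show "st (ada \<otimes>\<^bsub>GG\<^esub> ada) i = st \<one>\<^bsub>GG\<^esub> i" if "i < 2" for i
    using that unfolding less2 by (auto simp: st_mult0)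
qed (simp_all add: rot_mult)

lemma d_ada: "d \<otimes>\<^bsub>GG\<^esub> ada = ada \<otimes>\<^bsub>GG\<^esub> d"
proof (rule st_rot_eqI)
  show "st (d \<otimes>\<^bsub>GG\<^esub> ada) i = st (ada \<otimes>\<^bsub>GG\<^esub> d) i" if "i < 2" for i
    using that unfolding less2 by (auto simp: st_mult0)
qed (simp_all add: rot_mult)

end

text \<open>
  The quotient by the normal closure of \<open>abab\<close> is a quotient of \<open>D\<^sub>4 \<times> C\<^sub>2\<close>: the image \<open>B\<close> of
  \<open>b\<close> becomes central, and \<open>A\<close> swaps the commuting involutions \<open>D\<close> and \<open>E\<close>.
\<close>

locale dihedral_relations = group Q for Q (structure) +
  fixes A B D E
  assumes AG[simp]: "A \<in> carrier Q" and BG[simp]: "B \<in> carrier Q" and DG[simp]: "D \<in> carrier Q"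
    and AA: "A \<otimes> A = \<one>" and BB: "B \<otimes> B = \<one>" and DD: "D \<otimes> D = \<one>"
    and E: "E = A \<otimes> D \<otimes> A" and BD: "B \<otimes> D = D \<otimes> B" and DE: "D \<otimes> E = E \<otimes> D"
    and ABAB: "A \<otimes> B \<otimes> A \<otimes> B = \<one>"
begin

lemma EG[simp]: "E \<in> carrier Q" by (simp add: E)

lemma red: "x \<in> carrier Q \<Longrightarrow> A \<otimes> (A \<otimes> x) = x" "x \<in> carrier Q \<Longrightarrow> B \<otimes> (B \<otimes> x) = x"
  "x \<in> carrier Q \<Longrightarrow> D \<otimes> (D \<otimes> x) = x"
  using AA BB DD by (simp_all add: m_assoc[symmetric])

lemma AB: "A \<otimes> B = B \<otimes> A"
proof -
  have "(A \<otimes> B \<otimes> A \<otimes> B) \<otimes> (B \<otimes> A) = B \<otimes> A" using ABAB by simp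
  moreover have "(A \<otimes> B \<otimes> A \<otimes> B) \<otimes> (B \<otimes> A) = A \<otimes> B" using AA by (simp add: m_assoc red)
  ultimately show ?thesis by simp
qed

lemma BE: "B \<otimes> E = E \<otimes> B"
proof -
  have "B \<otimes> E = (B \<otimes> A) \<otimes> (D \<otimes> A)" by (simp add: E m_assoc)
  also have "\<dots> = A \<otimes> (B \<otimes> D) \<otimes> A" by (simp add: AB[symmetric] m_assoc)
  also have "\<dots> = (A \<otimes> D) \<otimes> (B \<otimes> A)" by (simp add: BD m_assoc)
  also have "\<dots> = E \<otimes> B" by (simp add: E AB[symmetric] m_assoc)
  finally show ?thesis .
qed

lemma EE: "E \<otimes> E = \<one>"
  using AA by (simp add: E m_assoc red)

lemma DA: "D \<otimes> A = A \<otimes> E" "E \<otimes> A = A \<otimes> D"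
  using AA by (simp_all add: E m_assoc red)

text \<open>
  Normal forms of the abelian subgroup \<open>\<langle>B, D, E\<rangle>\<close>; conjugation by \<open>A\<close> exchanges the last two exponents.
\<close>

definition F where "F i j l = B [^] (i::nat) \<otimes> D [^] (j::nat) \<otimes> E [^] (l::nat)"

lemma F_closed[simp]: "F i j l \<in> carrier Q" by (simp add: F_def)

lemma F_mult: "F i j l \<otimes> F i' j' l' = F (i + i') (j + j') (l + l')"
proof -
  note com = comm_pow[OF DG BG BD[symmetric]] comm_pow[OF EG BG BE[symmetric]] comm_pow[OF EG DG DE[symmetric]]
  have "F i j l \<otimes> F i' j' l' = B [^] i \<otimes> (D [^] j \<otimes> (E [^] l \<otimes> B [^] i') \<otimes> D [^] j') \<otimes> E [^] l'"
    by (simp add: F_def m_assoc)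
  also have "\<dots> = B [^] i \<otimes> (D [^] j \<otimes> B [^] i') \<otimes> (E [^] l \<otimes> D [^] j') \<otimes> E [^] l'"
    unfolding com(2) by (simp add: m_assoc)
  also have "\<dots> = (B [^] i \<otimes> B [^] i') \<otimes> (D [^] j \<otimes> D [^] j') \<otimes> (E [^] l \<otimes> E [^] l')"
    unfolding com(1,3) by (simp add: m_assoc)
  finally show ?thesis by (simp add: F_def nat_pow_mult)
qed

lemma pow_mod2: "x \<in> carrier Q \<Longrightarrow> x \<otimes> x = \<one> \<Longrightarrow> x [^] (n::nat) = x [^] (n mod 2)"
proof (induction n)
  case (Suc n)
  then show ?case by (cases "even n") (simp_all add: mod_Suc)
qed simp

lemma F_mod2: "F i j l = F (i mod 2) (j mod 2) (l mod 2)"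
  unfolding F_def using pow_mod2[OF BG BB] pow_mod2[OF DG DD] pow_mod2[OF EG EE] by metis

lemma F_sq: "F i j l \<otimes> F i j l = \<one>"
  unfolding F_mult using F_mod2[of "i + i" "j + j" "l + l"] by (simp add: F_def mult_2[symmetric])

lemma F_A: "F i j l \<otimes> A = A \<otimes> F i l j"
proof -
  have conj: "x [^] (n::nat) \<otimes> A = A \<otimes> y [^] n" if "x \<in> carrier Q" "y \<in> carrier Q" "x \<otimes> A = A \<otimes> y" for x y n
  proof (induction n)
    case (Suc n)
    have "x [^] Suc n \<otimes> A = x [^] n \<otimes> (x \<otimes> A)" using that by (simp add: m_assoc)
    also have "\<dots> = (x [^] n \<otimes> A) \<otimes> y" unfolding that(3) using that by (simp add: m_assoc)
    also have "\<dots> = A \<otimes> y [^] Suc n" unfolding Suc using that by (simp add: m_assoc)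
    finally show ?case .
  qed (use that in simp)
  have "F i j l \<otimes> A = B [^] i \<otimes> (D [^] j \<otimes> (E [^] l \<otimes> A))" by (simp add: F_def m_assoc)
  also have "\<dots> = B [^] i \<otimes> ((D [^] j \<otimes> A) \<otimes> D [^] l)"
    unfolding conj[OF EG DG DA(2)] by (simp add: m_assoc)
  also have "\<dots> = (B [^] i \<otimes> A) \<otimes> (E [^] j \<otimes> D [^] l)"
    unfolding conj[OF DG EG DA(1)] by (simp add: m_assoc)
  also have "\<dots> = A \<otimes> (B [^] i \<otimes> (E [^] j \<otimes> D [^] l))"
    unfolding conj[OF BG BG AB[symmetric]] by (simp add: m_assoc)
  also have "\<dots> = A \<otimes> F i l j"
    unfolding comm_pow[OF EG DG DE[symmetric]] by (simp add: F_def m_assoc)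
  finally show ?thesis .
qed

lemma F_pow4: "x = F i j l \<or> x = A \<otimes> F i j l \<Longrightarrow> x [^] (4::nat) = \<one>"
proof -
  assume x: "x = F i j l \<or> x = A \<otimes> F i j l"
  have "x \<otimes> x = F (i + i) (l + j) (j + l) \<or> x \<otimes> x = \<one>"
  proof (cases "x = F i j l")
    case True
    then show ?thesis using F_sq by simp
  next
    case False
    then have "x \<otimes> x = A \<otimes> (F i j l \<otimes> A) \<otimes> F i j l" using x by (simp add: m_assoc)
    also have "\<dots> = F i l j \<otimes> F i j l" unfolding F_A by (simp add: m_assoc red)
    finally show ?thesis by (simp add: F_mult)
  qed
  then have "(x \<otimes> x) \<otimes> (x \<otimes> x) = \<one>" using F_sq by auto
  moreover have "x \<in> carrier Q" using x by auto
  ultimately show ?thesis by (simp add: numeral_eq_Suc m_assoc)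
qed

end



context grigorchuk
begin

declare mult_FactGroup[simp del] one_FactGroup[simp del]

abbreviation rc where "rc x \<equiv> K #>\<^bsub>GG\<^esub> x"

lemma rc_group: "group (GG Mod K)"
  by (rule normal.factorgroup_is_group[OF K_normal])

lemma rc_hom: "group_hom GG (GG Mod K) rc"
  using normal.r_coset_hom_Mod[OF K_normal] rc_group is_group
  by (simp add: group_hom_def group_hom_axioms_def)

lemma rc_mult: "x \<in> carrier GG \<Longrightarrow> y \<in> carrier GG \<Longrightarrow> rc (x \<otimes>\<^bsub>GG\<^esub> y) = rc x \<otimes>\<^bsub>GG Mod K\<^esub> rc y"
  by (rule group_hom.hom_mult[OF rc_hom])

lemma rc_closed: "x \<in> carrier GG \<Longrightarrow> rc x \<in> carrier (GG Mod K)"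
  by (rule group_hom.hom_closed[OF rc_hom])

lemma rc_one: "rc \<one>\<^bsub>GG\<^esub> = \<one>\<^bsub>GG Mod K\<^esub>"
  by (rule group_hom.hom_one[OF rc_hom])

lemma rc_eq_one: "x \<in> carrier GG \<Longrightarrow> rc x = \<one>\<^bsub>GG Mod K\<^esub> \<longleftrightarrow> x \<in> K"
  using normal.rcos_eq_iff[OF K_normal, of x "\<one>\<^bsub>GG\<^esub>"] rc_one by simp

end

sublocale grigorchuk \<subseteq> Qt: dihedral_relations "GG Mod K" "rc a" "rc b" "rc d" "rc ada"
proof (rule dihedral_relations.intro[OF rc_group], rule dihedral_relations_axioms.intro)
  show "rc a \<in> carrier (GG Mod K)" "rc b \<in> carrier (GG Mod K)" "rc d \<in> carrier (GG Mod K)"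
    by (simp_all add: rc_closed)
  show "rc a \<otimes>\<^bsub>GG Mod K\<^esub> rc a = \<one>\<^bsub>GG Mod K\<^esub>" "rc b \<otimes>\<^bsub>GG Mod K\<^esub> rc b = \<one>\<^bsub>GG Mod K\<^esub>"
    "rc d \<otimes>\<^bsub>GG Mod K\<^esub> rc d = \<one>\<^bsub>GG Mod K\<^esub>"
    by (simp_all only: rc_mult[symmetric] rc_one a_closed bcd_closed aa bcd_table)
  show "rc ada = rc a \<otimes>\<^bsub>GG Mod K\<^esub> rc d \<otimes>\<^bsub>GG Mod K\<^esub> rc a"
    by (simp only: rc_mult[symmetric] m_closed a_closed bcd_closed ada_def)
  show "rc b \<otimes>\<^bsub>GG Mod K\<^esub> rc d = rc d \<otimes>\<^bsub>GG Mod K\<^esub> rc b"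
    by (simp only: rc_mult[symmetric] bcd_closed bcd_table bcd_table')
  show "rc d \<otimes>\<^bsub>GG Mod K\<^esub> rc ada = rc ada \<otimes>\<^bsub>GG Mod K\<^esub> rc d"
    by (simp only: rc_mult[symmetric] bcd_closed ada_closed d_ada)
  have "rc abab = \<one>\<^bsub>GG Mod K\<^esub>" using rc_eq_one[OF abab_closed] abab_K by simp
  then show "rc a \<otimes>\<^bsub>GG Mod K\<^esub> rc b \<otimes>\<^bsub>GG Mod K\<^esub> rc a \<otimes>\<^bsub>GG Mod K\<^esub> rc b = \<one>\<^bsub>GG Mod K\<^esub>"
    by (simp only: rc_mult[symmetric] m_closed a_closed bcd_closed abab_def)
qed

context grigorchuk
begin

abbreviation QK where "QK \<equiv> GG Mod K"

text \<open>
  Every coset of \<open>K\<close> has one of these \<open>16\<close> forms, which bounds the index of \<open>K\<close> and shows that the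
  quotient has exponent \<open>4\<close>.
\<close>

definition nf where
  "nf g \<longleftrightarrow> (\<exists>i j l. rc g = Qt.F i j l \<or> rc g = rc a \<otimes>\<^bsub>QK\<^esub> Qt.F i j l)"

lemma nf_a: "u \<in> carrier GG \<Longrightarrow> nf u \<Longrightarrow> nf (a \<otimes>\<^bsub>GG\<^esub> u)"
proof -
  assume u: "u \<in> carrier GG" "nf u"
  then obtain i j l where "rc u = Qt.F i j l \<or> rc u = rc a \<otimes>\<^bsub>QK\<^esub> Qt.F i j l" unfolding nf_def by blast
  then have "rc (a \<otimes>\<^bsub>GG\<^esub> u) = rc a \<otimes>\<^bsub>QK\<^esub> Qt.F i j l \<or> rc (a \<otimes>\<^bsub>GG\<^esub> u) = Qt.F i j l"
    unfolding rc_mult[OF a_closed u(1)] using Qt.red(1)[OF Qt.F_closed] by metis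
  then show ?thesis unfolding nf_def by blast
qed

lemma F_gen: "rc b = Qt.F 1 0 0" "rc d = Qt.F 0 1 0"
  by (simp_all add: Qt.F_def)

lemma nf_F:
  assumes "u \<in> carrier GG" "nf u" "x \<in> carrier GG" "rc x = Qt.F i j l"
  shows "nf (x \<otimes>\<^bsub>GG\<^esub> u)"
proof -
  obtain i' j' l' where "rc u = Qt.F i' j' l' \<or> rc u = rc a \<otimes>\<^bsub>QK\<^esub> Qt.F i' j' l'"
    using assms(2) unfolding nf_def by blast
  then show ?thesis
  proof
    assume *: "rc u = Qt.F i' j' l'"
    have "rc (x \<otimes>\<^bsub>GG\<^esub> u) = Qt.F (i + i') (j + j') (l + l')"
      unfolding rc_mult[OF assms(3,1)] assms(4) * by (rule Qt.F_mult)
    then show ?thesis unfolding nf_def by blast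
  next
    assume *: "rc u = rc a \<otimes>\<^bsub>QK\<^esub> Qt.F i' j' l'"
    have "rc (x \<otimes>\<^bsub>GG\<^esub> u) = (Qt.F i j l \<otimes>\<^bsub>QK\<^esub> rc a) \<otimes>\<^bsub>QK\<^esub> Qt.F i' j' l'"
      unfolding rc_mult[OF assms(3,1)] assms(4) * by (simp only: Qt.m_assoc Qt.F_closed Qt.AG)
    also have "\<dots> = rc a \<otimes>\<^bsub>QK\<^esub> Qt.F (i + i') (l + j') (j + l')"
      unfolding Qt.F_A by (simp only: Qt.m_assoc Qt.F_closed Qt.AG Qt.F_mult)
    finally show ?thesis unfolding nf_def by blast
  qed
qed

lemma nf_a_pow: "u \<in> carrier GG \<Longrightarrow> nf u \<Longrightarrow> nf (a [^]\<^bsub>GG\<^esub> (k::nat) \<otimes>\<^bsub>GG\<^esub> u)"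
proof (induction k)
  case (Suc k)
  then have "nf (a \<otimes>\<^bsub>GG\<^esub> (a [^]\<^bsub>GG\<^esub> k \<otimes>\<^bsub>GG\<^esub> u))" by (intro nf_a) auto
  then show ?case unfolding nat_pow_Suc2[OF a_closed] using Suc.prems by (simp add: m_assoc)
qed simp

lemma nf_one: "nf \<one>\<^bsub>GG\<^esub>"
proof -
  have "rc \<one>\<^bsub>GG\<^esub> = Qt.F 0 0 0" using rc_one by (simp add: Qt.F_def)
  then show ?thesis unfolding nf_def by blast
qed

lemma klein_F:
  assumes "x \<in> klein" shows "\<exists>i j l. rc x = Qt.F i j l"
proof -
  have "rc (b \<otimes>\<^bsub>GG\<^esub> d) = rc b \<otimes>\<^bsub>QK\<^esub> rc d" by (rule rc_mult) simp_all
  also have "\<dots> = Qt.F 1 1 0" by (simp add: Qt.F_def)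
  finally have F_c: "rc c = Qt.F 1 1 0" by simp
  have 0: "rc \<one>\<^bsub>GG\<^esub> = Qt.F 0 0 0" using rc_one by (simp add: Qt.F_def)
  consider "x = \<one>\<^bsub>GG\<^esub>" | "x = b" | "x = c" | "x = d" using assms by (auto simp: klein_def)
  then show ?thesis
  proof cases
    case 1
    show ?thesis unfolding 1 by (intro exI, rule 0)
  next
    case 2
    show ?thesis unfolding 2 by (intro exI, rule F_gen(1))
  next
    case 3
    show ?thesis unfolding 3 by (intro exI, rule F_c)
  next
    case 4
    show ?thesis unfolding 4 by (intro exI, rule F_gen(2))
  qed
qed

lemma nf_all:
  assumes "g \<in> carrier GG" shows "nf g"
proof -
  obtain xs where "wd xs g" using wd_exists[OF assms] by blast
  then show ?thesis
  proof (induction rule: wd.induct)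
    case (wd_Nil k)
    then show ?case using nf_a_pow[OF one_closed nf_one, of k] by simp
  next
    case (wd_Cons xs u x k)
    have u: "u \<in> carrier GG" using wd_Cons wd_closed by blast
    obtain i j l where "rc x = Qt.F i j l" using klein_F[OF wd_Cons(2)] by blast
    then have "nf (x \<otimes>\<^bsub>GG\<^esub> u)" by (rule nf_F[OF u wd_Cons.IH B_carrier[OF wd_Cons(2)]])
    then have "nf (a [^]\<^bsub>GG\<^esub> k \<otimes>\<^bsub>GG\<^esub> (x \<otimes>\<^bsub>GG\<^esub> u))" by (rule nf_a_pow[rotated]) (use u wd_Cons(2) in simp)
    then show ?case using u wd_Cons(2) by (simp add: m_assoc)
  qed
qed

lemma K_exponent: "g \<in> carrier GG \<Longrightarrow> g [^]\<^bsub>GG\<^esub> ((2::nat) ^ 2) \<in> K"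
proof -
  assume g: "g \<in> carrier GG"
  obtain i j l where "rc g = Qt.F i j l \<or> rc g = rc a \<otimes>\<^bsub>QK\<^esub> Qt.F i j l"
    using nf_all[OF g] unfolding nf_def by blast
  then have "rc g [^]\<^bsub>QK\<^esub> (4::nat) = \<one>\<^bsub>QK\<^esub>" by (rule Qt.F_pow4)
  then have "rc (g [^]\<^bsub>GG\<^esub> (4::nat)) = \<one>\<^bsub>QK\<^esub>"
    using group_hom.hom_nat_pow[OF rc_hom g, of 4] by simp
  then show ?thesis using rc_eq_one[of "g [^]\<^bsub>GG\<^esub> (4::nat)"] g by simp
qed

lemma K_finite: "finite (rcosets\<^bsub>GG\<^esub> K)"
proof (rule finite_subset)
  let ?I = "{0, 1 :: nat} \<times> {0, 1 :: nat} \<times> {0, 1 :: nat}"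
  let ?f = "\<lambda>(i, j, l). Qt.F i j l"
  show "rcosets\<^bsub>GG\<^esub> K \<subseteq> ?f ` ?I \<union> (\<lambda>z. rc a \<otimes>\<^bsub>QK\<^esub> ?f z) ` ?I"
  proof
    fix z assume "z \<in> rcosets\<^bsub>GG\<^esub> K"
    then obtain g where g: "g \<in> carrier GG" "z = rc g" by (auto simp: RCOSETS_def)
    obtain i j l where ijl: "z = Qt.F i j l \<or> z = rc a \<otimes>\<^bsub>QK\<^esub> Qt.F i j l"
      using nf_all[OF g(1)] g(2) unfolding nf_def by blast
    have I: "(i mod 2, j mod 2, l mod 2) \<in> ?I" by (auto simp: mod2_eq_if)
    have F: "Qt.F i j l = ?f (i mod 2, j mod 2, l mod 2)"
      using Qt.F_mod2[of i j l] by (simp only: prod.case)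
    from ijl show "z \<in> ?f ` ?I \<union> (\<lambda>z. rc a \<otimes>\<^bsub>QK\<^esub> ?f z) ` ?I"
    proof
      assume "z = Qt.F i j l"
      then show ?thesis unfolding F by (intro UnI1 image_eqI[OF _ I])
    next
      assume "z = rc a \<otimes>\<^bsub>QK\<^esub> Qt.F i j l"
      then show ?thesis unfolding F by (intro UnI2 image_eqI[OF _ I])
    qed
  qed
qed simp

lemma first_onto: "g \<in> carrier GG \<Longrightarrow> \<exists>y\<in>carrier GG. rot y = 0 \<and> st y 0 = g"
proof (rule first_section_onto)
  show "\<exists>g\<in>carrier GG. rot g = 0 \<and> st g 0 = a" by (rule bexI[of _ b]) simp_all
  show "\<exists>y\<in>klein. st y (2 - 1) = x" if "x \<in> klein" for x
    using that by (auto simp: klein_def)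
qed

lemma K_subgroup: "subgroup K GG" by (rule normal_imp_subgroup[OF K_normal])

lemma K_carrier': "k \<in> K \<Longrightarrow> k \<in> carrier GG" by (rule subgroup.mem_carrier[OF K_subgroup])

text \<open>
  The element is the commutator of \<open>b\<close> and \<open>ada\<close>, and these commute modulo \<open>K\<close>.
\<close>

lemma badabada:
  defines "g \<equiv> (b \<otimes>\<^bsub>GG\<^esub> ada) \<otimes>\<^bsub>GG\<^esub> (b \<otimes>\<^bsub>GG\<^esub> ada)"
  shows "g \<in> K" "st g 0 = abab" "st g (Suc 0) = \<one>\<^bsub>GG\<^esub>"
proof -
  have "rc g = (rc b \<otimes>\<^bsub>QK\<^esub> rc ada) \<otimes>\<^bsub>QK\<^esub> (rc b \<otimes>\<^bsub>QK\<^esub> rc ada)"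
    unfolding g_def by (simp only: rc_mult m_closed bcd_closed ada_closed)
  also have "\<dots> = rc b \<otimes>\<^bsub>QK\<^esub> (rc ada \<otimes>\<^bsub>QK\<^esub> rc b) \<otimes>\<^bsub>QK\<^esub> rc ada"
    by (simp only: Qt.m_assoc Qt.BG Qt.EG Qt.m_closed)
  also have "\<dots> = rc b \<otimes>\<^bsub>QK\<^esub> (rc b \<otimes>\<^bsub>QK\<^esub> (rc ada \<otimes>\<^bsub>QK\<^esub> rc ada))"
    unfolding Qt.BE[symmetric] by (simp only: Qt.m_assoc Qt.BG Qt.EG Qt.m_closed)
  also have "\<dots> = \<one>\<^bsub>QK\<^esub>"
    unfolding Qt.EE using Qt.red(2)[OF Qt.one_closed] by simp
  finally show "g \<in> K" using rc_eq_one[of g] by (simp add: g_def)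
  show "st g 0 = abab" by (simp add: g_def st_mult0 rot_mult abab_def m_assoc)
  show "st g (Suc 0) = \<one>\<^bsub>GG\<^esub>" by (simp add: g_def st_mult0 rot_mult)
qed

text \<open>
  Conjugating the previous element by elements that fix the first level realises all generators of \<open>K\<close> in the
  first coordinate.
\<close>

lemma K_first:
  assumes "k \<in> K"
  shows "\<exists>g\<in>K. st g 0 = k \<and> (\<forall>i. 0 < i \<and> i < 2 \<longrightarrow> st g i = \<one>\<^bsub>GG\<^esub>)"
proof -
  have one: "(0 < i \<and> i < 2) \<longleftrightarrow> i = Suc 0" for i :: nat by auto
  let ?H = "{k \<in> carrier GG. \<exists>g\<in>K. st g 0 = k \<and> st g (Suc 0) = \<one>\<^bsub>GG\<^esub>}"
  have "K \<subseteq> ?H"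
  proof (rule K_minimal)
    show "subgroup ?H GG"
    proof (rule subgroupI)
      have "\<one>\<^bsub>GG\<^esub> \<in> ?H"
        using subgroup.one_closed[OF K_subgroup] by (auto intro!: bexI[of _ "\<one>\<^bsub>GG\<^esub>"])
      then show "?H \<noteq> {}" by blast
    next
      fix k assume "k \<in> ?H"
      then obtain g where g: "g \<in> K" "st g 0 = k" "st g (Suc 0) = \<one>\<^bsub>GG\<^esub>" by blast
      have "st (inv\<^bsub>GG\<^esub> g) 0 = inv\<^bsub>GG\<^esub> k" "st (inv\<^bsub>GG\<^esub> g) (Suc 0) = \<one>\<^bsub>GG\<^esub>"
        using st_inv0[OF K_carrier'[OF g(1)] K_rot_tot(1)[OF g(1)]] g by simp_all
      then show "inv\<^bsub>GG\<^esub> k \<in> ?H"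
        using \<open>k \<in> ?H\<close> subgroup.m_inv_closed[OF K_subgroup g(1)] by auto
    next
      fix k l assume kl: "k \<in> ?H" "l \<in> ?H"
      then obtain g h where g: "g \<in> K" "st g 0 = k" "st g (Suc 0) = \<one>\<^bsub>GG\<^esub>"
        and h: "h \<in> K" "st h 0 = l" "st h (Suc 0) = \<one>\<^bsub>GG\<^esub>" by blast
      have "st (g \<otimes>\<^bsub>GG\<^esub> h) 0 = k \<otimes>\<^bsub>GG\<^esub> l" "st (g \<otimes>\<^bsub>GG\<^esub> h) (Suc 0) = \<one>\<^bsub>GG\<^esub>"
        using st_mult0[OF K_carrier'[OF g(1)] K_carrier'[OF h(1)] K_rot_tot(1)[OF h(1)]] g h by simp_all
      then show "k \<otimes>\<^bsub>GG\<^esub> l \<in> ?H"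
        using kl subgroup.m_closed[OF K_subgroup g(1) h(1)] by auto
    qed auto
    fix x assume x: "x \<in> carrier GG"
    obtain y where y: "y \<in> carrier GG" "rot y = 0" "st y 0 = x" using first_onto[OF x] by blast
    define g where "g = (b \<otimes>\<^bsub>GG\<^esub> ada) \<otimes>\<^bsub>GG\<^esub> (b \<otimes>\<^bsub>GG\<^esub> ada)"
    note gK = badabada[folded g_def]
    define h where "h = y \<otimes>\<^bsub>GG\<^esub> g \<otimes>\<^bsub>GG\<^esub> inv\<^bsub>GG\<^esub> y"
    have "h \<in> K" unfolding h_def by (rule normal.inv_op_closed2[OF K_normal y(1) gK(1)])
    moreover have "st h 0 = x \<otimes>\<^bsub>GG\<^esub> abab \<otimes>\<^bsub>GG\<^esub> inv\<^bsub>GG\<^esub> x"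
      using st_conj[OF K_carrier'[OF gK(1)] y(1) K_rot_tot(1)[OF gK(1)], of 0] y gK(2) by (simp add: h_def)
    moreover have "st h (Suc 0) = \<one>\<^bsub>GG\<^esub>"
      using st_conj[OF K_carrier'[OF gK(1)] y(1) K_rot_tot(1)[OF gK(1)], of "Suc 0"] y gK(3) by (simp add: h_def)
    ultimately show "x \<otimes>\<^bsub>GG\<^esub> abab \<otimes>\<^bsub>GG\<^esub> inv\<^bsub>GG\<^esub> x \<in> ?H" using x by auto
  qed
  then show ?thesis using assms unfolding one by auto
qed

end

sublocale grigorchuk \<subseteq> spinal_branch_group 2 grigorchuk_group klein K 2
proof (rule spinal_branch_group.intro[OF spinal_group_axioms],
    rule branch_group.intro[OF rot_group_axioms], rule branch_group_axioms.intro)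
  show "\<exists>k\<in>K. \<forall>i<2. sec 2 k i = f i" if "\<And>i. i < 2 \<Longrightarrow> f i \<in> K" for f
    by (rule branch_tuple[OF K_normal K_rot_tot(1) K_first that])
qed (use K_normal K_exponent K_finite K_rot_tot in auto)

context grigorchuk
begin

lemma tot_differ_approx:
  assumes "u \<in> carrier GG" "v \<in> carrier GG" "g \<in> carrier GG" "r \<in> K"
    and "u \<otimes>\<^bsub>GG\<^esub> g = g \<otimes>\<^bsub>GG\<^esub> v \<otimes>\<^bsub>GG\<^esub> r"
  shows "tot u = tot v"
proof -
  have "tot (u \<otimes>\<^bsub>GG\<^esub> g) = tot (g \<otimes>\<^bsub>GG\<^esub> v \<otimes>\<^bsub>GG\<^esub> r)" by (simp only: assms(5))
  then have "(tot u + tot g) mod 2 = (tot v + tot g) mod 2"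
    using assms(1-3) K_rot_tot(2)[OF assms(4)] K_carrier'[OF assms(4)]
    by (simp add: tot_mult mod_simps add.commute)
  then show ?thesis by (rule add_mod_cancel) (simp_all add: tot_def)
qed

lemma detected_tot:
  assumes "u \<in> carrier GG" "v \<in> carrier GG" "tot u \<noteq> tot v"
  shows "detected u v"
proof -
  have "approx u v 0"
    unfolding approx_def using tot_differ_approx[OF assms(1,2)] assms(3) by auto
  then show ?thesis by (auto simp: detected_def)
qed

text \<open>
  Recursion would lead from \<open>d\<close> to \<open>b\<close>, \<open>c\<close> and back to \<open>d\<close>; this pair breaks the circle. The elements
  \<open>b\<close>, \<open>d\<close> and \<open>ada\<close> commute with \<open>d\<close> and represent all cosets of \<open>K\<close> in the stabiliser of the first
  level, and an element outside the stabiliser would exchange the sections \<open>1\<close> and \<open>b\<close> of \<open>d\<close>, which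
  \<open>tot\<close> tells apart.
\<close>

lemma detected_dd: "detected d d"
proof -
  have "approx d d 1"
    unfolding approx_def
  proof (intro ballI impI)
    fix g assume g: "g \<in> carrier GG" and "\<exists>r\<in>R 1. d \<otimes>\<^bsub>GG\<^esub> g = g \<otimes>\<^bsub>GG\<^esub> d \<otimes>\<^bsub>GG\<^esub> r"
    then obtain r where r: "r \<in> R 1" "d \<otimes>\<^bsub>GG\<^esub> g = g \<otimes>\<^bsub>GG\<^esub> d \<otimes>\<^bsub>GG\<^esub> r" by blast
    then have rG: "r \<in> carrier GG" "rot r = 0" "st r 0 \<in> K" by auto
    have g0: "rot g = 0"
    proof (rule ccontr)
      assume "rot g \<noteq> 0"
      then have g1: "rot g = Suc 0" using rot_less[OF g] by simp
      have "st (d \<otimes>\<^bsub>GG\<^esub> g) 0 = st (g \<otimes>\<^bsub>GG\<^esub> d \<otimes>\<^bsub>GG\<^esub> r) 0" by (simp only: r(2))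
      then have "b \<otimes>\<^bsub>GG\<^esub> st g 0 = st g 0 \<otimes>\<^bsub>GG\<^esub> \<one>\<^bsub>GG\<^esub> \<otimes>\<^bsub>GG\<^esub> st r 0"
        using g g1 rG by (simp add: st_mult rot_mult)
      then have "tot b = tot \<one>\<^bsub>GG\<^esub>" by (intro tot_differ_approx[of b _ "st g 0" "st r 0"]) (use g rG in simp_all)
      then show False by (simp add: tot_def[of "\<one>\<^bsub>GG\<^esub>"])
    qed
    obtain i j l where ijl: "rc g = Qt.F i j l \<or> rc g = rc a \<otimes>\<^bsub>QK\<^esub> Qt.F i j l"
      using nf_all[OF g] unfolding nf_def by blast
    define w where "w = b [^]\<^bsub>GG\<^esub> i \<otimes>\<^bsub>GG\<^esub> d [^]\<^bsub>GG\<^esub> j \<otimes>\<^bsub>GG\<^esub> ada [^]\<^bsub>GG\<^esub> l"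
    have w: "w \<in> carrier GG" "rot w = 0" by (simp_all add: w_def rot_mult rot_pow)
    have rcw: "rc w = Qt.F i j l"
      unfolding w_def Qt.F_def
      by (simp only: rc_mult m_closed nat_pow_closed bcd_closed ada_closed group_hom.hom_nat_pow[OF rc_hom])
    have same: "inv\<^bsub>GG\<^esub> g \<otimes>\<^bsub>GG\<^esub> v \<in> K" if "v \<in> carrier GG" "rc v = rc g" for v
      using normal.rcos_eq_iff[OF K_normal that(1) g] that(2) by simp
    have "rc g \<noteq> rc a \<otimes>\<^bsub>QK\<^esub> Qt.F i j l"
    proof
      assume "rc g = rc a \<otimes>\<^bsub>QK\<^esub> Qt.F i j l"
      then have "rc (a \<otimes>\<^bsub>GG\<^esub> w) = rc g" using rcw rc_mult[OF a_closed w(1)] by simp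
      then have "inv\<^bsub>GG\<^esub> g \<otimes>\<^bsub>GG\<^esub> (a \<otimes>\<^bsub>GG\<^esub> w) \<in> K" using w by (intro same) auto
      then have "rot (inv\<^bsub>GG\<^esub> g \<otimes>\<^bsub>GG\<^esub> (a \<otimes>\<^bsub>GG\<^esub> w)) = 0" by (rule K_rot_tot(1))
      then show False using g w g0 by (simp add: rot_mult rot_inv)
    qed
    then have "rc w = rc g" using ijl rcw by simp
    then have k: "inv\<^bsub>GG\<^esub> g \<otimes>\<^bsub>GG\<^esub> w \<in> K" by (rule same[OF w(1)])
    have db: "d \<otimes>\<^bsub>GG\<^esub> b = b \<otimes>\<^bsub>GG\<^esub> d" by simp
    have comm: "d \<otimes>\<^bsub>GG\<^esub> y [^]\<^bsub>GG\<^esub> (n::nat) = y [^]\<^bsub>GG\<^esub> n \<otimes>\<^bsub>GG\<^esub> d"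
      if "y \<in> carrier GG" "d \<otimes>\<^bsub>GG\<^esub> y = y \<otimes>\<^bsub>GG\<^esub> d" for y n
      using comm_pow[OF bcd_closed(3) that, of 1 n] that by simp
    have "d \<otimes>\<^bsub>GG\<^esub> w = (d \<otimes>\<^bsub>GG\<^esub> b [^]\<^bsub>GG\<^esub> i) \<otimes>\<^bsub>GG\<^esub> d [^]\<^bsub>GG\<^esub> j \<otimes>\<^bsub>GG\<^esub> ada [^]\<^bsub>GG\<^esub> l" by (simp add: w_def m_assoc)
    also have "\<dots> = b [^]\<^bsub>GG\<^esub> i \<otimes>\<^bsub>GG\<^esub> (d \<otimes>\<^bsub>GG\<^esub> d [^]\<^bsub>GG\<^esub> j) \<otimes>\<^bsub>GG\<^esub> ada [^]\<^bsub>GG\<^esub> l"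
      unfolding comm[OF bcd_closed(1) db] by (simp add: m_assoc)
    also have "\<dots> = b [^]\<^bsub>GG\<^esub> i \<otimes>\<^bsub>GG\<^esub> d [^]\<^bsub>GG\<^esub> j \<otimes>\<^bsub>GG\<^esub> (d \<otimes>\<^bsub>GG\<^esub> ada [^]\<^bsub>GG\<^esub> l)"
      unfolding comm[OF bcd_closed(3) refl] by (simp add: m_assoc)
    also have "\<dots> = w \<otimes>\<^bsub>GG\<^esub> d"
      unfolding comm[OF ada_closed d_ada] by (simp add: w_def m_assoc)
    finally have dw: "d \<otimes>\<^bsub>GG\<^esub> w = w \<otimes>\<^bsub>GG\<^esub> d" .
    have gw: "g \<otimes>\<^bsub>GG\<^esub> (inv\<^bsub>GG\<^esub> g \<otimes>\<^bsub>GG\<^esub> w) = w" using g w by (simp add: cancel)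
    show "\<exists>k\<in>K. d \<otimes>\<^bsub>GG\<^esub> (g \<otimes>\<^bsub>GG\<^esub> k) = g \<otimes>\<^bsub>GG\<^esub> k \<otimes>\<^bsub>GG\<^esub> d"
      by (rule bexI[OF _ k]) (simp only: gw dw)
  qed
  then show ?thesis by (auto simp: detected_def)
qed

lemma detected_pair:
  assumes "u \<in> carrier GG" "rot u = 0" "v \<in> carrier GG" "rot v = 0"
    and "detected (st u 0) (st v 0)" "detected (st u 0) (st v (Suc 0))"
    "detected (st u (Suc 0)) (st v 0)" "detected (st u (Suc 0)) (st v (Suc 0))"
  shows "detected u v"
  by (rule detected_stab[OF assms(1-4)]) (use assms(5-8) in \<open>auto simp: less2\<close>)

text \<open>
  The homomorphism \<open>tot\<close> separates \<open>{1, d}\<close> from \<open>{b, c}\<close>. For pairs inside these sets one passes to sections,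
  in the order \<open>(1, d)\<close>, \<open>(c, c)\<close>, \<open>(b, c)\<close>, \<open>(b, b)\<close>.
\<close>

lemma detected_klein:
  assumes "x \<in> klein" "y \<in> klein"
  shows "detected x y"
proof -
  have tot1: "tot \<one>\<^bsub>GG\<^esub> = 0" by (simp add: tot_def)
  have aa: "detected a a" using detected_a_pow[of 1 1] by simp
  have ra: "detected a z" "detected z a" if "z \<in> klein" for z
    using that B_rot[OF that] by (auto intro!: detected_rot_differ)
  have kl: "\<one>\<^bsub>GG\<^esub> \<in> klein" "b \<in> klein" "c \<in> klein" "d \<in> klein" by (simp_all add: klein_def)
  have 1: "detected u v" if "u \<in> klein" "v \<in> klein" "tot u \<noteq> tot v" for u v
    using that by (intro detected_tot) auto
  have d1: "detected d \<one>\<^bsub>GG\<^esub>" "detected \<one>\<^bsub>GG\<^esub> d"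
    by (rule detected_pair; simp add: detected_one 1 kl tot1)+
  have cc: "detected c c"
    by (rule detected_pair) (simp_all add: aa ra kl detected_dd)
  have bc: "detected b c" "detected c b"
    by (rule detected_pair; simp add: aa ra kl 1)+
  have bb: "detected b b"
    by (rule detected_pair) (simp_all add: aa ra kl cc)
  show ?thesis
  proof (cases "tot x = tot y")
    case False
    then show ?thesis using 1 assms by blast
  next
    case True
    then show ?thesis using assms d1 cc bc bb detected_one detected_dd tot1 unfolding klein_def by auto
  qed
qed

definition has where
  "has x u \<longleftrightarrow> (\<exists>xs. rep xs u \<and> length xs = len u \<and> x \<in> set xs)"

text \<open>
  For an element that moves the first level, a section of the square may be as long as the element. But its letters
  are then obtained by \<open>b \<mapsto> c \<mapsto> d\<close>, and once \<open>d\<close> occurs the next step shortens the word: the rank counts the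
  steps until \<open>d\<close> appears. Length weighs three times as much because the rank is at most \<open>2\<close>.
\<close>

definition rank :: "(nat list \<Rightarrow> nat list) \<Rightarrow> nat" where
  "rank u = (if has d u then 0 else if has c u then 1 else 2)"

definition \<mu> where
  "\<mu> u = (if short u then 0 else 3 * len u + rank u)"

lemma mu_bound: "\<mu> u \<le> 3 * len u + 2"
  by (simp add: \<mu>_def rank_def)

lemma klein_mem: "\<one>\<^bsub>GG\<^esub> \<in> klein" "b \<in> klein" "c \<in> klein" "d \<in> klein"
  by (simp_all add: klein_def)

text \<open>
  Conjugating by the first letter moves it to the end; moving it there past the final \<open>a\<close> changes its position.
\<close>

lemma len_conj_d:
  assumes l': "l' \<in> lists letters" and j: "j < 2"
    and l: "l = (j, d) # l'"
  shows "len (ev (l' @ [((Suc j) mod 2, d)]) \<otimes>\<^bsub>GG\<^esub> a) = len (ev l \<otimes>\<^bsub>GG\<^esub> a)"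
proof -
  have lt: "(j, d) \<in> letters" "((Suc j) mod 2, d) \<in> letters" using j klein_mem by (auto simp: letters_def)
  have "a \<otimes>\<^bsub>GG\<^esub> el (j, d) = el (Suc j mod 2, d) \<otimes>\<^bsub>GG\<^esub> a"
    using a_pow_conj_el[OF lt(1), of 1] by simp
  then have "inv\<^bsub>GG\<^esub> (el (j, d)) \<otimes>\<^bsub>GG\<^esub> (ev l \<otimes>\<^bsub>GG\<^esub> a) \<otimes>\<^bsub>GG\<^esub> inv\<^bsub>GG\<^esub> (inv\<^bsub>GG\<^esub> (el (j, d)))
      = ev l' \<otimes>\<^bsub>GG\<^esub> (el (Suc j mod 2, d) \<otimes>\<^bsub>GG\<^esub> a)"
    using l l' lt by (simp add: m_assoc cancel)
  also have "\<dots> = ev (l' @ [((Suc j) mod 2, d)]) \<otimes>\<^bsub>GG\<^esub> a"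
    using l' lt by (simp add: ev_append m_assoc)
  finally show ?thesis
    using len_conj[of "ev l \<otimes>\<^bsub>GG\<^esub> a" "inv\<^bsub>GG\<^esub> (el (j, d))"] l l' lt by simp
qed

text \<open>
  Since \<open>d = (1, b)\<close> has a trivial first coordinate, the letters on either side of \<open>d\<close> meet in a
  section of \<open>u\<^sup>2\<close> and merge.
\<close>

lemma has_d_shrinks:
  assumes u: "u \<in> carrier GG" "rot u \<noteq> 0" "has d u" and y: "y < 2"
  shows "short (st (u [^]\<^bsub>GG\<^esub> (2::nat)) y) \<or> len (st (u [^]\<^bsub>GG\<^esub> (2::nat)) y) < len u"
proof -
  obtain xs where xs: "rep xs u" "length xs = len u" "d \<in> set xs" using u(3) by (auto simp: has_def)
  obtain xs1 xs2 where split: "xs = xs1 @ d # xs2" using xs(3) by (auto dest: split_list)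
  have rep: "rep (d # xs2 @ xs1) u" using rep_rotate[of xs1 "d # xs2" u] xs(1) split by simp
  obtain l0 k x where l0: "l0 \<in> lists letters" "map snd l0 = d # xs2 @ xs1" and x: "x \<in> carrier GG"
    and ux: "u = x \<otimes>\<^bsub>GG\<^esub> (ev l0 \<otimes>\<^bsub>GG\<^esub> a [^]\<^bsub>GG\<^esub> (k::nat)) \<otimes>\<^bsub>GG\<^esub> inv\<^bsub>GG\<^esub> x" "rot u = k mod 2"
    using rep_ev[OF rep] by (elim exE conjE) (rule that)
  obtain j l where jl: "l0 = (j, d) # l" using l0(2) by (cases l0) auto
  have "k mod 2 = 1" using u(2) ux(2) by simp
  then have ak: "a [^]\<^bsub>GG\<^esub> k = a" using a_pow_mod[of k] by simp
  define w where "w = ev l0 \<otimes>\<^bsub>GG\<^esub> a"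
  have w: "w \<in> carrier GG" "rot w = 1" using l0 by (simp_all add: w_def rot_mult)
  have uw: "u = x \<otimes>\<^bsub>GG\<^esub> w \<otimes>\<^bsub>GG\<^esub> inv\<^bsub>GG\<^esub> x" using ux ak by (simp add: w_def)
  have lenw: "len w = len u" using uw len_conj[OF w(1) x] by simp
  have lt: "(j, d) \<in> letters" and l: "l \<in> lists letters" using l0 jl by auto
  have j: "j < 2" using letters_D[OF lt] by simp
  have n: "len u = Suc (length l)" using arg_cong[OF l0(2), of length] xs(2) split jl by simp
  define E where "E i = st (ev l0) i" for i
  define j' where "j' = Suc j mod 2"
  have j': "j' < 2" "Suc j' mod 2 = j" "j' \<noteq> j" using j by (auto simp: j'_def less2)
  have E: "E i \<in> carrier GG" if "i < 2" for i using that l0 by (simp add: E_def)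
  have stw: "st w i = E (Suc i mod 2)" if "i < 2" for i
    using that l0 by (simp add: w_def E_def st_mult)
  have sq: "w [^]\<^bsub>GG\<^esub> (2::nat) = w \<otimes>\<^bsub>GG\<^esub> w"
    using nat_pow_Suc[of w 1] w by (simp add: numeral_2_eq_2[symmetric])
  have st2: "st (w [^]\<^bsub>GG\<^esub> (2::nat)) i = E i \<otimes>\<^bsub>GG\<^esub> E (Suc i mod 2)" if i: "i < 2" for i
  proof -
    have "st (w \<otimes>\<^bsub>GG\<^esub> w) i = st w (Suc i mod 2) \<otimes>\<^bsub>GG\<^esub> st w i" using st_mult[OF w(1) w(1) i] w by simp
    also have "\<dots> = E i \<otimes>\<^bsub>GG\<^esub> E (Suc i mod 2)" using i stw unfolding less2 by auto
    finally show ?thesis by (simp only: sq)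
  qed
  \<comment> \<open>The two sections of \<open>w\<^sup>2\<close> are conjugate; \<open>s\<close> is the one in which \<open>d\<close> itself disappears.\<close>
  define s where "s = E j \<otimes>\<^bsub>GG\<^esub> E j'"
  have s: "s \<in> carrier GG" using E j j' by (simp add: s_def)
  have any: "\<exists>z\<in>carrier GG. st (w [^]\<^bsub>GG\<^esub> (2::nat)) i = z \<otimes>\<^bsub>GG\<^esub> s \<otimes>\<^bsub>GG\<^esub> inv\<^bsub>GG\<^esub> z" if i: "i < 2" for i
  proof (cases "i = j")
    case True
    then show ?thesis using st2[OF i] s by (intro bexI[of _ "\<one>\<^bsub>GG\<^esub>"]) (simp_all add: s_def j'_def)
  next
    case False
    then have "i = j'" "Suc i mod 2 = j" using i j j' by (auto simp: less2)
    then have "st (w [^]\<^bsub>GG\<^esub> (2::nat)) i = E j' \<otimes>\<^bsub>GG\<^esub> E j" using st2[OF i] by simp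
    also have "\<dots> = E j' \<otimes>\<^bsub>GG\<^esub> s \<otimes>\<^bsub>GG\<^esub> inv\<^bsub>GG\<^esub> (E j')" using E j j' by (simp add: s_def m_assoc)
    finally show ?thesis using E[OF j'(1)] by blast
  qed
  have up: "u [^]\<^bsub>GG\<^esub> (2::nat) = x \<otimes>\<^bsub>GG\<^esub> w [^]\<^bsub>GG\<^esub> (2::nat) \<otimes>\<^bsub>GG\<^esub> inv\<^bsub>GG\<^esub> x"
    unfolding uw by (rule conj_pow[OF w(1) x])
  obtain i z where i: "i < 2" "z \<in> carrier GG"
    "st (u [^]\<^bsub>GG\<^esub> (2::nat)) y = z \<otimes>\<^bsub>GG\<^esub> st (w [^]\<^bsub>GG\<^esub> (2::nat)) i \<otimes>\<^bsub>GG\<^esub> inv\<^bsub>GG\<^esub> z"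
    using conj_section[of "w [^]\<^bsub>GG\<^esub> (2::nat)" x y] w x y up rot_pow_p[OF w(1)] by auto
  obtain z' where z': "z' \<in> carrier GG" "st (w [^]\<^bsub>GG\<^esub> (2::nat)) i = z' \<otimes>\<^bsub>GG\<^esub> s \<otimes>\<^bsub>GG\<^esub> inv\<^bsub>GG\<^esub> z'"
    using any[OF i(1)] by blast
  have same: "short (st (u [^]\<^bsub>GG\<^esub> (2::nat)) y) \<longleftrightarrow> short s" "len (st (u [^]\<^bsub>GG\<^esub> (2::nat)) y) = len s"
    unfolding i(3) z'(2) using s i(2) z'(1) by (simp_all add: short_conj len_conj)
  have stj: "st (el (j, d)) j = \<one>\<^bsub>GG\<^esub>" "st (el (j, d)) j' = b"
    using st_el[OF lt, of 0] st_el[OF lt, of "Suc 0"] j by (simp_all add: j'_def)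
  have Ej: "E j = st (ev l) j" "E j' = b \<otimes>\<^bsub>GG\<^esub> st (ev l) j'"
    using l lt j j' stj by (simp_all add: E_def jl st_mult0)
  show ?thesis
  proof (cases l)
    case Nil
    then have "s = b" using Ej j j' by (simp add: s_def)
    then show ?thesis using same short_B[of b] by (simp add: klein_def)
  next
    case (Cons z2 l1)
    obtain j2 x2 where z2: "z2 = (j2, x2)" by (cases z2)
    have lt2: "(j2, x2) \<in> letters" and l1: "l1 \<in> lists letters" using l Cons z2 by auto
    have "j2 \<noteq> j"
    proof
      assume "j2 = j"
      then have "len (ev ([] @ (j, d) # (j, x2) # l1) \<otimes>\<^bsub>GG\<^esub> a [^]\<^bsub>GG\<^esub> (1::nat)) \<le> Suc (length ([]::(nat \<times> (nat list \<Rightarrow> nat list)) list) + length l1)"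
        using lt lt2 l1 by (intro len_ev_merge) auto
      then show False using lenw n Cons z2 \<open>j2 = j\<close> jl by (simp add: w_def)
    qed
    then have j2: "j2 = j'" using letters_D(1)[OF lt2] j j' by (auto simp: less2)
    have "l \<noteq> []" using Cons by simp
    then obtain l2 zn where "l = l2 @ [zn]" by (cases l rule: rev_cases) auto
    moreover obtain jn xn where "zn = (jn, xn)" by (cases zn)
    ultimately have last: "l = l2 @ [(jn, xn)]" by simp
    have ltn: "(jn, xn) \<in> letters" and l2: "l2 \<in> lists letters" using l last by auto
    have "jn \<noteq> j'"
    proof
      assume *: "jn = j'"
      have "len (ev (l2 @ (j', xn) # (j', d) # []) \<otimes>\<^bsub>GG\<^esub> a [^]\<^bsub>GG\<^esub> (1::nat)) \<le> Suc (length l2 + length ([]::(nat \<times> (nat list \<Rightarrow> nat list)) list))"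
        using ltn l2 * j' lt by (intro len_ev_merge) (auto simp: letters_def)
      moreover have "len (ev (l @ [(j', d)]) \<otimes>\<^bsub>GG\<^esub> a) = len w"
        using len_conj_d[OF l j jl] by (simp add: w_def j'_def)
      ultimately show False using lenw n last * by simp
    qed
    then have jn: "jn = j" using letters_D(1)[OF ltn] j j' by (auto simp: less2)
    have "l2 \<noteq> []" using last Cons z2 j2 jn j' by auto
    then obtain l3 where l3: "l = (j', x2) # l3 @ [(j, xn)]"
      using last Cons z2 j2 jn by (cases l2) auto
    have l3l: "l3 \<in> lists letters" using l l3 by auto
    note lt2' = lt2[unfolded j2] and ltn' = ltn[unfolded jn]
    define \<sigma>2 where "\<sigma>2 = st x2 (Suc 0)"
    define \<sigma>n where "\<sigma>n = st xn (Suc 0)"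
    have \<sigma>: "\<sigma>2 \<in> klein" "\<sigma>n \<in> klein"
      using B_dir[of x2] B_dir[of xn] letters_D(2)[OF lt2] letters_D(2)[OF ltn] by (simp_all add: \<sigma>2_def \<sigma>n_def)
    have e1: "st (el (j', x2)) j = \<sigma>2" using st_el_dir[OF lt2', of j] j by (simp add: j'_def \<sigma>2_def)
    have e2: "st (el (j, xn)) j' = \<sigma>n" using st_el_dir[OF ltn', of j'] j' by (simp add: \<sigma>n_def)
    obtain k1 :: nat where k1: "st (el (j, xn)) j = a [^]\<^bsub>GG\<^esub> k1"
      using st_el_fin[OF ltn', of j] j j' by (auto simp: j'_def)
    obtain k2 :: nat where k2: "st (el (j', x2)) j' = a [^]\<^bsub>GG\<^esub> k2"
      using st_el_fin[OF lt2', of j'] j' by auto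
    let ?zs = "\<lambda>i. map (\<lambda>z. st (snd z) (2 - 1)) (filter (\<lambda>z. fst z = (i + 1) mod 2) l3)"
    have wdP: "wd (?zs i) (st (ev l3) i)" if "i < 2" for i
      using ev_section[OF l3l that] .
    have P: "st (ev l3) i \<in> carrier GG" if "i < 2" for i using that l3l by simp
    have lj: "st (ev l) j = \<sigma>2 \<otimes>\<^bsub>GG\<^esub> (st (ev l3) j \<otimes>\<^bsub>GG\<^esub> a [^]\<^bsub>GG\<^esub> k1)"
      using lt2' ltn' l3l j e1 k1 by (simp add: l3 ev_append st_mult0 rot_mult)
    have lj': "st (ev l) j' = a [^]\<^bsub>GG\<^esub> k2 \<otimes>\<^bsub>GG\<^esub> (st (ev l3) j' \<otimes>\<^bsub>GG\<^esub> \<sigma>n)"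
      using lt2' ltn' l3l j' e2 k2 by (simp add: l3 ev_append st_mult0 rot_mult)
    let ?M = "st (ev l3) j \<otimes>\<^bsub>GG\<^esub> (a [^]\<^bsub>GG\<^esub> k1 \<otimes>\<^bsub>GG\<^esub> (b \<otimes>\<^bsub>GG\<^esub> (a [^]\<^bsub>GG\<^esub> k2 \<otimes>\<^bsub>GG\<^esub> st (ev l3) j')))"
    have M: "?M \<in> carrier GG" using P j j' by simp
    have "s = \<sigma>2 \<otimes>\<^bsub>GG\<^esub> (?M \<otimes>\<^bsub>GG\<^esub> \<sigma>n)"
      unfolding s_def Ej lj lj' using \<sigma> P j j' by (simp add: m_assoc)
    then have "\<sigma>n \<otimes>\<^bsub>GG\<^esub> s \<otimes>\<^bsub>GG\<^esub> inv\<^bsub>GG\<^esub> \<sigma>n = (\<sigma>n \<otimes>\<^bsub>GG\<^esub> \<sigma>2) \<otimes>\<^bsub>GG\<^esub> ?M"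
      using \<sigma> M by (simp add: m_assoc)
    moreover have "wd ([\<sigma>n \<otimes>\<^bsub>GG\<^esub> \<sigma>2] @ (?zs j @ ([] @ ([b] @ ([] @ ?zs j'))))) ((\<sigma>n \<otimes>\<^bsub>GG\<^esub> \<sigma>2) \<otimes>\<^bsub>GG\<^esub> ?M)"
      by (intro wd_mult wd_B wd_Nil wdP) (use \<sigma> j j' klein_mem in auto)
    ultimately have "len s \<le> length ([\<sigma>n \<otimes>\<^bsub>GG\<^esub> \<sigma>2] @ (?zs j @ ([] @ ([b] @ ([] @ ?zs j')))))"
      using len_le[OF wd_rep] len_conj[OF s B_carrier[OF \<sigma>(2)]] by metis
    also have "\<dots> = 2 + (length (filter (\<lambda>z. fst z = j') l3) + length (filter (\<lambda>z. fst z = j) l3))"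
      using j' by (simp add: j'_def)
    also have "length (filter (\<lambda>z. fst z = j') l3) + length (filter (\<lambda>z. fst z = j) l3) = length l3"
    proof -
      have "filter (\<lambda>z. fst z = j) l3 = filter (\<lambda>z. \<not> fst z = j') l3"
        by (rule filter_cong[OF refl]) (use l3l letters_D(1) j j' in \<open>force simp: less2\<close>)
      then show ?thesis by (simp only: sum_length_filter_compl)
    qed
    finally show ?thesis using same n l3 by simp
  qed
qed

end

sublocale grigorchuk \<subseteq> contracting_branch_group 2 grigorchuk_group K 2 \<mu>
proof (rule contracting_branch_group.intro[OF branch_group_axioms], rule contracting_branch_group_axioms.intro)
  fix u i assume u: "u \<in> carrier GG" and i: "i < (2::nat)"
  show "\<mu> (sec 2 u i) \<le> \<mu> u - 1" if rot: "rot u = 0"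
  proof (cases "short u")
    case True
    then show ?thesis using short_section[OF u rot True i] by (simp add: \<mu>_def)
  next
    case False
    then have n: "len u \<ge> 2" using rot by (simp add: short_def)
    have "\<mu> (st u i) \<le> 3 * (len u div 2) + 2"
      using mu_bound[of "st u i"] len_section_stab[OF u rot n i] by linarith
    also have "\<dots> \<le> 3 * len u - 1" using n by linarith
    also have "\<dots> \<le> \<mu> u - 1" using False by (simp add: \<mu>_def)
    finally show ?thesis .
  qed
  show "\<mu> (sec 2 (u [^]\<^bsub>GG\<^esub> (2::nat)) i) \<le> \<mu> u - 1" if rot: "rot u \<noteq> 0"
  proof (cases "short u")
    case True
    then show ?thesis using short_section_pow[OF u rot True i] by (simp add: \<mu>_def)
  next
    case False
    let ?v = "st (u [^]\<^bsub>GG\<^esub> (2::nat)) i"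
    have n: "len u > 0" using False by (simp add: short_def)
    have muu: "\<mu> u = 3 * len u + rank u" using False by (simp add: \<mu>_def)
    have less: ?thesis if "len ?v < len u"
      using mu_bound[of ?v] muu that by linarith
    have le: "len ?v \<le> len u" by (rule short_descent_rot[OF u rot i])
    show ?thesis
    proof (cases "has d u")
      case True
      then show ?thesis using has_d_shrinks[OF u rot True i] less by (auto simp: \<mu>_def)
    next
      case nd: False
      obtain xs x where xs: "rep xs u" "length xs = len u" "x \<in> set xs"
        and x: "if has c u then x = c else x = b"
      proof (cases "has c u")
        case True
        then show ?thesis using that unfolding has_def by auto
      next
        case False
        obtain xs where xs: "rep xs u" "length xs = len u" using rep_exists[OF u] by blast
        then obtain x where x: "x \<in> set xs" using n by (cases xs) auto
        have "x \<in> klein" using rep_letters[OF xs(1)] x by blast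
        moreover have "x \<noteq> \<one>\<^bsub>GG\<^esub>" using minimal_ne_one[OF xs x] .
        moreover have "x \<noteq> c" "x \<noteq> d" using False nd xs x by (auto simp: has_def)
        ultimately have "x = b" by (simp add: klein_def)
        then show ?thesis using that[OF xs x] False by simp
      qed
      obtain ys where ys: "rep ys ?v" "length ys = length xs" "(\<lambda>x. st x (2 - 1)) ` set xs \<subseteq> set ys"
        using rep_section_rot[OF xs(1) rot i] by blast
      have mem: "st x (Suc 0) \<in> set ys" using ys(3) xs(3) by auto
      show ?thesis
      proof (cases "len ?v < len u")
        case True
        then show ?thesis by (rule less)
      next
        case False
        then have eq: "len ?v = len u" using le by simp
        then have "has (st x (Suc 0)) ?v" using ys xs mem unfolding has_def by auto
        then have "rank ?v < rank u" using x nd by (auto simp: rank_def split: if_splits)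
        moreover have "\<mu> ?v \<le> 3 * len u + rank ?v" using eq by (simp add: \<mu>_def)
        ultimately show ?thesis using muu by linarith
      qed
    qed
  qed
next
  fix u assume u: "u \<in> carrier GG" "\<mu> u = 0"
  then have su: "short u" by (auto simp: \<mu>_def short_def split: if_splits)
  have "x [^]\<^bsub>GG\<^esub> (2::nat) = \<one>\<^bsub>GG\<^esub>" if "x \<in> klein" for x
  proof -
    have "x [^]\<^bsub>GG\<^esub> (2::nat) = x \<otimes>\<^bsub>GG\<^esub> x"
      using nat_pow_Suc[of x 1] that by (simp add: numeral_2_eq_2[symmetric])
    also have "\<dots> = \<one>\<^bsub>GG\<^esub>" using that by (auto simp: klein_def)
    finally show ?thesis .
  qed
  then show "\<exists>n>0. u [^]\<^bsub>GG\<^esub> (n::nat) = \<one>\<^bsub>GG\<^esub>" by (rule short_torsion[OF u(1) su])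
  fix v assume v: "v \<in> carrier GG" "\<mu> v = 0"
  then have sv: "short v" by (auto simp: \<mu>_def short_def split: if_splits)
  show "detected u v"
    by (rule detected_short[OF detected_klein u(1) su v(1) sv])
qed


section \<open>Wreath products of free abelian groups with branch groups\<close>

lemma comm_group_product_group:
  assumes "\<And>i. i \<in> I \<Longrightarrow> comm_group (G i)"
  shows "comm_group (product_group I G)"
proof -
  have grp: "group (G i)" if "i \<in> I" for i using assms[OF that] by (rule comm_group.axioms(2))
  interpret group "product_group I G" by (rule product_group) (rule grp)
  show ?thesis
  proof (rule group_comm_groupI)
    fix x y assume "x \<in> carrier (product_group I G)" "y \<in> carrier (product_group I G)"
    then have "x i \<otimes>\<^bsub>G i\<^esub> y i = y i \<otimes>\<^bsub>G i\<^esub> x i" if "i \<in> I" for i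
      using that comm_monoid.m_comm[OF comm_group.axioms(1)[OF assms[OF that]]] by (auto simp: PiE_iff)
    then show "x \<otimes>\<^bsub>product_group I G\<^esub> y = y \<otimes>\<^bsub>product_group I G\<^esub> x" by (auto simp: restrict_def)
  qed
qed

text \<open>
  Reducing modulo a power of \<open>p\<close> that exceeds all differences of entries is injective on \<open>S\<close>.
\<close>

lemma integer_vectors_separated:
  fixes S :: "(nat \<Rightarrow> int) set"
  assumes p: "Factorial_Ring.prime (p::nat)"
    and S: "finite S" "S \<subseteq> carrier (product_group {..<m} (\<lambda>_. integer_group))"
  shows "\<exists>(Q :: (nat \<Rightarrow> int) monoid) \<alpha>. finite_p_group p Q \<and> comm_group Q \<and>
    \<alpha> \<in> hom (product_group {..<m} (\<lambda>_. integer_group)) Q \<and> inj_on \<alpha> S"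
proof -
  define M where "M = (\<Sum>f\<in>S. \<Sum>i<m. nat \<bar>f i\<bar>)"
  have bound: "nat \<bar>f i\<bar> \<le> M" if "f \<in> S" "i < m" for f i
  proof -
    have "nat \<bar>f i\<bar> \<le> (\<Sum>i<m. nat \<bar>f i\<bar>)" using that by (intro member_le_sum) auto
    also have "\<dots> \<le> M" unfolding M_def using that S by (intro member_le_sum[of f S "\<lambda>f. \<Sum>i<m. nat \<bar>f i\<bar>"]) auto
    finally show ?thesis .
  qed
  define q where "q = p ^ (2 * M + 1)"
  have "2 * M + 1 < 2 ^ (2 * M + 1)" by (rule less_exp)
  also have "\<dots> \<le> q" unfolding q_def using prime_ge_2_nat[OF p] by (rule power_mono) simp
  finally have q: "2 * M < q" by simp
  let ?Q = "product_group {..<m} (\<lambda>_. integer_mod_group q)"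
  define \<alpha> where "\<alpha> f = (\<lambda>i\<in>{..<m}. f i mod int q)" for f :: "nat \<Rightarrow> int"
  have comm: "comm_group (integer_mod_group q)"
    by (rule group.group_comm_groupI) (simp_all add: add.commute)
  have carr: "carrier (integer_mod_group q) = {0..<int q}" using q by (simp add: carrier_integer_mod_group)
  have "card (carrier ?Q) = q ^ m" by (simp add: card_PiE carr)
  also have "\<dots> = p ^ ((2 * M + 1) * m)" by (simp only: q_def power_mult)
  finally have "finite_p_group p ?Q"
    unfolding finite_p_group_def order_def using carr by (auto intro!: finite_PiE)
  moreover have "comm_group ?Q" using comm by (intro comm_group_product_group)
  moreover have "\<alpha> \<in> hom (product_group {..<m} (\<lambda>_. integer_group)) ?Q"
  proof (rule homI)
    fix f g assume "f \<in> carrier (product_group {..<m} (\<lambda>_. integer_group))"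
      "g \<in> carrier (product_group {..<m} (\<lambda>_. integer_group))"
    show "\<alpha> (f \<otimes>\<^bsub>product_group {..<m} (\<lambda>_. integer_group)\<^esub> g) = \<alpha> f \<otimes>\<^bsub>?Q\<^esub> \<alpha> g"
      by (rule ext) (simp add: \<alpha>_def restrict_def mod_add_eq)
  qed (use q in \<open>auto simp: \<alpha>_def carr\<close>)
  moreover have "inj_on \<alpha> S"
  proof (rule inj_onI)
    fix f g assume fg: "f \<in> S" "g \<in> S" "\<alpha> f = \<alpha> g"
    have "f i = g i" if i: "i < m" for i
    proof -
      have "\<alpha> f i = \<alpha> g i" using fg by simp
      then have dvd: "int q dvd f i - g i" using i by (simp add: \<alpha>_def mod_eq_dvd_iff)
      have "\<bar>f i - g i\<bar> < int q" using bound[OF fg(1) i] bound[OF fg(2) i] q by linarith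
      then show ?thesis using dvd zdvd_imp_le[of "int q" "\<bar>f i - g i\<bar>"] by force
    qed
    then show "f = g" using fg S by (intro PiE_ext[of f "{..<m}" "\<lambda>_. UNIV" g]) auto
  qed
  ultimately show ?thesis by blast
qed

theorem (in contracting_branch_group) wreath_of_integer_vectors:
  fixes m :: nat
  shows
  "p_conjugacy_separable p (wreath_product (product_group {..<m} (\<lambda>_. integer_group)) G)"
proof (rule wreath_p_conjugacy_separable[OF p_prime])
  show "comm_group (product_group {..<m} (\<lambda>_. integer_group))"
    by (rule comm_group_product_group) (rule group.group_comm_groupI, simp_all)
  show "\<exists>(Q :: (nat \<Rightarrow> int) monoid) \<alpha>. finite_p_group p Q \<and> comm_group Q \<and>
      \<alpha> \<in> hom (product_group {..<m} (\<lambda>_. integer_group)) Q \<and> inj_on \<alpha> S"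
    if "finite S" "S \<subseteq> carrier (product_group {..<m} (\<lambda>_. integer_group))" for S
    using integer_vectors_separated[OF p_prime that] .
  show "\<exists>(Q :: (nat list \<Rightarrow> nat list) set monoid) \<pi>. finite_p_group p Q \<and> \<pi> \<in> hom G Q \<and> inj_on \<pi> S"
    if S: "finite S" "S \<subseteq> carrier G" for S
  proof -
    obtain n where n: "inj_on (\<lambda>g. R n #> g) S" using finite_subset_separated[OF S] by blast
    have "(\<lambda>g. R n #> g) \<in> hom G (G Mod R n)" by (rule normal.r_coset_hom_Mod[OF R_normal])
    then show ?thesis using n finite_p_group_quotient by blast
  qed
qed (use conjugacy_separable torsion in blast)+

theorem corollary1p3:
  fixes p m :: nat
  assumes "Factorial_Ring.prime p"
  shows "p_conjugacy_separable p
    (wreath_product (product_group {..<m} (\<lambda>_. integer_group))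
       (if p = 2 then grigorchuk_group else gupta_sidki_group p))"
proof (cases "p = 2")
  case True
  interpret grigorchuk .
  show ?thesis using True wreath_of_integer_vectors by simp
next
  case False
  then have "p \<ge> 3" using prime_ge_2_nat[OF assms] by simp
  then interpret gupta_sidki p using assms by (simp add: gupta_sidki_def)
  show ?thesis using False wreath_of_integer_vectors by simp
qed

end
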